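(* Let $(K,v)$ be a valued field with value group $\Gamma=v(K^* )$. Every valuation on $K[x]$ whose restriction to $K$ is equivalent to $v$ is equivalent to some $\mathbb{R}^{\mathbb{I}}_{\mathrm{lex}}$-valued valuation $$\nu\colon K[x]\longrightarrow \mathbb{R}^{\mathbb{I}}_{\mathrm{lex}}\cup\{\infty\}$$ such that $\Gamma_\nu\subset\mathbb{R}_{\mathrm{sme}}$. If $\nu/v$ is commensurable, or preserves the rank, then $\Gamma_\nu\subset\Gamma_{\mathbb{Q}}$, or $\Gamma_\nu\subset\mathbb{R}^I_{\mathrm{lex}}$, respectively.
   Context: Valuations on $K[x]$ take values in $\Omega\infty=\Omega\cup\{\infty\}$ for an ordered abelian group $\Omega$, and may have nontrivial support: $\mathfrak{p}_\mu=\mu^{-1}(\infty)$ is a prime ideal of $K[x]$. $\Gamma_\mu\subset\Omega$ denotes the subgroup generated by $\mu(K[x]\setminus\mathfrak{p}_\mu)$. Valuations $\mu,\nu$ are equivalent if there is an isomorphism of ordered groups $\varphi\colon\Gamma_\mu\to\Gamma_\nu$ (extended by $\varphi(\infty)=\infty$) with $\nu=\varphi\circ\mu$; similarly for valuations on $K$. If $\mu_{|K}$ is equivalent to $v$, there is an induced embedding of ordered groups $\iota\colon\Gamma\hookrightarrow\Gamma_\mu$ with $\mu_{|K}=\iota\circ v$; one says that $\mu/v$ is commensurable, or preserves the rank, if the extension $\iota$ has the property. An extension $\Gamma\hookrightarrow\Lambda$ of ordered groups is commensurable if $\Lambda/\Gamma$ is a torsion group; it preserves the rank if the induced embedding $\mathrm{Prin}(\Gamma)\hookrightarrow\mathrm{Prin}(\Lambda)$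 (convex subgroup $\mapsto$ convex subgroup generated in $\Lambda$) is onto, where $\mathrm{Prin}(G)$ is the set of nonzero principal convex subgroups of $G$ (those generated by one nonzero element), ordered by descending inclusion. Let $I=\mathrm{Prin}(\Gamma)$. For an ordered set $J$, $\mathbb{R}^J_{\mathrm{lex}}$ (Hahn product) is the group of all $(x_j)\in\mathbb{R}^J$ with well-ordered support, ordered lexicographically. For $J\subset J'$, $\mathbb{R}^J_{\mathrm{lex}}\subset\mathbb{R}^{J'}_{\mathrm{lex}}$ via extension by zero. $\mathrm{Init}(I)$ is the set of initial segments of $I$ (including $\emptyset$ and $I$). For $S\in\mathrm{Init}(I)$, $I_S=S+\{i_S\}+S^c$ is the ordered set obtained by adding to $I$ a new element $i_S$ with $S<i_S<I\setminus S$. $\mathbb{I}=I\cup\{i_S\mid S\in\mathrm{Init}(I)\}$ has the total ordering extending that of every $I_S$ and with $i_S<i_T\iff S\subsetneq T$. Put $\mathbb{R}_{\mathrm{sme}}=\bigcup_{S\in\mathrm{Init}(I)}\mathbb{R}^{I_S}_{\mathrm{lex}}\subset\mathbb{R}^{\mathbb{I}}_{\mathrm{lex}}$. An embedding $\ell$ is fixed as follows. Let $\Gamma_{\mathbb{Q}}=\Gamma\otimes_{\mathbb{Z}}\mathbb{Q}$ be the divisible hull (with $\mathrm{Prin}(\Gamma_{\mathbb{Q}})=I$) and let $Q_i$ be its components: $Q_i=H_i/H_i^*$, where $H_i$ is the principal convex subgroup of index $i$ and $H_i^*$ is the union of all principal convex subgroups strictly contained in it. Fix an embedding $Q_i\hookrightarrow\mathbb{R}$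 of ordered groups for each $i$, and Hahn's immediate $\mathbb{Q}$-linear embedding of $\Gamma_{\mathbb{Q}}$ into the Hahn product of the $Q_i$, hence into $\mathbb{R}^I_{\mathrm{lex}}$. The composition $\ell\colon\Gamma\hookrightarrow\Gamma_{\mathbb{Q}}\hookrightarrow\mathbb{R}^I_{\mathrm{lex}}\subset\mathbb{R}_{\mathrm{sme}}\subset\mathbb{R}^{\mathbb{I}}_{\mathrm{lex}}$ is rank-preserving, and $\Gamma$, $\Gamma_{\mathbb{Q}}$ are identified with their images. *)

theory Defs
  imports "HOL-Algebra.Generated_Groups" "HOL-Computational_Algebra.Polynomial" Complex_Main
begin

text \<open>
  Ordered abelian groups are written multiplicatively, as commutative groups of HOL-Algebra with
  an order on the carrier: the neutral element \<open>\<one>\<close> is the zero of the group and \<open>x [^] n\<close> is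
  the multiple \<open>n x\<close>. Explicit carriers are needed because the index sets of the Hahn products
  below depend on the value group.
\<close>

record 'a ogroup = "'a monoid" +
  gle :: "'a \<Rightarrow> 'a \<Rightarrow> bool" (infix \<open>\<preceq>\<index>\<close> 50)

locale ordered_comm_group = comm_group G for G :: "'a ogroup" (structure) +
  assumes gle_refl: "x \<in> carrier G \<Longrightarrow> x \<preceq> x"
    and gle_antisym: "\<lbrakk>x \<in> carrier G; y \<in> carrier G; x \<preceq> y; y \<preceq> x\<rbrakk> \<Longrightarrow> x = y"
    and gle_trans: "\<lbrakk>x \<in> carrier G; y \<in> carrier G; z \<in> carrier G; x \<preceq> y; y \<preceq> z\<rbrakk> \<Longrightarrow> x \<preceq> z"
    and gle_total: "\<lbrakk>x \<in> carrier G; y \<in> carrier G\<rbrakk> \<Longrightarrow> x \<preceq> y \<or> y \<preceq> x"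
    and gle_mult: "\<lbrakk>x \<in> carrier G; y \<in> carrier G; z \<in> carrier G; x \<preceq> y\<rbrakk> \<Longrightarrow> z \<otimes> x \<preceq> z \<otimes> y"

definition real_ogroup :: "real ogroup" where
  "real_ogroup = \<lparr>carrier = UNIV, monoid.mult = (+), one = 0, gle = (\<le>)\<rparr>"

text \<open>Embeddings are injective by antisymmetry.\<close>

definition ogroup_emb :: "'a ogroup \<Rightarrow> 'b ogroup \<Rightarrow> ('a \<Rightarrow> 'b) set" where
  "ogroup_emb G L =
     {f \<in> hom G L. \<forall>x\<in>carrier G. \<forall>y\<in>carrier G. x \<preceq>\<^bsub>G\<^esub> y \<longleftrightarrow> f x \<preceq>\<^bsub>L\<^esub> f y}"

definition ogroup_iso :: "'a ogroup \<Rightarrow> 'b ogroup \<Rightarrow> ('a \<Rightarrow> 'b) set" where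
  "ogroup_iso G L = ogroup_emb G L \<inter> iso G L"

definition convex_subgroup :: "'a set \<Rightarrow> 'a ogroup \<Rightarrow> bool" where
  "convex_subgroup H G \<longleftrightarrow> subgroup H G \<and>
     (\<forall>x\<in>H. \<forall>y\<in>carrier G. \<one>\<^bsub>G\<^esub> \<preceq>\<^bsub>G\<^esub> y \<and> y \<preceq>\<^bsub>G\<^esub> x \<longrightarrow> y \<in> H)"

definition convex_hull_group :: "'a ogroup \<Rightarrow> 'a set \<Rightarrow> 'a set" where
  "convex_hull_group G A = \<Inter>{H. convex_subgroup H G \<and> A \<subseteq> H}"

definition Prin :: "'a ogroup \<Rightarrow> 'a set set" where
  "Prin G = {convex_hull_group G {x} | x. x \<in> carrier G \<and> x \<noteq> \<one>\<^bsub>G\<^esub>}"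

text \<open>
  An ordered set is given by its reflexive order relation \<open>r\<close>; its elements form \<open>Field r\<close>.
  \<open>Prin_rel G\<close> is \<open>Prin G\<close> with the order by descending inclusion.
\<close>

definition Prin_rel :: "'a ogroup \<Rightarrow> 'a set rel" where
  "Prin_rel G = {(H, H'). H \<in> Prin G \<and> H' \<in> Prin G \<and> H' \<subseteq> H}"

text \<open>
  The subgroup \<open>H\<^sup>*\<close>. The neutral element is added because there may be no
  nonzero principal convex subgroup strictly contained in \<open>H\<close>.
\<close>

definition lower_subgroup :: "'a ogroup \<Rightarrow> 'a set \<Rightarrow> 'a set" where
  "lower_subgroup G H = insert \<one>\<^bsub>G\<^esub> (\<Union>{H' \<in> Prin G. H' \<subset> H})"

text \<open>The quotient \<open>H / H\<^sup>*\<close>, with the order induced from \<open>H\<close>.\<close>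

definition component :: "'a ogroup \<Rightarrow> 'a set \<Rightarrow> 'a set ogroup" where
  "component G H = (let Q = (G\<lparr>carrier := H\<rparr>) Mod (lower_subgroup G H) in
     \<lparr>carrier = carrier Q, monoid.mult = monoid.mult Q, one = one Q,
      gle = (\<lambda>A B. \<exists>a\<in>A. \<exists>b\<in>B. a \<preceq>\<^bsub>G\<^esub> b)\<rparr>)"

definition commensurable_ext :: "'a ogroup \<Rightarrow> 'b ogroup \<Rightarrow> ('a \<Rightarrow> 'b) \<Rightarrow> bool" where
  "commensurable_ext G L f \<longleftrightarrow> (let Q = L Mod (f ` carrier G) in
     \<forall>x\<in>carrier Q. \<exists>n::nat. n > 0 \<and> x [^]\<^bsub>Q\<^esub> n = \<one>\<^bsub>Q\<^esub>)"

definition rank_preserving :: "'a ogroup \<Rightarrow> 'b ogroup \<Rightarrow> ('a \<Rightarrow> 'b) \<Rightarrow> bool" where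
  "rank_preserving G L f \<longleftrightarrow> (\<lambda>H. convex_hull_group L (f ` H)) ` Prin G = Prin L"

text \<open>
  Immediate: the rank is preserved and all induced maps between components are isomorphisms.
  The map displayed sends the class of \<open>a\<close> to the class of \<open>f a\<close>.
\<close>

definition immediate_ext :: "'a ogroup \<Rightarrow> 'b ogroup \<Rightarrow> ('a \<Rightarrow> 'b) \<Rightarrow> bool" where
  "immediate_ext G L f \<longleftrightarrow> rank_preserving G L f \<and>
     (\<forall>H\<in>Prin G. let H' = convex_hull_group L (f ` H) in
        (\<lambda>A. \<Union>a\<in>A. lower_subgroup L H' #>\<^bsub>L\<^esub> f a) \<in> ogroup_iso (component G H) (component L H'))"

text \<open>
  The group \<open>G \<otimes> \<rat>\<close>, realized as the group of fractions: the class of \<open>(x, n)\<close> stands for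
  \<open>x \<otimes> 1/n\<close>. As \<open>G\<close> is torsion-free, \<open>x/m = y/n\<close> if and only if \<open>n x = m y\<close>.
\<close>

definition frac_rel :: "'a ogroup \<Rightarrow> ('a \<times> nat) rel" where
  "frac_rel G = {((x, m), (y, n)). x \<in> carrier G \<and> y \<in> carrier G \<and> m > 0 \<and> n > 0 \<and>
     x [^]\<^bsub>G\<^esub> n = y [^]\<^bsub>G\<^esub> m}"

definition div_hull :: "'a ogroup \<Rightarrow> ('a \<times> nat) set ogroup" where
  "div_hull G =
     \<lparr>carrier = (carrier G \<times> {0<..}) // frac_rel G,
      monoid.mult = (\<lambda>X Y. \<Union>(x, m)\<in>X. \<Union>(y, n)\<in>Y.
        frac_rel G `` {(x [^]\<^bsub>G\<^esub> n \<otimes>\<^bsub>G\<^esub> y [^]\<^bsub>G\<^esub> m, m * n)}),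
      one = frac_rel G `` {(\<one>\<^bsub>G\<^esub>, 1)},
      gle = (\<lambda>X Y. \<exists>(x, m)\<in>X. \<exists>(y, n)\<in>Y. x [^]\<^bsub>G\<^esub> n \<preceq>\<^bsub>G\<^esub> y [^]\<^bsub>G\<^esub> m)\<rparr>"

definition to_hull :: "'a ogroup \<Rightarrow> 'a \<Rightarrow> ('a \<times> nat) set" where
  "to_hull G x = frac_rel G `` {(x, 1)}"

text \<open>
  The Hahn product of the family \<open>Q\<close> over the ordered set \<open>r\<close>. Its elements take the value zero
  outside the index set, so that \<open>hahn_real (Restr r J) \<subseteq> hahn_real r\<close> is extension by zero.
\<close>

definition hahn :: "'i rel \<Rightarrow> ('i \<Rightarrow> 'a ogroup) \<Rightarrow> ('i \<Rightarrow> 'a) ogroup" where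
  "hahn r Q =
     \<lparr>carrier = {f. (\<forall>i\<in>Field r. f i \<in> carrier (Q i)) \<and> (\<forall>i. i \<notin> Field r \<longrightarrow> f i = \<one>\<^bsub>Q i\<^esub>) \<and>
        (let supp = {i. f i \<noteq> \<one>\<^bsub>Q i\<^esub>} in well_order_on supp (Restr r supp))},
      monoid.mult = (\<lambda>f g i. if i \<in> Field r then f i \<otimes>\<^bsub>Q i\<^esub> g i else \<one>\<^bsub>Q i\<^esub>),
      one = (\<lambda>i. \<one>\<^bsub>Q i\<^esub>),
      gle = (\<lambda>f g. f = g \<or> (\<exists>i\<in>Field r. f i \<noteq> g i \<and> f i \<preceq>\<^bsub>Q i\<^esub> g i \<and>
        (\<forall>j. (j, i) \<in> r \<and> j \<noteq> i \<longrightarrow> f j = g j)))\<rparr>"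

abbreviation hahn_real :: "'i rel \<Rightarrow> ('i \<Rightarrow> real) ogroup" where
  "hahn_real r \<equiv> hahn r (\<lambda>_. real_ogroup)"

text \<open>
  \<open>Old i\<close> is the element \<open>i\<close> of \<open>I\<close> and \<open>Cut S\<close> is the new element \<open>i_S\<close>; the predicate
  \<open>ofilter r\<close> of the library describes the initial segments of \<open>r\<close>.
\<close>

datatype 'i cut_idx = Old 'i | Cut "'i set"

fun cut_le :: "'i rel \<Rightarrow> 'i cut_idx \<Rightarrow> 'i cut_idx \<Rightarrow> bool" where
  "cut_le r (Old i) (Old j) \<longleftrightarrow> (i, j) \<in> r"
| "cut_le r (Old i) (Cut S) \<longleftrightarrow> i \<in> S"
| "cut_le r (Cut S) (Old i) \<longleftrightarrow> i \<notin> S"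
| "cut_le r (Cut S) (Cut T) \<longleftrightarrow> S \<subseteq> T"

definition cut_rel :: "'i rel \<Rightarrow> 'i cut_idx rel" where
  "cut_rel r = (let J = Old ` Field r \<union> Cut ` {S. ofilter r S} in
     {(k, l). k \<in> J \<and> l \<in> J \<and> cut_le r k l})"

definition R_cut :: "'g ogroup \<Rightarrow> ('g set cut_idx \<Rightarrow> real) ogroup" where
  "R_cut \<Gamma> = hahn_real (cut_rel (Prin_rel \<Gamma>))"

definition R_old :: "'g ogroup \<Rightarrow> ('g set cut_idx \<Rightarrow> real) set" where
  "R_old \<Gamma> = carrier (hahn_real (Restr (cut_rel (Prin_rel \<Gamma>)) (Old ` Prin \<Gamma>)))"

definition R_sme :: "'g ogroup \<Rightarrow> ('g set cut_idx \<Rightarrow> real) set" where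
  "R_sme \<Gamma> = (\<Union>S \<in> {S. ofilter (Prin_rel \<Gamma>) S}.
     carrier (hahn_real (Restr (cut_rel (Prin_rel \<Gamma>)) (Old ` Prin \<Gamma> \<union> {Cut S}))))"

text \<open>
  The component of \<open>\<Gamma>\<^sub>\<rat>\<close> of index \<open>i \<in> Prin \<Gamma>\<close>; the sets \<open>Prin \<Gamma>\<close> and \<open>Prin \<Gamma>\<^sub>\<rat>\<close> are
  identified by means of \<open>\<Gamma> \<rightarrow> \<Gamma>\<^sub>\<rat>\<close>.
\<close>

definition hull_component :: "'g ogroup \<Rightarrow> 'g set \<Rightarrow> ('g \<times> nat) set set ogroup" where
  "hull_component \<Gamma> i =
     component (div_hull \<Gamma>) (convex_hull_group (div_hull \<Gamma>) (to_hull \<Gamma> ` i))"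

text \<open>
  The data chosen: an embedding \<open>e i\<close> of each component into \<open>\<real>\<close>, and an immediate embedding \<open>h\<close>
  of \<open>\<Gamma>\<^sub>\<rat>\<close> into the Hahn product of its components. Additive maps between vector spaces over
  \<open>\<rat>\<close> are linear, so \<open>\<rat>\<close>-linearity of \<open>h\<close> need not be demanded separately.
\<close>

definition hahn_embedding ::
  "'g ogroup \<Rightarrow> ('g set \<Rightarrow> ('g \<times> nat) set set \<Rightarrow> real) \<Rightarrow>
   (('g \<times> nat) set \<Rightarrow> 'g set \<Rightarrow> ('g \<times> nat) set set) \<Rightarrow> bool" where
  "hahn_embedding \<Gamma> e h \<longleftrightarrow>
     (\<forall>i\<in>Prin \<Gamma>. e i \<in> ogroup_emb (hull_component \<Gamma> i) real_ogroup) \<and>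
     (let P = hahn (Prin_rel \<Gamma>) (hull_component \<Gamma>) in
        h \<in> ogroup_emb (div_hull \<Gamma>) P \<and> immediate_ext (div_hull \<Gamma>) P h)"

text \<open>The composition \<open>\<Gamma>\<^sub>\<rat> \<rightarrow> \<real>\<^sup>I \<subseteq> \<real>\<^sup>\<I>\<close>, and its image.\<close>

definition hull_to_R ::
  "'g ogroup \<Rightarrow> ('g set \<Rightarrow> ('g \<times> nat) set set \<Rightarrow> real) \<Rightarrow>
   (('g \<times> nat) set \<Rightarrow> 'g set \<Rightarrow> ('g \<times> nat) set set) \<Rightarrow>
   ('g \<times> nat) set \<Rightarrow> 'g set cut_idx \<Rightarrow> real" where
  "hull_to_R \<Gamma> e h x k =
     (case k of Old i \<Rightarrow> if i \<in> Prin \<Gamma> then e i (h x i) else 0 | Cut S \<Rightarrow> 0)"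

definition hull_image ::
  "'g ogroup \<Rightarrow> ('g set \<Rightarrow> ('g \<times> nat) set set \<Rightarrow> real) \<Rightarrow>
   (('g \<times> nat) set \<Rightarrow> 'g set \<Rightarrow> ('g \<times> nat) set set) \<Rightarrow> ('g set cut_idx \<Rightarrow> real) set" where
  "hull_image \<Gamma> e h = hull_to_R \<Gamma> e h ` carrier (div_hull \<Gamma>)"

datatype 'a with_inf = Fin 'a | Infty

fun inf_add :: "'a ogroup \<Rightarrow> 'a with_inf \<Rightarrow> 'a with_inf \<Rightarrow> 'a with_inf" where
  "inf_add G (Fin x) (Fin y) = Fin (x \<otimes>\<^bsub>G\<^esub> y)"
| "inf_add G _ _ = Infty"

fun inf_le :: "'a ogroup \<Rightarrow> 'a with_inf \<Rightarrow> 'a with_inf \<Rightarrow> bool" where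
  "inf_le G (Fin x) (Fin y) \<longleftrightarrow> x \<preceq>\<^bsub>G\<^esub> y"
| "inf_le G Infty (Fin y) \<longleftrightarrow> False"
| "inf_le G _ Infty \<longleftrightarrow> True"

definition inf_min :: "'a ogroup \<Rightarrow> 'a with_inf \<Rightarrow> 'a with_inf \<Rightarrow> 'a with_inf" where
  "inf_min G a b = (if inf_le G a b then a else b)"

text \<open>Nonzero elements may have the value \<open>Infty\<close>.\<close>

locale valuation = ordered_comm_group G
  for G :: "'a ogroup" and \<mu> :: "'r::comm_ring_1 \<Rightarrow> 'a with_inf" +
  assumes val_closed: "\<mu> f = Fin x \<Longrightarrow> x \<in> carrier G"
    and val_zero: "\<mu> 0 = Infty"
    and val_one: "\<mu> 1 = Fin \<one>\<^bsub>G\<^esub>"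
    and val_mult: "\<mu> (f * g) = inf_add G (\<mu> f) (\<mu> g)"
    and val_add: "inf_le G (inf_min G (\<mu> f) (\<mu> g)) (\<mu> (f + g))"

definition value_group :: "'a ogroup \<Rightarrow> ('r \<Rightarrow> 'a with_inf) \<Rightarrow> 'a ogroup" where
  "value_group G \<mu> = subgroup_generated G {x. \<exists>f. \<mu> f = Fin x}"

lemma inf_add_eq_Infty_iff: "inf_add G a b = Infty \<longleftrightarrow> a = Infty \<or> b = Infty"
  by (cases a; cases b) auto

text \<open>On a field, only zero has the value \<open>Infty\<close>, and \<open>value_group G v\<close> is \<open>v(K\<^sup>*)\<close>.\<close>

lemma valuation_field_eq_Infty_iff:
  fixes v :: "'k::field \<Rightarrow> 'a with_inf"
  assumes "valuation G v"
  shows "v c = Infty \<longleftrightarrow> c = 0"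
proof
  interpret valuation G v by fact
  show "v c = Infty" if "c = 0" using that val_zero by simp
  show "c = 0" if "v c = Infty"
  proof (rule ccontr)
    assume "c \<noteq> 0"
    then have "inf_add G (v c) (v (inverse c)) = Fin \<one>\<^bsub>G\<^esub>"
      by (simp add: val_one flip: val_mult)
    with that show False by simp
  qed
qed

lemma carrier_value_group_field:
  fixes v :: "'k::field \<Rightarrow> 'a with_inf"
  assumes "valuation G v"
  shows "Fin ` carrier (value_group G v) = v ` (UNIV - {0})"
proof -
  interpret valuation G v by fact
  let ?A = "{x. \<exists>c. v c = Fin x}"
  have A: "?A \<subseteq> carrier G" using val_closed by auto
  have "x \<in> ?A" if "x \<in> generate G ?A" for x
    using that
  proof induction
    case one
    show ?case using val_one by auto
  next
    case (incl x)
    then show ?case .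
  next
    case (inv x)
    then obtain c where c: "v c = Fin x" by auto
    then have "c \<noteq> 0" using val_zero by auto
    then have 1: "inf_add G (v (inverse c)) (v c) = Fin \<one>\<^bsub>G\<^esub>"
      by (simp add: val_one flip: val_mult)
    then obtain y where y: "v (inverse c) = Fin y" using c by (cases "v (inverse c)") auto
    have "inv\<^bsub>G\<^esub> x = y" using 1 c y val_closed by (auto intro: inv_equality)
    then show ?case using y by auto
  next
    case (eng x y)
    then obtain c d where "v c = Fin x" "v d = Fin y" by auto
    then have "v (c * d) = Fin (x \<otimes>\<^bsub>G\<^esub> y)" by (simp add: val_mult)
    then show ?case by auto
  qed
  moreover have "?A \<subseteq> generate G ?A" by (auto intro: generate.incl)
  ultimately have "generate G ?A = ?A" by auto
  moreover have "carrier G \<inter> ?A = ?A" using A by auto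
  ultimately have "carrier (value_group G v) = ?A"
    by (simp add: value_group_def carrier_subgroup_generated)
  moreover have "Fin ` ?A = v ` (UNIV - {0})" (is "?L = ?R")
  proof
    show "?L \<subseteq> ?R"
    proof
      fix a assume "a \<in> ?L"
      then obtain c x where c: "a = v c" "v c = Fin x" by force
      then have "c \<noteq> 0" using valuation_field_eq_Infty_iff[OF assms, of c] by simp
      with c show "a \<in> ?R" by blast
    qed
    show "?R \<subseteq> ?L"
    proof
      fix a assume "a \<in> ?R"
      then obtain c where c: "a = v c" "c \<noteq> 0" by blast
      then have "v c \<noteq> Infty" using valuation_field_eq_Infty_iff[OF assms, of c] by simp
      then obtain x where "v c = Fin x" by (cases "v c") auto
      with c show "a \<in> ?L" by auto
    qed
  qed
  ultimately show ?thesis by simp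
qed

definition val_equiv ::
  "'a ogroup \<Rightarrow> ('r \<Rightarrow> 'a with_inf) \<Rightarrow> 'b ogroup \<Rightarrow> ('r \<Rightarrow> 'b with_inf) \<Rightarrow> bool" where
  "val_equiv G \<mu> L \<nu> \<longleftrightarrow>
     (\<exists>\<phi> \<in> ogroup_iso (value_group G \<mu>) (value_group L \<nu>). \<forall>f. \<nu> f = map_with_inf \<phi> (\<mu> f))"

definition restrict_val :: "('k::zero poly \<Rightarrow> 'a with_inf) \<Rightarrow> 'k \<Rightarrow> 'a with_inf" where
  "restrict_val \<mu> c = \<mu> [:c:]"

text \<open>
  The embedding \<open>\<Gamma> \<rightarrow> \<Gamma>\<^sub>\<mu>\<close> induced by an extension \<open>\<mu>/v\<close>; it is unique on \<open>\<Gamma>\<close>.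
\<close>

definition induced_emb ::
  "'g ogroup \<Rightarrow> ('k::field \<Rightarrow> 'g with_inf) \<Rightarrow> 'a ogroup \<Rightarrow> ('k poly \<Rightarrow> 'a with_inf) \<Rightarrow>
   ('g \<Rightarrow> 'a) set" where
  "induced_emb G v L \<mu> = {\<iota> \<in> ogroup_emb (value_group G v) (value_group L \<mu>).
     \<forall>c. restrict_val \<mu> c = map_with_inf \<iota> (v c)}"

definition val_commensurable ::
  "'g ogroup \<Rightarrow> ('k::field \<Rightarrow> 'g with_inf) \<Rightarrow> 'a ogroup \<Rightarrow> ('k poly \<Rightarrow> 'a with_inf) \<Rightarrow> bool" where
  "val_commensurable G v L \<mu> \<longleftrightarrow>
     (\<exists>\<iota>\<in>induced_emb G v L \<mu>. commensurable_ext (value_group G v) (value_group L \<mu>) \<iota>)"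

definition val_rank_preserving ::
  "'g ogroup \<Rightarrow> ('k::field \<Rightarrow> 'g with_inf) \<Rightarrow> 'a ogroup \<Rightarrow> ('k poly \<Rightarrow> 'a with_inf) \<Rightarrow> bool" where
  "val_rank_preserving G v L \<mu> \<longleftrightarrow>
     (\<exists>\<iota>\<in>induced_emb G v L \<mu>. rank_preserving (value_group G v) (value_group L \<mu>) \<iota>)"

end

theory Submission
  imports Defs
begin

text \<open>
  Write \<open>\<Gamma>\<close> for the value group of \<open>v\<close>, \<open>\<Lambda>\<close> for that of \<open>\<mu>\<close>, and \<open>\<iota> : \<Gamma> \<rightarrow> \<Lambda>\<close> for the embedding
  given by the equivalence of \<open>v\<close> with the restriction of \<open>\<mu>\<close>. It suffices to extend the given
  embedding of \<open>\<Gamma>\<close> into the real Hahn product along \<open>\<iota>\<close> to an embedding \<open>\<Phi>\<close> of \<open>\<Lambda>\<close>, because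
  \<open>\<Phi> \<circ> \<mu>\<close> is then a valuation equivalent to \<open>\<mu>\<close>.

  Modulo torsion, \<open>\<Lambda> / \<iota>(\<Gamma>)\<close> has rank at most one (\<open>rational_rank_le_one\<close>): if the values of
  \<open>f\<close> and \<open>g\<close> were independent, then the monomials \<open>f\<^sup>i g\<^sup>j\<close> would have distinct values modulo
  \<open>\<Gamma>\<close> and hence be linearly independent over \<open>K\<close>, but their number grows quadratically with the
  degree. So \<open>\<Lambda>\<close> is contained, up to torsion, in \<open>\<iota>(\<Gamma>) + \<int>\<gamma>\<close> for one value \<open>\<gamma>\<close>. As the real
  Hahn product is divisible and torsion-free, \<open>\<Phi>\<close> is determined by the image \<open>x\<close> of \<open>\<gamma>\<close>, and the
  only condition is that \<open>x\<close> makes the same cut in the divisible hull of \<open>\<Gamma>\<close> as \<open>\<gamma>\<close> does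
  (\<open>extend_embedding\<close>).

  Every cut in the divisible hull is realized (\<open>cut_realized\<close>). Approximate the cut by elements of
  the hull at finer and finer scales. Two approximations at scale \<open>i\<close> have the same
  coordinates up to \<open>i\<close>, so the approximations glue to one element \<open>y\<close>, defined on the initial
  segment \<open>S\<close> of those scales at which an approximation exists. If no element of the hull is an
  approximation at all scales in \<open>S\<close>, then \<open>y\<close> realizes the cut. Otherwise let \<open>g\<close> be such
  an element. If the cut separates two such elements, their first difference is the least index
  outside \<open>S\<close>, and a supremum of real numbers provides the coordinate that is missing
  there. If it does not, then the distance from \<open>g\<close> to the cut is smaller than all scales in \<open>S\<close>
  and larger than all others; this is the one case in which the new index \<open>i\<^sub>S\<close> is used.

  In this last case \<open>\<Lambda>\<close> contains an element with leading index \<open>i\<^sub>S\<close>. It generates a principal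
  convex subgroup that no element of \<open>\<Gamma>\<close> generates (\<open>not_rank_preserving\<close>), whence the claim on
  rank-preserving extensions. The claim on commensurable extensions follows from
  torsion-freeness (\<open>torsion_in_hull_image\<close>). That every index is the leading index of some
  element of the hull, which the notion of scale presupposes, is the part of immediacy of Hahn's
  embedding on which the argument rests (\<open>rank_preserving_leading_index\<close>).
\<close>

section \<open>Ordered abelian groups and their convex subgroups\<close>

context ordered_comm_group
begin

lemma gle_mult_iff:
  assumes "x \<in> carrier G" "y \<in> carrier G" "z \<in> carrier G"
  shows "z \<otimes> x \<preceq> z \<otimes> y \<longleftrightarrow> x \<preceq> y"
proof
  assume "z \<otimes> x \<preceq> z \<otimes> y"
  then have "inv z \<otimes> (z \<otimes> x) \<preceq> inv z \<otimes> (z \<otimes> y)"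
    using assms by (intro gle_mult[of "z \<otimes> x" "z \<otimes> y" "inv z"]) auto
  moreover have "inv z \<otimes> (z \<otimes> w) = w" if "w \<in> carrier G" for w
    using that assms m_assoc[of "inv z" z w] by simp
  ultimately show "x \<preceq> y" using assms by simp
next
  show "x \<preceq> y \<Longrightarrow> z \<otimes> x \<preceq> z \<otimes> y" using assms gle_mult by blast
qed

lemma gle_mult_iff_right:
  assumes "x \<in> carrier G" "y \<in> carrier G" "z \<in> carrier G"
  shows "x \<otimes> z \<preceq> y \<otimes> z \<longleftrightarrow> x \<preceq> y"
  using gle_mult_iff[OF assms] assms by (simp add: m_comm)

lemma gle_mult_mono:
  assumes "a \<in> carrier G" "b \<in> carrier G" "c \<in> carrier G" "d \<in> carrier G" "a \<preceq> b" "c \<preceq> d"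
  shows "a \<otimes> c \<preceq> b \<otimes> d"
  using assms gle_trans[of "a \<otimes> c" "b \<otimes> c" "b \<otimes> d"] by (simp add: gle_mult_iff gle_mult_iff_right)

lemma gle_iff_quotient:
  assumes "x \<in> carrier G" "y \<in> carrier G"
  shows "x \<preceq> y \<longleftrightarrow> \<one> \<preceq> inv x \<otimes> y"
  using gle_mult_iff[of x y "inv x"] assms by simp

lemma inv_gle_inv_iff:
  assumes "x \<in> carrier G" "y \<in> carrier G"
  shows "inv x \<preceq> inv y \<longleftrightarrow> y \<preceq> x"
  using gle_iff_quotient[of "inv x" "inv y"] gle_iff_quotient[of y x] m_comm[of x "inv y"] assms
  by simp

lemma one_gle_inv_iff:
  assumes "x \<in> carrier G"
  shows "\<one> \<preceq> inv x \<longleftrightarrow> x \<preceq> \<one>"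
  using inv_gle_inv_iff[of \<one> x] assms by simp

lemma pow_mono:
  assumes "a \<in> carrier G" "b \<in> carrier G" "a \<preceq> b"
  shows "a [^] (n::nat) \<preceq> b [^] n"
  by (induction n) (use assms in \<open>auto intro: gle_refl gle_mult_mono\<close>)

lemma gle_pow:
  assumes "c \<in> carrier G" "\<one> \<preceq> c" "n > 0"
  shows "c \<preceq> c [^] (n::nat)"
proof -
  obtain m where m: "n = Suc m" using \<open>n > 0\<close> by (cases n) auto
  have "\<one> [^] m \<preceq> c [^] m" using assms by (intro pow_mono) auto
  then have "\<one> \<otimes> c \<preceq> c [^] m \<otimes> c" using assms by (subst gle_mult_iff_right) auto
  then show ?thesis using assms m by simp
qed

lemma pow_eq_one_imp_one:
  assumes "c \<in> carrier G" "n > 0" "c [^] (n::nat) = \<one>"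
  shows "c = \<one>"
proof -
  have *: "d = \<one>" if "d \<in> carrier G" "\<one> \<preceq> d" "d [^] n = \<one>" for d
    using gle_pow[of d n] that assms(2) gle_antisym[of d \<one>] by simp
  show ?thesis
  proof (cases "\<one> \<preceq> c")
    case True
    then show ?thesis using * assms by blast
  next
    case False
    then have "c \<preceq> \<one>" using gle_total assms by blast
    then have "inv c = \<one>" using *[of "inv c"] assms by (simp add: one_gle_inv_iff nat_pow_inv)
    then show ?thesis using assms by (metis inv_inv inv_one)
  qed
qed

lemma pow_eq_iff:
  assumes "a \<in> carrier G" "b \<in> carrier G" "n > 0"
  shows "a [^] (n::nat) = b [^] n \<longleftrightarrow> a = b"
proof
  assume "a [^] n = b [^] n"
  then have "(inv a \<otimes> b) [^] n = \<one>"
    using assms by (simp add: pow_mult_distrib m_comm nat_pow_inv)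
  then have "inv a \<otimes> b = \<one>" using assms pow_eq_one_imp_one[of "inv a \<otimes> b" n] by simp
  then show "a = b" using assms by (metis inv_closed inv_equality inv_inv)
qed auto

lemma pow_gle_iff:
  assumes "a \<in> carrier G" "b \<in> carrier G" "n > 0"
  shows "a [^] (n::nat) \<preceq> b [^] n \<longleftrightarrow> a \<preceq> b"
  using pow_mono[of a b n] pow_mono[of b a n] pow_eq_iff[of a b n] gle_antisym gle_total gle_refl assms
  by (metis nat_pow_closed)

lemma subgroup_ordered_comm_group:
  assumes "subgroup H G"
  shows "ordered_comm_group (G\<lparr>carrier := H\<rparr>)"
proof -
  have sub: "H \<subseteq> carrier G" using assms by (rule subgroup.subset)
  then interpret C: comm_group "G\<lparr>carrier := H\<rparr>"
    by (intro group.group_comm_groupI[OF subgroup_imp_group[OF assms]]) (auto simp: m_comm subset_iff)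
  have car: "x \<in> carrier G" if "x \<in> H" for x using that sub by blast
  show ?thesis
  proof
    fix x y z
    assume "x \<in> carrier (G\<lparr>carrier := H\<rparr>)" "y \<in> carrier (G\<lparr>carrier := H\<rparr>)" "z \<in> carrier (G\<lparr>carrier := H\<rparr>)"
    then have c: "x \<in> carrier G" "y \<in> carrier G" "z \<in> carrier G" using car by simp_all
    show "x \<preceq>\<^bsub>G\<lparr>carrier := H\<rparr>\<^esub> y \<Longrightarrow> y \<preceq>\<^bsub>G\<lparr>carrier := H\<rparr>\<^esub> z \<Longrightarrow> x \<preceq>\<^bsub>G\<lparr>carrier := H\<rparr>\<^esub> z"
      using gle_trans[OF c] by simp
    show "x \<preceq>\<^bsub>G\<lparr>carrier := H\<rparr>\<^esub> y \<Longrightarrow>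
        z \<otimes>\<^bsub>G\<lparr>carrier := H\<rparr>\<^esub> x \<preceq>\<^bsub>G\<lparr>carrier := H\<rparr>\<^esub> z \<otimes>\<^bsub>G\<lparr>carrier := H\<rparr>\<^esub> y"
      using gle_mult[OF c] by simp
  qed (use car gle_refl gle_antisym gle_total in auto)
qed

lemma convex_hull_convex:
  assumes "A \<subseteq> carrier G"
  shows "convex_subgroup (convex_hull_group G A) G"
proof -
  have ne: "{H. convex_subgroup H G \<and> A \<subseteq> H} \<noteq> {}"
    using assms by (auto simp: convex_subgroup_def intro!: exI[of _ "carrier G"] subgroup_self)
  show ?thesis
    unfolding convex_hull_group_def convex_subgroup_def
  proof (intro conjI ballI impI)
    show "subgroup (\<Inter> {H. (subgroup H G \<and> (\<forall>x\<in>H. \<forall>y\<in>carrier G. \<one> \<preceq> y \<and> y \<preceq> x \<longrightarrow> y \<in> H)) \<and> A \<subseteq> H}) G"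
      by (rule subgroups_Inter) (use ne in \<open>auto simp: convex_subgroup_def\<close>)
  qed blast
qed

lemma convex_hull_min: "convex_subgroup H G \<Longrightarrow> A \<subseteq> H \<Longrightarrow> convex_hull_group G A \<subseteq> H"
  by (auto simp: convex_hull_group_def)

lemma convex_hull_superset: "A \<subseteq> convex_hull_group G A"
  by (auto simp: convex_hull_group_def)

lemma convex_subgroup_between:
  assumes H: "convex_subgroup H G" and "a \<in> H" "c \<in> H" "b \<in> carrier G" "a \<preceq> b" "b \<preceq> c"
  shows "b \<in> H"
proof -
  have sub: "subgroup H G" using H by (simp add: convex_subgroup_def)
  have car: "a \<in> carrier G" "c \<in> carrier G" using sub assms subgroup.subset by blast+
  have "inv a \<otimes> c \<in> H" using sub assms by (auto simp: subgroup.m_closed subgroup.m_inv_closed)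
  moreover have "\<one> \<preceq> inv a \<otimes> b" using assms car gle_iff_quotient by blast
  moreover have "inv a \<otimes> b \<preceq> inv a \<otimes> c" using assms car by (simp add: gle_mult_iff)
  ultimately have "inv a \<otimes> b \<in> H"
    using H assms car unfolding convex_subgroup_def by (meson inv_closed m_closed)
  then have "a \<otimes> (inv a \<otimes> b) \<in> H" using sub assms by (simp add: subgroup.m_closed)
  then show ?thesis using assms car by (simp add: m_assoc[symmetric])
qed

lemma convex_subgroups_chain:
  assumes H: "convex_subgroup H G" and K: "convex_subgroup K G"
  shows "H \<subseteq> K \<or> K \<subseteq> H"
proof (rule ccontr)
  assume "\<not> ?thesis"
  then obtain x y where x: "x \<in> H" "x \<notin> K" and y: "y \<in> K" "y \<notin> H" by blast
  have sH: "subgroup H G" and sK: "subgroup K G" using H K by (auto simp: convex_subgroup_def)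
  have car: "x \<in> carrier G" "y \<in> carrier G" using sH sK x y subgroup.subset by blast+
  have pos: "\<exists>x'. x' \<in> A \<and> x' \<notin> B \<and> \<one> \<preceq> x' \<and> x' \<in> carrier G"
    if "subgroup A G" "subgroup B G" "x \<in> A" "x \<notin> B" for A B x
  proof -
    have c: "x \<in> carrier G" using that subgroup.subset by blast
    have "inv x \<in> A" "inv x \<notin> B"
      using that c by (auto simp: subgroup.m_inv_closed) (metis inv_inv subgroup.m_inv_closed)
    then show ?thesis using that c gle_total[of \<one> x] one_gle_inv_iff[of x] by blast
  qed
  obtain x' where x': "x' \<in> H" "x' \<notin> K" "\<one> \<preceq> x'" "x' \<in> carrier G" using pos sH sK x by blast
  obtain y' where y': "y' \<in> K" "y' \<notin> H" "\<one> \<preceq> y'" "y' \<in> carrier G" using pos sH sK y by blast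
  show False using gle_total[of x' y'] x' y' H K unfolding convex_subgroup_def by blast
qed

lemma Prin_convex: "H \<in> Prin G \<Longrightarrow> convex_subgroup H G"
  by (auto simp: Prin_def intro: convex_hull_convex)

lemma Prin_rel_Linear_order: "Linear_order (Prin_rel G)"
  and Field_Prin_rel: "Field (Prin_rel G) = Prin G"
proof -
  show F: "Field (Prin_rel G) = Prin G"
    by (auto simp: Prin_rel_def Field_def)
  show "Linear_order (Prin_rel G)"
    unfolding order_on_defs F
    using convex_subgroups_chain[OF Prin_convex Prin_convex]
    by (auto simp: Prin_rel_def refl_on_def trans_def antisym_def total_on_def)
qed

end

lemma ordered_comm_groupI:
  fixes G (structure)
  assumes "\<And>x y. x \<in> carrier G \<Longrightarrow> y \<in> carrier G \<Longrightarrow> x \<otimes> y \<in> carrier G"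
    and "\<one> \<in> carrier G"
    and "\<And>x y z. x \<in> carrier G \<Longrightarrow> y \<in> carrier G \<Longrightarrow> z \<in> carrier G \<Longrightarrow> (x \<otimes> y) \<otimes> z = x \<otimes> (y \<otimes> z)"
    and "\<And>x y. x \<in> carrier G \<Longrightarrow> y \<in> carrier G \<Longrightarrow> x \<otimes> y = y \<otimes> x"
    and "\<And>x. x \<in> carrier G \<Longrightarrow> \<one> \<otimes> x = x"
    and "\<And>x. x \<in> carrier G \<Longrightarrow> \<exists>y\<in>carrier G. y \<otimes> x = \<one>"
    and "\<And>x. x \<in> carrier G \<Longrightarrow> x \<preceq> x"
    and "\<And>x y. x \<in> carrier G \<Longrightarrow> y \<in> carrier G \<Longrightarrow> x \<preceq> y \<Longrightarrow> y \<preceq> x \<Longrightarrow> x = y"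
    and "\<And>x y z. x \<in> carrier G \<Longrightarrow> y \<in> carrier G \<Longrightarrow> z \<in> carrier G \<Longrightarrow> x \<preceq> y \<Longrightarrow> y \<preceq> z \<Longrightarrow> x \<preceq> z"
    and "\<And>x y. x \<in> carrier G \<Longrightarrow> y \<in> carrier G \<Longrightarrow> x \<preceq> y \<or> y \<preceq> x"
    and "\<And>x y z. x \<in> carrier G \<Longrightarrow> y \<in> carrier G \<Longrightarrow> z \<in> carrier G \<Longrightarrow> x \<preceq> y \<Longrightarrow> z \<otimes> x \<preceq> z \<otimes> y"
  shows "ordered_comm_group G"
proof -
  interpret comm_group G
    by (rule comm_groupI) (fact assms)+
  show ?thesis by unfold_locales (fact assms)+
qed

lemma ogroup_embD:
  assumes "f \<in> ogroup_emb G L"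
  shows "x \<in> carrier G \<Longrightarrow> f x \<in> carrier L"
    and "x \<in> carrier G \<Longrightarrow> y \<in> carrier G \<Longrightarrow> f (x \<otimes>\<^bsub>G\<^esub> y) = f x \<otimes>\<^bsub>L\<^esub> f y"
    and "x \<in> carrier G \<Longrightarrow> y \<in> carrier G \<Longrightarrow> x \<preceq>\<^bsub>G\<^esub> y \<longleftrightarrow> f x \<preceq>\<^bsub>L\<^esub> f y"
  using assms by (auto simp: ogroup_emb_def hom_def)

locale ogroup_embedding = G: ordered_comm_group G + L: ordered_comm_group L
  for G :: "'a ogroup" and L :: "'b ogroup" (structure) +
  fixes f
  assumes emb: "f \<in> ogroup_emb G L"
begin

sublocale group_hom G L f
  by unfold_locales (use emb in \<open>simp add: ogroup_emb_def\<close>)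

lemma emb_gle: "x \<in> carrier G \<Longrightarrow> y \<in> carrier G \<Longrightarrow> f x \<preceq> f y \<longleftrightarrow> x \<preceq>\<^bsub>G\<^esub> y"
  using ogroup_embD(3)[OF emb] by simp

lemma emb_eq: "x \<in> carrier G \<Longrightarrow> y \<in> carrier G \<Longrightarrow> f x = f y \<longleftrightarrow> x = y"
  by (metis G.gle_antisym G.gle_refl emb_gle)

lemma emb_inj: "inj_on f (carrier G)"
  using emb_eq by (auto simp: inj_on_def)

lemma emb_pow: "x \<in> carrier G \<Longrightarrow> f (x [^]\<^bsub>G\<^esub> (n::nat)) = f x [^] n"
  by (induction n) auto

end

section \<open>Hahn products are ordered groups\<close>

text \<open>
  For subsets of the field of a linear order \<open>r\<close>, this is the well-order condition on supports in
  the form in which it is handed down to subsets and to unions.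
\<close>

definition wo_set :: "'i rel \<Rightarrow> 'i set \<Rightarrow> bool" where
  "wo_set r A \<longleftrightarrow> (\<forall>B\<subseteq>A. B \<noteq> {} \<longrightarrow> (\<exists>m\<in>B. \<forall>b\<in>B. (m, b) \<in> r))"

lemma wo_set_subset: "wo_set r A \<Longrightarrow> B \<subseteq> A \<Longrightarrow> wo_set r B"
  by (auto simp: wo_set_def)

definition lex_less :: "'i rel \<Rightarrow> ('i \<Rightarrow> real) \<Rightarrow> ('i \<Rightarrow> real) \<Rightarrow> bool" where
  "lex_less r f g \<longleftrightarrow> (\<exists>i\<in>Field r. f i < g i \<and> (\<forall>j. (j, i) \<in> r \<and> j \<noteq> i \<longrightarrow> f j = g j))"

locale linear_rel =
  fixes r :: "'i rel"
  assumes lin: "Linear_order r"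
begin

lemma rel_refl: "i \<in> Field r \<Longrightarrow> (i, i) \<in> r"
  using lin by (simp add: order_on_defs refl_on_def)

lemma rel_trans: "(i, j) \<in> r \<Longrightarrow> (j, k) \<in> r \<Longrightarrow> (i, k) \<in> r"
  using lin by (meson order_on_defs transD)

lemma rel_antisym: "(i, j) \<in> r \<Longrightarrow> (j, i) \<in> r \<Longrightarrow> i = j"
  using lin by (simp add: order_on_defs antisym_def)

lemma rel_total: "i \<in> Field r \<Longrightarrow> j \<in> Field r \<Longrightarrow> (i, j) \<in> r \<or> (j, i) \<in> r"
  using lin rel_refl by (cases "i = j") (auto simp: order_on_defs total_on_def)

lemma rel_Field: "(i, j) \<in> r \<Longrightarrow> i \<in> Field r \<and> j \<in> Field r"
  by (auto simp: Field_def)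

lemma wo_set_iff:
  assumes "A \<subseteq> Field r"
  shows "well_order_on A (Restr r A) \<longleftrightarrow> wo_set r A"
proof -
  have "(i, i) \<in> r" "(i, j) \<in> r \<or> (j, i) \<in> r" if "i \<in> A" "j \<in> A" for i j
    using that assms rel_refl rel_total by blast+
  moreover have "trans (Restr r A)" by (intro transI) (auto intro: rel_trans)
  moreover have "antisym (Restr r A)" using rel_antisym by (auto intro: antisymI)
  ultimately have l: "linear_order_on A (Restr r A)"
    unfolding order_on_defs refl_on_def total_on_def by auto
  have "wf (Restr r A - Id) \<longleftrightarrow> wo_set r A"
    unfolding wf_eq_minimal wo_set_def
  proof (intro iffI allI impI)
    fix B assume *: "\<forall>Q x. x \<in> Q \<longrightarrow> (\<exists>z\<in>Q. \<forall>y. (y, z) \<in> Restr r A - Id \<longrightarrow> y \<notin> Q)"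
      and B: "B \<subseteq> A" "B \<noteq> {}"
    then obtain m where m: "m \<in> B" "\<And>y. (y, m) \<in> Restr r A - Id \<Longrightarrow> y \<notin> B"
      by (metis ex_in_conv)
    have "(m, b) \<in> r" if "b \<in> B" for b
    proof (cases "b = m")
      case False
      then show ?thesis using m that B assms rel_total[of m b] by blast
    qed (use m B assms rel_refl in blast)
    then show "\<exists>m\<in>B. \<forall>b\<in>B. (m, b) \<in> r" using m by blast
  next
    fix Q :: "'i set" and x assume *: "\<forall>B\<subseteq>A. B \<noteq> {} \<longrightarrow> (\<exists>m\<in>B. \<forall>b\<in>B. (m, b) \<in> r)" and x: "x \<in> Q"
    show "\<exists>z\<in>Q. \<forall>y. (y, z) \<in> Restr r A - Id \<longrightarrow> y \<notin> Q"
    proof (cases "Q \<inter> A = {}")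
      case False
      then obtain m where "m \<in> Q \<inter> A" "\<forall>b\<in>Q \<inter> A. (m, b) \<in> r" using * by (metis inf_le2)
      then show ?thesis using rel_antisym by blast
    qed (use x in blast)
  qed
  then show ?thesis using l by (simp add: well_order_on_def)
qed

lemma wo_set_Un:
  assumes "wo_set r A" "wo_set r B" "A \<subseteq> Field r" "B \<subseteq> Field r"
  shows "wo_set r (A \<union> B)"
  unfolding wo_set_def
proof (intro allI impI)
  fix C assume C: "C \<subseteq> A \<union> B" "C \<noteq> {}"
  have sub: "\<exists>m\<in>C \<inter> X. \<forall>b\<in>C \<inter> X. (m, b) \<in> r" if "wo_set r X" "C \<inter> X \<noteq> {}" for X
    using that unfolding wo_set_def by (meson inf_le2)
  show "\<exists>m\<in>C. \<forall>b\<in>C. (m, b) \<in> r"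
  proof (cases "C \<inter> A = {} \<or> C \<inter> B = {}")
    case True
    then have "C \<inter> A = C \<or> C \<inter> B = C" using C by blast
    then show ?thesis using sub[of A] sub[of B] assms C by metis
  next
    case False
    then obtain a b where a: "a \<in> C \<inter> A" "\<And>c. c \<in> C \<inter> A \<Longrightarrow> (a, c) \<in> r"
      and b: "b \<in> C \<inter> B" "\<And>c. c \<in> C \<inter> B \<Longrightarrow> (b, c) \<in> r"
      using sub[of A] sub[of B] assms by metis
    have C': "c \<in> C \<inter> A \<or> c \<in> C \<inter> B" if "c \<in> C" for c using that C by blast
    have "(a, b) \<in> r \<or> (b, a) \<in> r" using a b assms by (intro rel_total) auto
    then show ?thesis
    proof
      assume "(a, b) \<in> r"
      then have "(a, c) \<in> r" if "c \<in> C" for c using C'[OF that] a b rel_trans by blast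
      then show ?thesis using a by blast
    next
      assume "(b, a) \<in> r"
      then have "(b, c) \<in> r" if "c \<in> C" for c using C'[OF that] a b rel_trans by blast
      then show ?thesis using b by blast
    qed
  qed
qed

end

lemma hahn_simps [simp]:
  "\<one>\<^bsub>hahn r Q\<^esub> = (\<lambda>i. \<one>\<^bsub>Q i\<^esub>)"
  "f \<otimes>\<^bsub>hahn r Q\<^esub> g = (\<lambda>i. if i \<in> Field r then f i \<otimes>\<^bsub>Q i\<^esub> g i else \<one>\<^bsub>Q i\<^esub>)"
  by (simp_all add: hahn_def)

lemma hahn_gle: "f \<preceq>\<^bsub>hahn r Q\<^esub> g \<longleftrightarrow> f = g \<or> (\<exists>i\<in>Field r. f i \<noteq> g i \<and> f i \<preceq>\<^bsub>Q i\<^esub> g i \<and>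
        (\<forall>j. (j, i) \<in> r \<and> j \<noteq> i \<longrightarrow> f j = g j))"
  by (simp add: hahn_def)

locale hahn_product = linear_rel r for r :: "'i rel" +
  fixes Q :: "'i \<Rightarrow> 'a ogroup"
  assumes Q: "\<And>i. i \<in> Field r \<Longrightarrow> ordered_comm_group (Q i)"
begin

abbreviation "P \<equiv> hahn r Q"

lemma carrier_hahn:
  "f \<in> carrier P \<longleftrightarrow> (\<forall>i\<in>Field r. f i \<in> carrier (Q i)) \<and>
     (\<forall>i. i \<notin> Field r \<longrightarrow> f i = \<one>\<^bsub>Q i\<^esub>) \<and> wo_set r {i. f i \<noteq> \<one>\<^bsub>Q i\<^esub>}"
proof (cases "\<forall>i. i \<notin> Field r \<longrightarrow> f i = \<one>\<^bsub>Q i\<^esub>")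
  case True
  then have "{i. f i \<noteq> \<one>\<^bsub>Q i\<^esub>} \<subseteq> Field r" by blast
  from wo_set_iff[OF this] True show ?thesis by (simp add: hahn_def Let_def)
qed (auto simp: hahn_def)

lemma first_difference:
  assumes "f \<in> carrier P" "g \<in> carrier P" "f \<noteq> g"
  obtains i where "i \<in> Field r" "f i \<noteq> g i" "\<And>j. (j, i) \<in> r \<Longrightarrow> j \<noteq> i \<Longrightarrow> f j = g j"
proof -
  let ?D = "{i. f i \<noteq> g i}"
  have "?D \<subseteq> {i. f i \<noteq> \<one>\<^bsub>Q i\<^esub>} \<union> {i. g i \<noteq> \<one>\<^bsub>Q i\<^esub>}" by auto
  moreover have "wo_set r ({i. f i \<noteq> \<one>\<^bsub>Q i\<^esub>} \<union> {i. g i \<noteq> \<one>\<^bsub>Q i\<^esub>})"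
    using assms unfolding carrier_hahn by (intro wo_set_Un) auto
  moreover have "?D \<noteq> {}" using assms by auto
  ultimately obtain m where m: "m \<in> ?D" "\<forall>b\<in>?D. (m, b) \<in> r" unfolding wo_set_def by blast
  then have "m \<in> Field r" using rel_Field by blast
  then show ?thesis using that m rel_antisym by blast
qed

lemma hahn_ordered_comm_group: "ordered_comm_group P"
proof (rule ordered_comm_groupI)
  note grp = ordered_comm_group.axioms(1)[OF Q] Q
  have G: "group (Q i)" "monoid (Q i)" if "i \<in> Field r" for i
    using grp(1)[OF that] by (simp_all add: comm_group.axioms group.axioms)
  fix x assume x: "x \<in> carrier P"
  show "\<one>\<^bsub>P\<^esub> \<otimes>\<^bsub>P\<^esub> x = x"
    using x G by (auto simp: carrier_hahn monoid.l_one)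
  show "x \<preceq>\<^bsub>P\<^esub> x" by (simp add: hahn_gle)
  show "\<exists>y\<in>carrier P. y \<otimes>\<^bsub>P\<^esub> x = \<one>\<^bsub>P\<^esub>"
  proof
    let ?y = "\<lambda>i. if i \<in> Field r then inv\<^bsub>Q i\<^esub> (x i) else \<one>\<^bsub>Q i\<^esub>"
    show "?y \<otimes>\<^bsub>P\<^esub> x = \<one>\<^bsub>P\<^esub>"
      using x G by (auto simp: carrier_hahn group.l_inv)
    have "{i. ?y i \<noteq> \<one>\<^bsub>Q i\<^esub>} \<subseteq> {i. x i \<noteq> \<one>\<^bsub>Q i\<^esub>}"
      using G by (auto simp: monoid.inv_one split: if_splits)
    moreover have "wo_set r {i. x i \<noteq> \<one>\<^bsub>Q i\<^esub>}" using x by (simp add: carrier_hahn)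
    ultimately have "wo_set r {i. ?y i \<noteq> \<one>\<^bsub>Q i\<^esub>}" by (rule wo_set_subset[rotated])
    then show "?y \<in> carrier P"
      using x G by (simp add: carrier_hahn group.inv_closed)
  qed
  fix y assume y: "y \<in> carrier P"
  have "{i. (x \<otimes>\<^bsub>P\<^esub> y) i \<noteq> \<one>\<^bsub>Q i\<^esub>} \<subseteq> {i. x i \<noteq> \<one>\<^bsub>Q i\<^esub>} \<union> {i. y i \<noteq> \<one>\<^bsub>Q i\<^esub>}"
    using G by (auto simp: monoid.l_one monoid.one_closed)
  moreover have "wo_set r ({i. x i \<noteq> \<one>\<^bsub>Q i\<^esub>} \<union> {i. y i \<noteq> \<one>\<^bsub>Q i\<^esub>})"
    using x y by (intro wo_set_Un) (auto simp add: carrier_hahn)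
  ultimately have "wo_set r {i. (x \<otimes>\<^bsub>P\<^esub> y) i \<noteq> \<one>\<^bsub>Q i\<^esub>}"
    using wo_set_subset by blast
  then show "x \<otimes>\<^bsub>P\<^esub> y \<in> carrier P"
    using x y G by (simp add: carrier_hahn monoid.m_closed)
  show "x \<otimes>\<^bsub>P\<^esub> y = y \<otimes>\<^bsub>P\<^esub> x"
    using x y grp(1) by (auto simp: carrier_hahn fun_eq_iff intro!: comm_monoid.m_comm comm_group.axioms(1))
  show "x \<preceq>\<^bsub>P\<^esub> y \<or> y \<preceq>\<^bsub>P\<^esub> x"
  proof (cases "x = y")
    case False
    then obtain i where i: "i \<in> Field r" "x i \<noteq> y i" "\<And>j. (j, i) \<in> r \<Longrightarrow> j \<noteq> i \<Longrightarrow> x j = y j"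
      using first_difference x y by metis
    then have "x i \<preceq>\<^bsub>Q i\<^esub> y i \<or> y i \<preceq>\<^bsub>Q i\<^esub> x i"
      using x y ordered_comm_group.gle_total[OF Q[OF i(1)]] unfolding carrier_hahn by blast
    then show ?thesis using i unfolding hahn_gle by metis
  qed (simp add: hahn_gle)
  show "x = y" if le: "x \<preceq>\<^bsub>P\<^esub> y" "y \<preceq>\<^bsub>P\<^esub> x"
  proof (rule ccontr)
    assume ne: "x \<noteq> y"
    then obtain i where i: "i \<in> Field r" "x i \<noteq> y i" "x i \<preceq>\<^bsub>Q i\<^esub> y i"
        "\<And>j. (j, i) \<in> r \<Longrightarrow> j \<noteq> i \<Longrightarrow> x j = y j" using le(1) ne unfolding hahn_gle by metis
    obtain k where k: "k \<in> Field r" "x k \<noteq> y k" "y k \<preceq>\<^bsub>Q k\<^esub> x k"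
        "\<And>j. (j, k) \<in> r \<Longrightarrow> j \<noteq> k \<Longrightarrow> y j = x j" using le(2) ne unfolding hahn_gle by metis
    have "i = k" using i k rel_total[of i k] by metis
    then show False using i k x y grp(2)[of i] ordered_comm_group.gle_antisym[of "Q i"]
      by (auto simp: carrier_hahn)
  qed
  fix z assume z: "z \<in> carrier P"
  show "(x \<otimes>\<^bsub>P\<^esub> y) \<otimes>\<^bsub>P\<^esub> z = x \<otimes>\<^bsub>P\<^esub> (y \<otimes>\<^bsub>P\<^esub> z)"
    using x y z G by (auto simp: carrier_hahn fun_eq_iff intro!: monoid.m_assoc)
  show "x \<preceq>\<^bsub>P\<^esub> z" if le: "x \<preceq>\<^bsub>P\<^esub> y" "y \<preceq>\<^bsub>P\<^esub> z"
  proof (cases "x = y \<or> y = z")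
    case False
    then obtain i where i: "i \<in> Field r" "x i \<noteq> y i" "x i \<preceq>\<^bsub>Q i\<^esub> y i"
        "\<And>j. (j, i) \<in> r \<Longrightarrow> j \<noteq> i \<Longrightarrow> x j = y j" using le(1) False unfolding hahn_gle by metis
    obtain k where k: "k \<in> Field r" "y k \<noteq> z k" "y k \<preceq>\<^bsub>Q k\<^esub> z k"
        "\<And>j. (j, k) \<in> r \<Longrightarrow> j \<noteq> k \<Longrightarrow> y j = z j" using le(2) False unfolding hahn_gle by metis
    interpret Qi: ordered_comm_group "Q i" using i Q by simp
    interpret Qk: ordered_comm_group "Q k" using k Q by simp
    have car: "x i \<in> carrier (Q i)" "y i \<in> carrier (Q i)" "z i \<in> carrier (Q i)"
      using x y z i by (auto simp: carrier_hahn)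
    have "\<exists>m\<in>Field r. x m \<noteq> z m \<and> x m \<preceq>\<^bsub>Q m\<^esub> z m \<and> (\<forall>j. (j, m) \<in> r \<and> j \<noteq> m \<longrightarrow> x j = z j)"
    proof (cases "i = k")
      case True
      have "x i \<preceq>\<^bsub>Q i\<^esub> z i" "x i \<noteq> z i" using i k True car Qi.gle_trans Qi.gle_antisym by metis+
      then show ?thesis using i k True by metis
    next
      case False
      (* the smaller one of the two first differences *)
      then show ?thesis
        using rel_total[OF i(1) k(1)] i k rel_trans[of _ i k] rel_trans[of _ k i] rel_antisym by metis
    qed
    then show ?thesis by (simp add: hahn_gle)
  qed (use le in auto)
  show "z \<otimes>\<^bsub>P\<^esub> x \<preceq>\<^bsub>P\<^esub> z \<otimes>\<^bsub>P\<^esub> y" if le: "x \<preceq>\<^bsub>P\<^esub> y"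
  proof (cases "x = y")
    case False
    then obtain i where i: "i \<in> Field r" "x i \<noteq> y i" "x i \<preceq>\<^bsub>Q i\<^esub> y i"
        "\<And>j. (j, i) \<in> r \<Longrightarrow> j \<noteq> i \<Longrightarrow> x j = y j" using le False unfolding hahn_gle by metis
    interpret Qi: ordered_comm_group "Q i" using i Q by simp
    have car: "x i \<in> carrier (Q i)" "y i \<in> carrier (Q i)" "z i \<in> carrier (Q i)"
      using x y z i by (auto simp: carrier_hahn)
    have "z i \<otimes>\<^bsub>Q i\<^esub> x i \<preceq>\<^bsub>Q i\<^esub> z i \<otimes>\<^bsub>Q i\<^esub> y i" "z i \<otimes>\<^bsub>Q i\<^esub> x i \<noteq> z i \<otimes>\<^bsub>Q i\<^esub> y i"
      using i car Qi.gle_mult by auto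
    then show ?thesis using i unfolding hahn_gle by (intro disjI2 bexI[of _ i]) auto
  qed (simp add: hahn_gle)
next
  show "\<one>\<^bsub>P\<^esub> \<in> carrier P"
    using Q by (auto simp: carrier_hahn wo_set_def ordered_comm_group_def comm_group_def group_def
        intro: monoid.one_closed)
qed

end

section \<open>The divisible hull\<close>

context ordered_comm_group
begin

abbreviation "D \<equiv> div_hull G"

lemma frac_rel_iff:
  "((x, m), (y, n)) \<in> frac_rel G \<longleftrightarrow>
     x \<in> carrier G \<and> y \<in> carrier G \<and> m > 0 \<and> n > 0 \<and> x [^] n = y [^] m"
  by (simp add: frac_rel_def)

lemma frac_rel_equiv: "equiv (carrier G \<times> {0<..}) (frac_rel G)"
proof (rule equivI)
  show "trans (frac_rel G)"
  proof (rule transI, clarify)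
    fix x m y n z p
    assume "((x, m), (y, n)) \<in> frac_rel G" "((y, n), (z, p)) \<in> frac_rel G"
    then have c: "x \<in> carrier G" "y \<in> carrier G" "z \<in> carrier G" "m > 0" "n > 0" "p > 0"
      and e: "x [^] n = y [^] m" "y [^] p = z [^] n" by (auto simp: frac_rel_iff)
    have "(x [^] p) [^] n = (x [^] n) [^] p" using c by (simp add: nat_pow_pow mult.commute)
    also have "\<dots> = (y [^] p) [^] m" using c e(1) by (simp add: nat_pow_pow mult.commute)
    also have "\<dots> = (z [^] m) [^] n" unfolding e(2) using c by (simp add: nat_pow_pow mult.commute)
    finally have "x [^] p = z [^] m" using c by (simp add: pow_eq_iff)
    then show "((x, m), (z, p)) \<in> frac_rel G" using c by (simp add: frac_rel_iff)
  qed
qed (auto simp: frac_rel_def refl_on_def sym_def)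

text \<open>
  The element \<open>x / m\<close> of the divisible hull.
\<close>

definition frac :: "'a \<Rightarrow> nat \<Rightarrow> ('a \<times> nat) set" where
  "frac x m = frac_rel G `` {(x, m)}"

lemma frac_eq_iff:
  assumes "x \<in> carrier G" "y \<in> carrier G" "m > 0" "n > 0"
  shows "frac x m = frac y n \<longleftrightarrow> x [^] n = y [^] m"
  unfolding frac_def using assms eq_equiv_class_iff[OF frac_rel_equiv, of "(x, m)" "(y, n)"]
  by (auto simp: frac_rel_iff)

lemma carrier_div_hull: "X \<in> carrier D \<longleftrightarrow> (\<exists>x m. x \<in> carrier G \<and> m > 0 \<and> X = frac x m)"
  by (force simp: div_hull_def frac_def quotient_def)

lemma frac_self: "x \<in> carrier G \<Longrightarrow> m > 0 \<Longrightarrow> (x, m) \<in> frac x m"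
  by (simp add: frac_def frac_rel_iff)

lemma div_hull_mult:
  assumes "x \<in> carrier G" "y \<in> carrier G" "m > 0" "n > 0"
  shows "frac x m \<otimes>\<^bsub>D\<^esub> frac y n = frac (x [^] n \<otimes> y [^] m) (m * n)"
proof -
  have "frac (x' [^] n' \<otimes> y' [^] m') (m' * n') = frac (x [^] n \<otimes> y [^] m) (m * n)"
    if "(x', m') \<in> frac x m" "(y', n') \<in> frac y n" for x' m' y' n'
  proof -
    have c: "x' \<in> carrier G" "y' \<in> carrier G" "m' > 0" "n' > 0"
      and e: "x [^] m' = x' [^] m" "y [^] n' = y' [^] n"
      using that by (auto simp: frac_def frac_rel_iff)
    have "(x' [^] n' \<otimes> y' [^] m') [^] (m * n) = (x' [^] m) [^] (n' * n) \<otimes> (y' [^] n) [^] (m' * m)"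
      using c assms by (simp add: pow_mult_distrib[OF m_comm] nat_pow_pow mult_ac)
    also have "\<dots> = (x [^] n \<otimes> y [^] m) [^] (m' * n')"
      using c assms unfolding e[symmetric] by (simp add: pow_mult_distrib[OF m_comm] nat_pow_pow mult_ac)
    finally show ?thesis using c assms by (simp add: frac_eq_iff)
  qed
  then have "(\<Union>(x', m')\<in>frac x m. \<Union>(y', n')\<in>frac y n. frac (x' [^] n' \<otimes> y' [^] m') (m' * n'))
      = (\<Union>(x', m')\<in>frac x m. \<Union>(y', n')\<in>frac y n. frac (x [^] n \<otimes> y [^] m) (m * n))"
    by (intro SUP_cong refl) (auto split: prod.splits)
  also have "\<dots> = frac (x [^] n \<otimes> y [^] m) (m * n)"
    using assms frac_self by auto
  finally show ?thesis by (simp add: div_hull_def frac_def)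
qed

lemma div_hull_one: "\<one>\<^bsub>D\<^esub> = frac \<one> 1"
  by (simp add: div_hull_def frac_def)

lemma div_hull_gle:
  assumes "x \<in> carrier G" "y \<in> carrier G" "m > 0" "n > 0"
  shows "frac x m \<preceq>\<^bsub>D\<^esub> frac y n \<longleftrightarrow> x [^] n \<preceq> y [^] m"
proof
  assume "frac x m \<preceq>\<^bsub>D\<^esub> frac y n"
  then obtain x' m' y' n' where "(x', m') \<in> frac x m" "(y', n') \<in> frac y n" and le: "x' [^] n' \<preceq> y' [^] m'"
    by (auto simp: div_hull_def)
  then have c: "x' \<in> carrier G" "y' \<in> carrier G" "m' > 0" "n' > 0"
      and e: "x [^] m' = x' [^] m" "y [^] n' = y' [^] n"
      by (auto simp: frac_def frac_rel_iff)
  have "(x [^] n) [^] (m' * n') = (x [^] m') [^] (n * n')"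
    using c assms by (simp add: nat_pow_pow mult_ac)
  also have "\<dots> = (x' [^] n') [^] (m * n)"
    using c assms unfolding e by (simp add: nat_pow_pow mult_ac)
  also have "\<dots> \<preceq> (y' [^] m') [^] (m * n)"
    using le c by (intro pow_mono) auto
  also have "(y' [^] m') [^] (m * n) = (y' [^] n) [^] (m * m')"
    using c assms by (simp add: nat_pow_pow mult_ac)
  also have "\<dots> = (y [^] m) [^] (m' * n')"
    using c assms unfolding e[symmetric] by (simp add: nat_pow_pow mult_ac)
  finally show "x [^] n \<preceq> y [^] m" using c assms by (simp add: pow_gle_iff)
next
  assume "x [^] n \<preceq> y [^] m"
  then show "frac x m \<preceq>\<^bsub>D\<^esub> frac y n"
    using frac_self[of x m] frac_self[of y n] assms unfolding div_hull_def
    by (simp, intro bexI[of _ "(x, m)"], simp, intro bexI[of _ "(y, n)"]) simp_all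
qed

lemma common_denominator:
  assumes "x \<in> carrier G" "m > 0" "k > 0"
  shows "frac x m = frac (x [^] (k::nat)) (m * k)"
  using assms by (simp add: frac_eq_iff nat_pow_pow mult_ac)

lemma common_denominator3:
  assumes "X \<in> carrier D" "Y \<in> carrier D" "Z \<in> carrier D"
  obtains x y z m where "x \<in> carrier G" "y \<in> carrier G" "z \<in> carrier G" "m > 0"
    "X = frac x m" "Y = frac y m" "Z = frac z m"
proof -
  obtain x m y n z p where X: "x \<in> carrier G" "m > 0" "X = frac x m"
    and Y: "y \<in> carrier G" "n > 0" "Y = frac y n" and Z: "z \<in> carrier G" "p > 0" "Z = frac z p"
    using assms by (auto simp: carrier_div_hull)
  show ?thesis
    using that[of "x [^] (n * p)" "y [^] (m * p)" "z [^] (m * n)" "m * n * p"] X Y Z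
      common_denominator[of x m "n * p"] common_denominator[of y n "m * p"] common_denominator[of z p "m * n"]
    by (simp add: mult_ac)
qed

lemma frac_mult:
  assumes "x \<in> carrier G" "y \<in> carrier G" "m > 0"
  shows "frac x m \<otimes>\<^bsub>D\<^esub> frac y m = frac (x \<otimes> y) m"
proof -
  have "frac x m \<otimes>\<^bsub>D\<^esub> frac y m = frac ((x \<otimes> y) [^] m) (m * m)"
    using assms by (simp add: div_hull_mult pow_mult_distrib m_comm)
  also have "\<dots> = frac (x \<otimes> y) m"
    using assms by (intro common_denominator[symmetric]) auto
  finally show ?thesis .
qed

lemma frac_gle:
  assumes "x \<in> carrier G" "y \<in> carrier G" "m > 0"
  shows "frac x m \<preceq>\<^bsub>D\<^esub> frac y m \<longleftrightarrow> x \<preceq> y"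
  using assms by (simp add: div_hull_gle pow_gle_iff)

lemma frac_one: "m > 0 \<Longrightarrow> frac \<one> m = \<one>\<^bsub>D\<^esub>"
  by (simp add: div_hull_one frac_eq_iff)

lemma frac_closed: "x \<in> carrier G \<Longrightarrow> m > 0 \<Longrightarrow> frac x m \<in> carrier D"
  using carrier_div_hull by blast

lemma div_hull_ordered_comm_group: "ordered_comm_group D"
proof (rule ordered_comm_groupI)
  show "\<one>\<^bsub>D\<^esub> \<in> carrier D" by (simp add: div_hull_one frac_closed)
  fix X assume X: "X \<in> carrier D"
  then obtain x m where x: "x \<in> carrier G" "m > 0" "X = frac x m" by (auto simp: carrier_div_hull)
  show "\<one>\<^bsub>D\<^esub> \<otimes>\<^bsub>D\<^esub> X = X"
    using x by (simp add: frac_one[of m, symmetric] frac_mult)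
  show "\<exists>Y\<in>carrier D. Y \<otimes>\<^bsub>D\<^esub> X = \<one>\<^bsub>D\<^esub>"
    using x by (intro bexI[of _ "frac (inv x) m"]) (simp_all add: frac_mult frac_one frac_closed)
  show "X \<preceq>\<^bsub>D\<^esub> X" using x by (simp add: frac_gle gle_refl)
  fix Y assume Y: "Y \<in> carrier D"
  obtain x y m where xy: "x \<in> carrier G" "y \<in> carrier G" "m > 0" "X = frac x m" "Y = frac y m"
    by (rule common_denominator3[OF X Y Y])
  show "X \<otimes>\<^bsub>D\<^esub> Y \<in> carrier D" using xy by (simp add: frac_mult frac_closed)
  show "X \<otimes>\<^bsub>D\<^esub> Y = Y \<otimes>\<^bsub>D\<^esub> X" using xy by (simp add: frac_mult m_comm)
  show "X \<preceq>\<^bsub>D\<^esub> Y \<or> Y \<preceq>\<^bsub>D\<^esub> X" using xy gle_total by (simp add: frac_gle)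
  show "X = Y" if "X \<preceq>\<^bsub>D\<^esub> Y" "Y \<preceq>\<^bsub>D\<^esub> X"
    using that xy gle_antisym[of x y] by (simp add: frac_gle)
  fix Z assume Z: "Z \<in> carrier D"
  obtain x y z m where xyz: "x \<in> carrier G" "y \<in> carrier G" "z \<in> carrier G" "m > 0"
      "X = frac x m" "Y = frac y m" "Z = frac z m"
    using common_denominator3[OF X Y Z] .
  show "(X \<otimes>\<^bsub>D\<^esub> Y) \<otimes>\<^bsub>D\<^esub> Z = X \<otimes>\<^bsub>D\<^esub> (Y \<otimes>\<^bsub>D\<^esub> Z)"
    using xyz by (simp add: frac_mult m_assoc)
  show "X \<preceq>\<^bsub>D\<^esub> Z" if "X \<preceq>\<^bsub>D\<^esub> Y" "Y \<preceq>\<^bsub>D\<^esub> Z"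
    using that xyz gle_trans[of x y z] by (simp add: frac_gle)
  show "Z \<otimes>\<^bsub>D\<^esub> X \<preceq>\<^bsub>D\<^esub> Z \<otimes>\<^bsub>D\<^esub> Y" if "X \<preceq>\<^bsub>D\<^esub> Y"
    using that xyz by (simp add: frac_gle frac_mult gle_mult)
qed

lemma to_hull_frac: "to_hull G x = frac x 1"
  by (simp add: to_hull_def frac_def)

lemma to_hull_emb: "to_hull G \<in> ogroup_emb G D"
  by (auto simp: ogroup_emb_def hom_def to_hull_frac frac_closed frac_mult frac_gle)

lemma frac_pow:
  assumes "x \<in> carrier G" "m > 0"
  shows "frac x m [^]\<^bsub>D\<^esub> (n::nat) = frac (x [^] n) m"
  by (induction n) (use assms in \<open>simp_all add: frac_one frac_mult\<close>)

lemma frac_pow_denominator: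
  assumes "x \<in> carrier G" "m > 0"
  shows "frac x m [^]\<^bsub>D\<^esub> m = to_hull G x"
  using assms by (simp add: frac_pow to_hull_frac frac_eq_iff)

section \<open>Components\<close>

text \<open>
  A union of a chain: convex subgroups are comparable by inclusion.
\<close>

lemma lower_subgroup_convex:
  assumes "H \<in> Prin G"
  shows "convex_subgroup (lower_subgroup G H) G"
proof -
  let ?P = "{H' \<in> Prin G. H' \<subset> H}"
  let ?N = "lower_subgroup G H"
  have cases: "x = \<one> \<or> (\<exists>K\<in>?P. x \<in> K)" if "x \<in> ?N" for x
    using that by (auto simp: lower_subgroup_def)
  have sub: "convex_subgroup K G" "subgroup K G" "K \<subseteq> ?N" if "K \<in> ?P" for K
    using that Prin_convex by (auto simp: lower_subgroup_def convex_subgroup_def)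
  have one: "\<one> \<in> ?N" by (simp add: lower_subgroup_def)
  have car: "x \<in> carrier G" if "x \<in> ?N" for x
    using cases[OF that] sub(2) subgroup.subset by blast
  show ?thesis
    unfolding convex_subgroup_def
  proof (intro conjI ballI impI)
    show "subgroup ?N G"
    proof
      show "?N \<subseteq> carrier G" using car by blast
      show "\<one> \<in> ?N" by fact
      show "inv x \<in> ?N" if "x \<in> ?N" for x
        using cases[OF that] one sub subgroup.m_inv_closed by (metis inv_one subsetD)
      fix x y assume x: "x \<in> ?N" and y: "y \<in> ?N"
      show "x \<otimes> y \<in> ?N"
      proof (cases "x = \<one> \<or> y = \<one>")
        case True
        then show ?thesis using x y car by auto
      next
        case False
        obtain K where K: "K \<in> ?P" "x \<in> K" using cases[OF x] False by blast
        obtain L where L: "L \<in> ?P" "y \<in> L" using cases[OF y] False by blast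
        have "K \<subseteq> L \<or> L \<subseteq> K"
          by (rule convex_subgroups_chain[OF sub(1)[OF K(1)] sub(1)[OF L(1)]])
        then show ?thesis
        proof
          assume "K \<subseteq> L"
          then have "x \<otimes> y \<in> L" using K L subgroup.m_closed[OF sub(2)[OF L(1)]] by blast
          then show ?thesis using sub(3)[of L] L by blast
        next
          assume "L \<subseteq> K"
          then have "x \<otimes> y \<in> K" using K L subgroup.m_closed[OF sub(2)[OF K(1)]] by blast
          then show ?thesis using sub(3)[of K] K by blast
        qed
      qed
    qed
    fix x y assume x: "x \<in> ?N" and y: "y \<in> carrier G" "\<one> \<preceq> y \<and> y \<preceq> x"
    show "y \<in> ?N"
    proof (cases "x = \<one>")
      case True
      then show ?thesis using y one gle_antisym[of y \<one>] by auto
    next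
      case False
      then obtain K where "K \<in> ?P" "x \<in> K" using cases x by blast
      then show ?thesis using sub[of K] y unfolding convex_subgroup_def by blast
    qed
  qed
qed

lemma generator_notin_lower_subgroup:
  assumes "x \<in> carrier G" "x \<noteq> \<one>"
  shows "x \<notin> lower_subgroup G (convex_hull_group G {x})"
  using assms convex_hull_min[OF Prin_convex, of _ "{x}"] by (auto simp: lower_subgroup_def)

lemma component_simps [simp]:
  "carrier (component G H) = rcosets\<^bsub>G\<lparr>carrier := H\<rparr>\<^esub> (lower_subgroup G H)"
  "\<one>\<^bsub>component G H\<^esub> = lower_subgroup G H"
  "A \<otimes>\<^bsub>component G H\<^esub> B = A <#> B"
  "A \<preceq>\<^bsub>component G H\<^esub> B \<longleftrightarrow> (\<exists>a\<in>A. \<exists>b\<in>B. a \<preceq> b)"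
  by (simp_all add: component_def FactGroup_def Let_def set_mult_def)

lemma component_carrier_iff:
  "A \<in> carrier (component G H) \<longleftrightarrow> (\<exists>a\<in>H. A = lower_subgroup G H #> a)"
  by (auto simp: RCOSETS_def r_coset_def)

lemma component_mult:
  assumes H: "H \<in> Prin G" and "a \<in> H" "b \<in> H"
  shows "(lower_subgroup G H #> a) \<otimes>\<^bsub>component G H\<^esub> (lower_subgroup G H #> b) = lower_subgroup G H #> (a \<otimes> b)"
proof -
  have "subgroup H G" "subgroup (lower_subgroup G H) G"
    using Prin_convex[OF H] lower_subgroup_convex[OF H] by (auto simp: convex_subgroup_def)
  then interpret normal "lower_subgroup G H" G using subgroup_imp_normal by blast
  have "a \<in> carrier G" "b \<in> carrier G" using assms \<open>subgroup H G\<close> subgroup.subset by blast+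
  then show ?thesis by (simp add: rcos_sum)
qed

text \<open>
  The order of the quotient compares some representatives. If these satisfy
  \<open>n \<otimes> a \<preceq> m \<otimes> b\<close> although \<open>b \<preceq> a\<close>, then the quotient of \<open>b\<close> by \<open>a\<close> lies between that of \<open>n\<close> by \<open>m\<close>
  and the neutral element. Convexity puts it into the lower subgroup, and the cosets agree.
\<close>

lemma component_gle:
  assumes H: "H \<in> Prin G" and a: "a \<in> H" and b: "b \<in> H"
  shows "(lower_subgroup G H #> a) \<preceq>\<^bsub>component G H\<^esub> (lower_subgroup G H #> b) \<longleftrightarrow>
    a \<preceq> b \<or> lower_subgroup G H #> a = lower_subgroup G H #> b"
proof -
  let ?N = "lower_subgroup G H"
  have conv: "convex_subgroup ?N G" using H by (rule lower_subgroup_convex)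
  then have N: "subgroup ?N G" by (simp add: convex_subgroup_def)
  have "subgroup H G" using Prin_convex[OF H] by (simp add: convex_subgroup_def)
  then have car: "a \<in> carrier G" "b \<in> carrier G" using assms subgroup.subset by blast+
  have Nc: "n \<in> carrier G" if "n \<in> ?N" for n using that N subgroup.subset by blast
  have mem: "a \<in> ?N #> a" "b \<in> ?N #> b" using N car by (auto simp: rcos_self)
  show ?thesis
  proof
    assume "(?N #> a) \<preceq>\<^bsub>component G H\<^esub> (?N #> b)"
    then obtain n m where nm: "n \<in> ?N" "m \<in> ?N" "n \<otimes> a \<preceq> m \<otimes> b"
      by (auto simp: r_coset_def)
    show "a \<preceq> b \<or> ?N #> a = ?N #> b"
    proof (cases "a \<preceq> b")
      case False
      then have ba: "b \<preceq> a" using gle_total car by blast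
      have "inv m \<otimes> (n \<otimes> a) \<preceq> inv m \<otimes> (m \<otimes> b)" using nm car Nc by (simp add: gle_mult_iff)
      then have le: "(inv m \<otimes> n) \<otimes> a \<preceq> b" using nm car Nc by (simp add: m_assoc[symmetric])
      have 1: "inv m \<otimes> n \<preceq> b \<otimes> inv a"
        using le gle_mult_iff_right[of "(inv m \<otimes> n) \<otimes> a" b "inv a"] nm car Nc by (simp add: m_assoc)
      have 2: "b \<otimes> inv a \<preceq> \<one>"
        using ba gle_mult_iff_right[of b a "inv a"] car by simp
      have "b \<otimes> inv a \<in> ?N"
        using convex_subgroup_between[OF conv _ _ _ 1 2] nm N car
        by (simp add: subgroup.m_closed subgroup.m_inv_closed subgroup.one_closed)
      then have "b \<in> ?N #> a"
        unfolding r_coset_def using car by (auto simp: m_assoc intro!: bexI[of _ "b \<otimes> inv a"])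
      then have "?N #> a = ?N #> b" using repr_independence N car by metis
      then show ?thesis ..
    qed simp
  next
    assume "a \<preceq> b \<or> ?N #> a = ?N #> b"
    then show "(?N #> a) \<preceq>\<^bsub>component G H\<^esub> (?N #> b)"
      using mem car gle_refl by (simp del: component_simps(1-3)) blast
  qed
qed

lemma component_ordered_comm_group:
  assumes H: "H \<in> Prin G"
  shows "ordered_comm_group (component G H)"
proof (rule ordered_comm_groupI)
  let ?N = "lower_subgroup G H"
  have "subgroup H G" using Prin_convex[OF H] by (simp add: convex_subgroup_def)
  then interpret HS: subgroup H G .
  have N: "subgroup ?N G" using lower_subgroup_convex[OF H] by (simp add: convex_subgroup_def)
  have one: "\<one>\<^bsub>component G H\<^esub> = ?N #> \<one>"
    using coset_mult_one[OF subgroup.subset[OF N]] by simp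
  note [simp del] = component_simps
  note [simp] = component_mult[OF H] component_gle[OF H]
  show "\<one>\<^bsub>component G H\<^esub> \<in> carrier (component G H)"
    unfolding one component_carrier_iff using HS.one_closed by blast
  fix A assume "A \<in> carrier (component G H)"
  then obtain a where a: "a \<in> H" "A = ?N #> a" unfolding component_carrier_iff by blast
  show "\<one>\<^bsub>component G H\<^esub> \<otimes>\<^bsub>component G H\<^esub> A = A" unfolding one using a by simp
  show "\<exists>B\<in>carrier (component G H). B \<otimes>\<^bsub>component G H\<^esub> A = \<one>\<^bsub>component G H\<^esub>"
    unfolding one using a by (intro bexI[of _ "?N #> inv a"]) (auto simp: component_carrier_iff)
  show "A \<preceq>\<^bsub>component G H\<^esub> A" using a by simp
  fix B assume "B \<in> carrier (component G H)"
  then obtain b where b: "b \<in> H" "B = ?N #> b" unfolding component_carrier_iff by blast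
  show "A \<otimes>\<^bsub>component G H\<^esub> B \<in> carrier (component G H)"
    using a b by (auto simp: component_carrier_iff)
  show "A \<otimes>\<^bsub>component G H\<^esub> B = B \<otimes>\<^bsub>component G H\<^esub> A" using a b by (simp add: m_comm)
  show "A \<preceq>\<^bsub>component G H\<^esub> B \<or> B \<preceq>\<^bsub>component G H\<^esub> A" using a b gle_total[of a b] by auto
  show "A = B" if "A \<preceq>\<^bsub>component G H\<^esub> B" "B \<preceq>\<^bsub>component G H\<^esub> A"
    using that a b gle_antisym[of a b] by auto
  fix C assume "C \<in> carrier (component G H)"
  then obtain c where c: "c \<in> H" "C = ?N #> c" unfolding component_carrier_iff by blast
  show "A \<otimes>\<^bsub>component G H\<^esub> B \<otimes>\<^bsub>component G H\<^esub> C = A \<otimes>\<^bsub>component G H\<^esub> (B \<otimes>\<^bsub>component G H\<^esub> C)"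
    using a b c by (simp add: m_assoc)
  show "A \<preceq>\<^bsub>component G H\<^esub> C" if "A \<preceq>\<^bsub>component G H\<^esub> B" "B \<preceq>\<^bsub>component G H\<^esub> C"
  proof -
    have "a \<preceq> b \<or> A = B" "b \<preceq> c \<or> B = C" using that a b c by simp_all
    moreover have "A \<preceq>\<^bsub>component G H\<^esub> C" if "a \<preceq> b" "b \<preceq> c"
      using that a c gle_trans[OF _ _ _ that] b(1) by simp
    ultimately show ?thesis using that by blast
  qed
  show "C \<otimes>\<^bsub>component G H\<^esub> A \<preceq>\<^bsub>component G H\<^esub> C \<otimes>\<^bsub>component G H\<^esub> B" if "A \<preceq>\<^bsub>component G H\<^esub> B"
  proof (cases "A = B")
    case True
    then show ?thesis using b c by simp
  next
    case False
    then show ?thesis using that a b c by (simp add: gle_mult)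
  qed
qed

end

section \<open>Leading indices of embeddings into Hahn products\<close>

context hahn_product
begin

lemma hahn_gle_at:
  assumes "f \<in> carrier P" "g \<in> carrier P"
    and "k \<in> Field r" "f k \<noteq> g k" "\<And>j. (j, k) \<in> r \<Longrightarrow> j \<noteq> k \<Longrightarrow> f j = g j"
  shows "f \<preceq>\<^bsub>P\<^esub> g \<longleftrightarrow> f k \<preceq>\<^bsub>Q k\<^esub> g k"
proof
  assume "f \<preceq>\<^bsub>P\<^esub> g"
  then obtain i where i: "i \<in> Field r" "f i \<noteq> g i" "f i \<preceq>\<^bsub>Q i\<^esub> g i"
    "\<And>j. (j, i) \<in> r \<Longrightarrow> j \<noteq> i \<Longrightarrow> f j = g j" using assms(4) unfolding hahn_gle by metis
  have "i = k" using rel_total[OF i(1) assms(3)] i(2,4) assms(4,5) by metis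
  then show "f k \<preceq>\<^bsub>Q k\<^esub> g k" using i by simp
next
  assume "f k \<preceq>\<^bsub>Q k\<^esub> g k"
  then show "f \<preceq>\<^bsub>P\<^esub> g" using assms unfolding hahn_gle by blast
qed

text \<open>
  An element between zero and \<open>x\<close> cannot have its first nonzero coordinate where \<open>x\<close> and all that
  precedes vanish.
\<close>

lemma vanishing_convex:
  assumes J: "\<And>i j. i \<in> J \<Longrightarrow> (j, i) \<in> r \<Longrightarrow> j \<in> J"
  shows "convex_subgroup {w \<in> carrier P. \<forall>j\<in>J. w j = \<one>\<^bsub>Q j\<^esub>} P" (is "convex_subgroup ?C _")
proof -
  interpret P: ordered_comm_group P by (rule hahn_ordered_comm_group)
  have one: "\<one>\<^bsub>P\<^esub> \<in> carrier P" by (rule P.one_closed)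
  show ?thesis
    unfolding convex_subgroup_def
  proof (intro conjI ballI impI)
    show "subgroup ?C P"
    proof
      show "x \<otimes>\<^bsub>P\<^esub> y \<in> ?C" if "x \<in> ?C" "y \<in> ?C" for x y
      proof -
        have "x \<otimes>\<^bsub>P\<^esub> y \<in> carrier P" using that by (intro P.m_closed) auto
        moreover have "(x \<otimes>\<^bsub>P\<^esub> y) j = \<one>\<^bsub>Q j\<^esub>" if "j \<in> J" for j
        proof (cases "j \<in> Field r")
          case True
          interpret Qj: ordered_comm_group "Q j" using Q[OF True] .
          show ?thesis using \<open>x \<in> ?C\<close> \<open>y \<in> ?C\<close> that by simp
        qed simp
        ultimately show ?thesis by blast
      qed
      show "inv\<^bsub>P\<^esub> x \<in> ?C" if x: "x \<in> ?C" for x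
      proof -
        have c: "x \<in> carrier P" using x by simp
        have i: "inv\<^bsub>P\<^esub> x \<in> carrier P" using c by (rule P.inv_closed)
        moreover have "(inv\<^bsub>P\<^esub> x) j = \<one>\<^bsub>Q j\<^esub>" if "j \<in> J" for j
        proof (cases "j \<in> Field r")
          case True
          interpret Qj: ordered_comm_group "Q j" using Q[OF True] .
          have "(inv\<^bsub>P\<^esub> x \<otimes>\<^bsub>P\<^esub> x) j = \<one>\<^bsub>Q j\<^esub>" unfolding P.l_inv[OF c] by simp
          moreover have "x j = \<one>\<^bsub>Q j\<^esub>" using x that by blast
          moreover have "(inv\<^bsub>P\<^esub> x) j \<in> carrier (Q j)" using i True by (simp add: carrier_hahn)
          ultimately show ?thesis using True by simp
        next
          case False
          then show ?thesis using i by (simp add: carrier_hahn)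
        qed
        ultimately show ?thesis by blast
      qed
    qed (use one in auto)
    fix x y assume x: "x \<in> ?C" and y: "y \<in> carrier P"
      "\<one>\<^bsub>P\<^esub> \<preceq>\<^bsub>P\<^esub> y \<and> y \<preceq>\<^bsub>P\<^esub> x"
    show "y \<in> ?C"
    proof (rule ccontr)
      assume "y \<notin> ?C"
      then obtain j where j: "j \<in> J" "y j \<noteq> \<one>\<^bsub>Q j\<^esub>" using y by blast
      then have "y \<noteq> \<one>\<^bsub>P\<^esub>" by auto
      then obtain k where k: "k \<in> Field r" "y k \<noteq> \<one>\<^bsub>P\<^esub> k"
          "\<And>i. (i, k) \<in> r \<Longrightarrow> i \<noteq> k \<Longrightarrow> y i = \<one>\<^bsub>P\<^esub> i"
        using first_difference[OF y(1) one] by metis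
      have jF: "j \<in> Field r" using j y(1) by (auto simp: carrier_hahn)
      have "(k, j) \<in> r"
      proof (rule ccontr)
        assume "(k, j) \<notin> r"
        then have "(j, k) \<in> r" "j \<noteq> k" using rel_total[OF k(1) jF] rel_refl[OF k(1)] by auto
        then show False using k(3)[of j] j(2) by simp
      qed
      have kJ: "i \<in> J" if "(i, k) \<in> r" for i
        using J[OF j(1) rel_trans[OF that \<open>(k, j) \<in> r\<close>]] .
      then have xk: "x i = \<one>\<^bsub>Q i\<^esub>" if "(i, k) \<in> r" for i using that x by blast
      interpret Qk: ordered_comm_group "Q k" using Q k by simp
      have "\<one>\<^bsub>Q k\<^esub> \<preceq>\<^bsub>Q k\<^esub> y k"
        using hahn_gle_at[OF one y(1) k(1)] k y(2) by simp
      moreover have "y k \<preceq>\<^bsub>Q k\<^esub> \<one>\<^bsub>Q k\<^esub>"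
      proof -
        have xc: "x \<in> carrier P" using x by simp
        have c1: "y k \<noteq> x k" using k(2) xk[OF rel_refl[OF k(1)]] by simp
        have c2: "y j = x j" if "(j, k) \<in> r" "j \<noteq> k" for j
          using k(3)[OF that] xk[OF that(1)] by simp
        have "y k \<preceq>\<^bsub>Q k\<^esub> x k"
          using y(2) hahn_gle_at[OF y(1) xc k(1) c1 c2] by blast
        then show ?thesis using xk[OF rel_refl[OF k(1)]] by simp
      qed
      moreover have "y k \<in> carrier (Q k)" using y(1) k(1) by (simp add: carrier_hahn)
      ultimately have "\<one>\<^bsub>Q k\<^esub> = y k" by (intro Qk.gle_antisym Qk.one_closed)
      then show False using k(2) by simp
    qed
  qed
qed

text \<open>
  Let \<open>C\<close> be the convex subgroup of all elements vanishing below \<open>i\<close>, and \<open>C'\<close> that of the elements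
  vanishing at \<open>i\<close> as well. An element supported at \<open>i\<close> alone generates a principal convex
  subgroup that is contained in \<open>C\<close> but not in \<open>C'\<close>. As this subgroup is also generated by images
  of elements of \<open>D\<close>, not all of these can lie in \<open>C'\<close>.
\<close>

lemma rank_preserving_leading_index:
  assumes D: "ordered_comm_group D" and h: "h \<in> ogroup_emb D P"
    and rank: "rank_preserving D P h"
    and i: "i \<in> Field r" and q: "q \<in> carrier (Q i)" "q \<noteq> \<one>\<^bsub>Q i\<^esub>"
  obtains y where "y \<in> carrier D" "h y i \<noteq> \<one>\<^bsub>Q i\<^esub>"
    "\<And>j. (j, i) \<in> r \<Longrightarrow> j \<noteq> i \<Longrightarrow> h y j = \<one>\<^bsub>Q j\<^esub>"
proof -
  interpret P: ordered_comm_group P by (rule hahn_ordered_comm_group)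
  let ?van = "\<lambda>J. {w \<in> carrier P. \<forall>j\<in>J. w j = \<one>\<^bsub>Q j\<^esub>}"
  let ?C = "?van {j. (j, i) \<in> r \<and> j \<noteq> i}" and ?C' = "?van {j. (j, i) \<in> r}"
  have C: "convex_subgroup ?C P"
    by (intro vanishing_convex) (use rel_trans rel_antisym in blast)
  have C': "convex_subgroup ?C' P"
    by (intro vanishing_convex) (use rel_trans in blast)
  let ?w = "\<lambda>j. if j = i then q else \<one>\<^bsub>Q j\<^esub>"
  have "wo_set r {j. ?w j \<noteq> \<one>\<^bsub>Q j\<^esub>}"
    unfolding wo_set_def using rel_refl[OF i] by (auto simp: subset_iff split: if_splits)
  moreover have "?w j \<in> carrier (Q j)" if "j \<in> Field r" for j
    using P.one_closed that q by (simp add: carrier_hahn)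
  moreover have "?w j = \<one>\<^bsub>Q j\<^esub>" if "j \<notin> Field r" for j
    using i that by auto
  ultimately have w: "?w \<in> carrier P"
    unfolding carrier_hahn by blast
  have ne: "?w \<noteq> \<one>\<^bsub>P\<^esub>"
  proof
    assume "?w = \<one>\<^bsub>P\<^esub>"
    from fun_cong[OF this, of i] show False using q by simp
  qed
  have "convex_hull_group P {?w} \<in> Prin P"
    unfolding Prin_def by (intro CollectI exI[of _ ?w] conjI refl w ne)
  then have "convex_hull_group P {?w} \<in> (\<lambda>H. convex_hull_group P (h ` H)) ` Prin D"
    using rank by (simp add: rank_preserving_def)
  then obtain H where H: "H \<in> Prin D"
      "convex_hull_group P {?w} = convex_hull_group P (h ` H)"
    by (rule imageE)
  have HD: "H \<subseteq> carrier D"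
    using ordered_comm_group.Prin_convex[OF D H(1)] subgroup.subset[of H D]
    by (simp add: convex_subgroup_def)
  have hH: "h ` H \<subseteq> carrier P" using HD ogroup_embD(1)[OF h] by blast
  have "?w \<in> ?C" using w by auto
  then have "h ` H \<subseteq> ?C"
    using P.convex_hull_min[OF C, of "{?w}"] P.convex_hull_superset[of "h ` H"] H(2) by blast
  moreover have "\<not> h ` H \<subseteq> ?C'"
  proof
    assume "h ` H \<subseteq> ?C'"
    then have "?w \<in> ?C'"
      using P.convex_hull_min[OF C'] P.convex_hull_superset[of "{?w}"] H(2) by blast
    then show False using q rel_refl[OF i] by auto
  qed
  ultimately obtain y where y: "y \<in> H" "h y \<in> ?C" "h y \<notin> ?C'" by blast
  then have "h y i \<noteq> \<one>\<^bsub>Q i\<^esub>" by auto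
  with y HD that show ?thesis by blast
qed

end

section \<open>The index set enlarged by its cuts\<close>

lemma real_ogroup_simps [simp]:
  "carrier real_ogroup = UNIV" "x \<otimes>\<^bsub>real_ogroup\<^esub> y = x + y" "\<one>\<^bsub>real_ogroup\<^esub> = 0"
  "x \<preceq>\<^bsub>real_ogroup\<^esub> y \<longleftrightarrow> x \<le> y"
  by (simp_all add: real_ogroup_def)

lemma real_ordered_comm_group: "ordered_comm_group real_ogroup"
  by (rule ordered_comm_groupI) (auto intro: exI[of _ "- x" for x])

context linear_rel
begin

lemma initial_segments_chain:
  assumes "ofilter r S" "ofilter r T"
  shows "S \<subseteq> T \<or> T \<subseteq> S"
proof (rule ccontr)
  assume "\<not> ?thesis"
  then obtain s t where st: "s \<in> S" "s \<notin> T" "t \<in> T" "t \<notin> S" by blast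
  then have "(s, t) \<in> r \<or> (t, s) \<in> r" using assms by (intro rel_total) (auto simp: ofilter_def)
  then show False using st assms by (auto simp: ofilter_def under_def)
qed

lemma cut_rel_iff [simp]:
  "(Old i, Old j) \<in> cut_rel r \<longleftrightarrow> (i, j) \<in> r"
  "(Old i, Cut S) \<in> cut_rel r \<longleftrightarrow> ofilter r S \<and> i \<in> S"
  "(Cut S, Old i) \<in> cut_rel r \<longleftrightarrow> ofilter r S \<and> i \<in> Field r \<and> i \<notin> S"
  "(Cut S, Cut T) \<in> cut_rel r \<longleftrightarrow> ofilter r S \<and> ofilter r T \<and> S \<subseteq> T"
  using rel_Field by (auto simp: cut_rel_def Let_def ofilter_def)

lemma Field_cut_rel_iff [simp]:
  "Old i \<in> Field (cut_rel r) \<longleftrightarrow> i \<in> Field r"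
  "Cut S \<in> Field (cut_rel r) \<longleftrightarrow> ofilter r S"
proof -
  have F: "k \<in> Field (cut_rel r) \<longleftrightarrow> (k, k) \<in> cut_rel r" for k
  proof
    assume "k \<in> Field (cut_rel r)"
    then have "k \<in> Old ` Field r \<union> Cut ` {S. ofilter r S}"
      by (auto simp: Field_def cut_rel_def Let_def)
    then show "(k, k) \<in> cut_rel r" using rel_refl by auto
  qed (auto simp: Field_def)
  show "Old i \<in> Field (cut_rel r) \<longleftrightarrow> i \<in> Field r"
    unfolding F using rel_refl rel_Field by auto
  show "Cut S \<in> Field (cut_rel r) \<longleftrightarrow> ofilter r S" unfolding F by simp
qed

lemma cut_rel_linear: "Linear_order (cut_rel r)"
  unfolding order_on_defs
proof (intro conjI)
  show "cut_rel r \<subseteq> Field (cut_rel r) \<times> Field (cut_rel r)" by (auto simp: Field_def)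
  show "refl_on (Field (cut_rel r)) (cut_rel r)"
  proof (rule refl_onI)
    fix k assume "k \<in> Field (cut_rel r)"
    then show "(k, k) \<in> cut_rel r" using rel_refl by (cases k) auto
  qed
  show "trans (cut_rel r)"
  proof (rule transI)
    fix a b c assume ab: "(a, b) \<in> cut_rel r" and bc: "(b, c) \<in> cut_rel r"
    have down: "i \<in> S" if "ofilter r S" "j \<in> S" "(i, j) \<in> r" for i j S
      using that by (auto simp: ofilter_def under_def)
    show "(a, c) \<in> cut_rel r"
    proof (cases b)
      case (Old j)
      show ?thesis
      proof (cases a; cases c)
        fix i k assume [simp]: "a = Old i" "c = Old k"
        show ?thesis using ab bc Old rel_trans by simp
      next
        fix i T assume [simp]: "a = Old i" "c = Cut T"
        show ?thesis using ab bc Old down by auto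
      next
        fix S k assume [simp]: "a = Cut S" "c = Old k"
        show ?thesis using ab bc Old down rel_Field[of j k] by auto
      next
        fix S T assume [simp]: "a = Cut S" "c = Cut T"
        then have "ofilter r S" "ofilter r T" "j \<in> T" "j \<notin> S" using ab bc Old by auto
        then show ?thesis using initial_segments_chain by auto
      qed
    next
      case (Cut U)
      show ?thesis
      proof (cases a; cases c)
        fix i k assume [simp]: "a = Old i" "c = Old k"
        have i: "ofilter r U" "i \<in> U" "k \<in> Field r" "k \<notin> U" using ab bc Cut by auto
        then have "i \<in> Field r" by (auto simp: ofilter_def)
        then show ?thesis using i rel_total[of i k] down by auto
      next
        fix i T assume [simp]: "a = Old i" "c = Cut T"
        show ?thesis using ab bc Cut by auto
      next
        fix S k assume [simp]: "a = Cut S" "c = Old k"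
        show ?thesis using ab bc Cut by auto
      next
        fix S T assume [simp]: "a = Cut S" "c = Cut T"
        show ?thesis using ab bc Cut by auto
      qed
    qed
  qed
  show "antisym (cut_rel r)"
  proof (rule antisymI)
    fix a b assume "(a, b) \<in> cut_rel r" "(b, a) \<in> cut_rel r"
    then show "a = b" using rel_antisym by (cases a; cases b) auto
  qed
  show "total_on (Field (cut_rel r)) (cut_rel r)"
  proof (rule total_onI)
    fix a b assume "a \<in> Field (cut_rel r)" "b \<in> Field (cut_rel r)"
    then show "(a, b) \<in> cut_rel r \<or> (b, a) \<in> cut_rel r"
      using rel_total initial_segments_chain by (cases a; cases b) auto
  qed
qed

end

section \<open>The embedding of the divisible hull\<close>

locale hahn_embedded = ordered_comm_group \<Gamma> for \<Gamma> :: "'g ogroup" (structure) +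
  fixes e h
  assumes hahn_embedding: "hahn_embedding \<Gamma> e h"
begin

abbreviation "I \<equiv> Prin_rel \<Gamma>"
abbreviation "C \<equiv> cut_rel (Prin_rel \<Gamma>)"

sublocale I: linear_rel I
  by unfold_locales (rule Prin_rel_Linear_order)

sublocale D: ordered_comm_group D
  by (rule div_hull_ordered_comm_group)

text \<open>
  This is the identification of the principal convex subgroups of \<open>\<Gamma>\<close> with those of its divisible
  hull: the convex subgroup generated by the image of \<open>i\<close> is principal, because the preimage of a
  convex subgroup of the hull is convex.
\<close>

lemma hull_index:
  assumes "i \<in> Prin \<Gamma>"
  obtains x where "x \<in> carrier \<Gamma>" "x \<noteq> \<one>"
    "convex_hull_group D (to_hull \<Gamma> ` i) = convex_hull_group D {to_hull \<Gamma> x}"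
proof -
  interpret t: ogroup_embedding \<Gamma> D "to_hull \<Gamma>"
    by unfold_locales (rule to_hull_emb)
  obtain x where x: "x \<in> carrier \<Gamma>" "x \<noteq> \<one>" "i = convex_hull_group \<Gamma> {x}"
    using assms by (auto simp: Prin_def)
  have conv: "convex_subgroup i \<Gamma>" using assms by (rule Prin_convex)
  have i: "i \<subseteq> carrier \<Gamma>" using conv subgroup.subset by (auto simp: convex_subgroup_def)
  let ?K = "convex_hull_group D {to_hull \<Gamma> x}"
  have K: "convex_subgroup ?K D" using x by (intro D.convex_hull_convex) auto
  then have sK: "subgroup ?K D" by (simp add: convex_subgroup_def)
  let ?P = "{y \<in> carrier \<Gamma>. to_hull \<Gamma> y \<in> ?K}"
  have "convex_subgroup ?P \<Gamma>"
    unfolding convex_subgroup_def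
  proof (intro conjI ballI impI)
    show "subgroup ?P \<Gamma>"
      by standard (use sK in \<open>auto simp: subgroup.m_closed subgroup.m_inv_closed subgroup.one_closed\<close>)
    fix a b assume a: "a \<in> ?P" and b: "b \<in> carrier \<Gamma>" "\<one> \<preceq> b \<and> b \<preceq> a"
    then have "\<one>\<^bsub>D\<^esub> \<preceq>\<^bsub>D\<^esub> to_hull \<Gamma> b" "to_hull \<Gamma> b \<preceq>\<^bsub>D\<^esub> to_hull \<Gamma> a"
      using t.emb_gle[of \<one> b] t.emb_gle[of b a] by auto
    then show "b \<in> ?P" using K a b t.hom_closed[of b] unfolding convex_subgroup_def by blast
  qed
  moreover have "x \<in> ?P" using x D.convex_hull_superset[of "{to_hull \<Gamma> x}"] by auto
  ultimately have "i \<subseteq> ?P" using convex_hull_min[of ?P "{x}"] x by blast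
  then have "convex_hull_group D (to_hull \<Gamma> ` i) \<subseteq> ?K" by (intro D.convex_hull_min[OF K]) auto
  moreover have "?K \<subseteq> convex_hull_group D (to_hull \<Gamma> ` i)"
  proof (rule D.convex_hull_min)
    show "convex_subgroup (convex_hull_group D (to_hull \<Gamma> ` i)) D"
      by (intro D.convex_hull_convex) (use i in auto)
    show "{to_hull \<Gamma> x} \<subseteq> convex_hull_group D (to_hull \<Gamma> ` i)"
      using convex_hull_superset[of "{x}"] D.convex_hull_superset[of "to_hull \<Gamma> ` i"] x by auto
  qed
  ultimately show ?thesis using that x by blast
qed

lemma hull_index_Prin: "i \<in> Prin \<Gamma> \<Longrightarrow> convex_hull_group D (to_hull \<Gamma> ` i) \<in> Prin D"
  and hull_component_nontrivial: "i \<in> Prin \<Gamma> \<Longrightarrow> \<exists>q\<in>carrier (hull_component \<Gamma> i). q \<noteq> \<one>\<^bsub>hull_component \<Gamma> i\<^esub>"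
proof -
  assume "i \<in> Prin \<Gamma>"
  then obtain x where x: "x \<in> carrier \<Gamma>" "x \<noteq> \<one>"
    "convex_hull_group D (to_hull \<Gamma> ` i) = convex_hull_group D {to_hull \<Gamma> x}" by (rule hull_index)
  interpret t: ogroup_embedding \<Gamma> D "to_hull \<Gamma>"
    by unfold_locales (rule to_hull_emb)
  let ?H = "convex_hull_group D {to_hull \<Gamma> x}" and ?t = "to_hull \<Gamma> x"
  have t: "?t \<in> carrier D" "?t \<noteq> \<one>\<^bsub>D\<^esub>" using x t.emb_eq[of x \<one>] by auto
  then have H: "?H \<in> Prin D" by (auto simp: Prin_def)
  then show "convex_hull_group D (to_hull \<Gamma> ` i) \<in> Prin D" using x by simp
  let ?N = "lower_subgroup D ?H"
  have "?t \<in> ?H" using D.convex_hull_superset[of "{?t}"] by blast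
  then have car: "?N #>\<^bsub>D\<^esub> ?t \<in> carrier (component D ?H)"
    unfolding D.component_carrier_iff by blast
  have "subgroup ?N D" using D.lower_subgroup_convex[OF H] by (simp add: convex_subgroup_def)
  then have "?t \<in> ?N #>\<^bsub>D\<^esub> ?t" using t D.rcos_self by blast
  moreover have "?t \<notin> ?N" using t D.generator_notin_lower_subgroup by blast
  ultimately have "?N #>\<^bsub>D\<^esub> ?t \<noteq> ?N" by blast
  then show "\<exists>q\<in>carrier (hull_component \<Gamma> i). q \<noteq> \<one>\<^bsub>hull_component \<Gamma> i\<^esub>"
    using car x unfolding hull_component_def by (intro bexI[of _ "?N #>\<^bsub>D\<^esub> ?t"]) simp_all
qed

abbreviation "Q \<equiv> hull_component \<Gamma>"

sublocale P: hahn_product I Q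
proof (intro hahn_product.intro hahn_product_axioms.intro I.linear_rel_axioms)
  fix i assume "i \<in> Field I"
  then have "convex_hull_group D (to_hull \<Gamma> ` i) \<in> Prin D"
    by (simp add: Field_Prin_rel hull_index_Prin)
  then show "ordered_comm_group (Q i)"
    unfolding hull_component_def by (rule D.component_ordered_comm_group)
qed

lemma e_emb: "i \<in> Prin \<Gamma> \<Longrightarrow> ogroup_embedding (Q i) real_ogroup (e i)"
  using P.Q[of i] hahn_embedding real_ordered_comm_group
  unfolding hahn_embedding_def ogroup_embedding_def ogroup_embedding_axioms_def Field_Prin_rel
  by blast

sublocale h: ogroup_embedding D "hahn I Q" h
  using hahn_embedding P.hahn_ordered_comm_group D.ordered_comm_group_axioms
  unfolding hahn_embedding_def ogroup_embedding_def ogroup_embedding_axioms_def Let_def by blast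

lemma leading_index:
  assumes "i \<in> Prin \<Gamma>"
  obtains y where "y \<in> carrier D" "h y i \<noteq> \<one>\<^bsub>Q i\<^esub>"
    "\<And>j. (j, i) \<in> I \<Longrightarrow> j \<noteq> i \<Longrightarrow> h y j = \<one>\<^bsub>Q j\<^esub>"
proof -
  have "rank_preserving D (hahn I Q) h"
    using hahn_embedding by (simp add: hahn_embedding_def immediate_ext_def Let_def)
  moreover obtain q where "q \<in> carrier (Q i)" "q \<noteq> \<one>\<^bsub>Q i\<^esub>"
    using hull_component_nontrivial[OF assms] by blast
  ultimately show ?thesis
    using P.rank_preserving_leading_index[OF D.ordered_comm_group_axioms h.emb, of i q] assms that
    by (metis Field_Prin_rel)
qed

sublocale R: hahn_product C "\<lambda>_. real_ogroup"
  by (intro hahn_product.intro hahn_product_axioms.intro linear_rel.intro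
      I.cut_rel_linear real_ordered_comm_group)

sublocale R: ordered_comm_group "R_cut \<Gamma>"
  unfolding R_cut_def by (rule R.hahn_ordered_comm_group)

abbreviation "\<l> \<equiv> hull_to_R \<Gamma> e h"

lemma l_Old: "i \<in> Prin \<Gamma> \<Longrightarrow> \<l> x (Old i) = e i (h x i)"
  and l_Cut [simp]: "\<l> x (Cut S) = 0"
  and l_outside: "i \<notin> Prin \<Gamma> \<Longrightarrow> \<l> x (Old i) = 0"
  by (simp_all add: hull_to_R_def)

lemma h_in: "x \<in> carrier D \<Longrightarrow> i \<in> Prin \<Gamma> \<Longrightarrow> h x i \<in> carrier (Q i)"
  using h.hom_closed[of x] P.carrier_hahn[of "h x"] by (simp add: Field_Prin_rel)

lemma l_eq_0_iff:
  assumes "x \<in> carrier D" "i \<in> Prin \<Gamma>"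
  shows "\<l> x (Old i) = 0 \<longleftrightarrow> h x i = \<one>\<^bsub>Q i\<^esub>"
proof -
  interpret e: ogroup_embedding "Q i" real_ogroup "e i" using assms e_emb by simp
  show ?thesis using e.emb_eq[OF h_in[OF assms] e.G.one_closed] assms e.hom_one by (simp add: l_Old)
qed

lemma l_closed:
  assumes "x \<in> carrier D"
  shows "\<l> x \<in> carrier (R_cut \<Gamma>)"
  unfolding R_cut_def R.carrier_hahn
proof (intro conjI allI ballI impI)
  show "\<l> x k = \<one>\<^bsub>real_ogroup\<^esub>" if "k \<notin> Field C" for k
    using that by (cases k) (simp_all add: Field_Prin_rel l_outside)
  show "wo_set C {k. \<l> x k \<noteq> \<one>\<^bsub>real_ogroup\<^esub>}"
    unfolding wo_set_def
  proof (intro allI impI)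
    fix B assume B: "B \<subseteq> {k. \<l> x k \<noteq> \<one>\<^bsub>real_ogroup\<^esub>}" "B \<noteq> {}"
    let ?B = "{i. Old i \<in> B}"
    have BO: "\<exists>i\<in>?B. k = Old i" if "k \<in> B" for k using that B by (cases k) auto
    have "?B \<subseteq> {i. h x i \<noteq> \<one>\<^bsub>Q i\<^esub>}"
    proof clarify
      fix i assume "Old i \<in> B" and 1: "h x i = \<one>\<^bsub>Q i\<^esub>"
      then have ne: "\<l> x (Old i) \<noteq> 0" using B by auto
      then have "i \<in> Prin \<Gamma>" using l_outside by blast
      then show False using 1 ne l_eq_0_iff assms by blast
    qed
    moreover have "wo_set I {i. h x i \<noteq> \<one>\<^bsub>Q i\<^esub>}"
      using h.hom_closed[OF assms] by (simp add: P.carrier_hahn)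
    moreover have "?B \<noteq> {}" using B BO by blast
    ultimately obtain m where "m \<in> ?B" "\<forall>b\<in>?B. (m, b) \<in> I" unfolding wo_set_def by blast
    then show "\<exists>m\<in>B. \<forall>b\<in>B. (m, b) \<in> C"
      using BO by (intro bexI[of _ "Old m"]) fastforce+
  qed
qed simp

lemma l_mult:
  assumes "x \<in> carrier D" "y \<in> carrier D"
  shows "\<l> (x \<otimes>\<^bsub>D\<^esub> y) k = \<l> x k + \<l> y k"
proof (cases k)
  case (Old i)
  show ?thesis
  proof (cases "i \<in> Prin \<Gamma>")
    case True
    interpret e: ogroup_embedding "Q i" real_ogroup "e i" using True e_emb by simp
    show ?thesis
      using True assms h_in[OF _ True] e.hom_mult[of "h x i" "h y i"]
      by (simp add: l_Old Old Field_Prin_rel)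
  qed (simp add: l_outside Old)
qed simp

lemma l_emb: "\<l> \<in> ogroup_emb D (R_cut \<Gamma>)"
  unfolding ogroup_emb_def hom_def
proof (intro CollectI conjI ballI Pi_I)
  fix x assume x: "x \<in> carrier D"
  show "\<l> x \<in> carrier (R_cut \<Gamma>)" using x by (rule l_closed)
  fix y assume y: "y \<in> carrier D"
  have xy: "\<l> (x \<otimes>\<^bsub>D\<^esub> y) \<in> carrier (R_cut \<Gamma>)" using x y by (intro l_closed) auto
  show "\<l> (x \<otimes>\<^bsub>D\<^esub> y) = \<l> x \<otimes>\<^bsub>R_cut \<Gamma>\<^esub> \<l> y"
  proof
    fix k
    show "\<l> (x \<otimes>\<^bsub>D\<^esub> y) k = (\<l> x \<otimes>\<^bsub>R_cut \<Gamma>\<^esub> \<l> y) k"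
      using l_mult[OF x y] xy by (simp add: R_cut_def R.carrier_hahn)
  qed
  show "x \<preceq>\<^bsub>D\<^esub> y \<longleftrightarrow> \<l> x \<preceq>\<^bsub>R_cut \<Gamma>\<^esub> \<l> y"
  proof (cases "x = y")
    case True
    then show ?thesis using D.gle_refl R.gle_refl x l_closed by simp
  next
    case False
    then have "h x \<noteq> h y" using h.emb_eq x y by blast
    then obtain i where i: "i \<in> Field I" "h x i \<noteq> h y i" "\<And>j. (j, i) \<in> I \<Longrightarrow> j \<noteq> i \<Longrightarrow> h x j = h y j"
      using P.first_difference[OF h.hom_closed[OF x] h.hom_closed[OF y]] by metis
    have iP: "i \<in> Prin \<Gamma>" using i Field_Prin_rel by simp
    interpret e: ogroup_embedding "Q i" real_ogroup "e i" using iP e_emb by simp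
    have ne: "\<l> x (Old i) \<noteq> \<l> y (Old i)"
      using i e.emb_eq[OF h_in[OF x iP] h_in[OF y iP]] iP by (simp add: l_Old)
    have below: "\<l> x k = \<l> y k" if "(k, Old i) \<in> C" "k \<noteq> Old i" for k
      using that i(3) by (cases k) (auto simp: hull_to_R_def)
    have "x \<preceq>\<^bsub>D\<^esub> y \<longleftrightarrow> h x i \<preceq>\<^bsub>Q i\<^esub> h y i"
      using h.emb_gle[OF x y] P.hahn_gle_at[OF h.hom_closed[OF x] h.hom_closed[OF y] i] by simp
    also have "\<dots> \<longleftrightarrow> \<l> x (Old i) \<le> \<l> y (Old i)"
      using e.emb_gle[OF h_in[OF x iP] h_in[OF y iP]] iP by (simp add: l_Old)
    also have "\<dots> \<longleftrightarrow> \<l> x \<preceq>\<^bsub>R_cut \<Gamma>\<^esub> \<l> y"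
      using R.hahn_gle_at[of "\<l> x" "\<l> y" "Old i"] l_closed[OF x] l_closed[OF y] i(1) ne below
      by (simp add: R_cut_def)
    finally show ?thesis .
  qed
qed

end

section \<open>Realizing cuts in a real Hahn product\<close>

context linear_rel
begin

text \<open>
  This makes the support of a glued element well-ordered: up to any of its indices it agrees with
  the support of an approximation.
\<close>

lemma wo_set_local:
  assumes "\<And>b. b \<in> A \<Longrightarrow> wo_set r {a \<in> A. (a, b) \<in> r}" and A: "A \<subseteq> Field r"
  shows "wo_set r A"
  unfolding wo_set_def
proof (intro allI impI)
  fix B assume B: "B \<subseteq> A" "B \<noteq> {}"
  then obtain b where b: "b \<in> B" by blast
  then have bA: "b \<in> A" using B by blast
  have bF: "b \<in> Field r" using bA A by blast
  have "wo_set r {a \<in> A. (a, b) \<in> r}" using assms(1) bA .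
  moreover have "{a \<in> B. (a, b) \<in> r} \<subseteq> {a \<in> A. (a, b) \<in> r}" using B by blast
  moreover have "{a \<in> B. (a, b) \<in> r} \<noteq> {}" using b rel_refl[OF bF] by blast
  ultimately obtain m where m: "m \<in> {a \<in> B. (a, b) \<in> r}" "\<forall>a\<in>{a \<in> B. (a, b) \<in> r}. (m, a) \<in> r"
    unfolding wo_set_def by blast
  have "(m, c) \<in> r" if "c \<in> B" for c
  proof (cases "(c, b) \<in> r")
    case False
    then have "(b, c) \<in> r" using rel_total[OF bF, of c] that B A by blast
    then show ?thesis using m(1) rel_trans[of m b c] by blast
  qed (use m that in blast)
  then show "\<exists>m\<in>B. \<forall>b\<in>B. (m, b) \<in> r" using m by blast
qed

lemma real_hahn_product: "hahn_product r (\<lambda>_. real_ogroup)"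
  by (intro hahn_product.intro hahn_product_axioms.intro linear_rel_axioms real_ordered_comm_group)

lemma hahn_real_gle: "f \<preceq>\<^bsub>hahn_real r\<^esub> g \<longleftrightarrow> f = g \<or> lex_less r f g"
  unfolding hahn_gle lex_less_def by (auto simp: less_le) 

lemma lex_less_irrefl: "\<not> lex_less r f f"
  by (simp add: lex_less_def)

lemma lex_less_total:
  assumes "f \<in> carrier (hahn_real r)" "g \<in> carrier (hahn_real r)" "f \<noteq> g"
  shows "lex_less r f g \<or> lex_less r g f"
  using ordered_comm_group.gle_total[OF hahn_product.hahn_ordered_comm_group[OF real_hahn_product] assms(1,2)]
    assms(3) by (auto simp: hahn_real_gle)

lemma lex_less_asym:
  assumes "f \<in> carrier (hahn_real r)" "g \<in> carrier (hahn_real r)" "lex_less r f g"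
  shows "\<not> lex_less r g f"
  using ordered_comm_group.gle_antisym[OF hahn_product.hahn_ordered_comm_group[OF real_hahn_product] assms(1,2)]
    assms(3) lex_less_irrefl[of f] by (auto simp: hahn_real_gle)

end

text \<open>
  A group \<open>V\<close> of functions closed under division by two, together with the lower half \<open>D\<close> of a cut
  in it. Division by two serves to turn the triangle inequality for two small distances into a
  strict comparison. By the condition on leading indices, \<open>V\<close> has elements at every scale \<open>i\<close>.
\<close>

locale cut_space = linear_rel r for r :: "'i rel" +
  fixes V D :: "('i cut_idx \<Rightarrow> real) set"
  assumes V_carrier: "f \<in> V \<Longrightarrow> f \<in> carrier (hahn_real (cut_rel r))"
    and V_Cut: "f \<in> V \<Longrightarrow> f (Cut S) = 0"
    and V_add: "f \<in> V \<Longrightarrow> g \<in> V \<Longrightarrow> (\<lambda>k. f k + g k) \<in> V"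
    and V_diff: "f \<in> V \<Longrightarrow> g \<in> V \<Longrightarrow> (\<lambda>k. f k - g k) \<in> V"
    and V_half: "f \<in> V \<Longrightarrow> (\<lambda>k. f k / 2) \<in> V"
    and V_lead: "i \<in> Field r \<Longrightarrow>
      \<exists>f\<in>V. f (Old i) > 0 \<and> (\<forall>j. (j, i) \<in> r \<and> j \<noteq> i \<longrightarrow> f (Old j) = 0)"
    and D_subset: "D \<subseteq> V"
    and D_down: "w \<in> D \<Longrightarrow> u \<in> V \<Longrightarrow> lex_less (cut_rel r) u w \<Longrightarrow> u \<in> D"
begin

abbreviation "C \<equiv> cut_rel r"

sublocale C: linear_rel C
  by (rule linear_rel.intro) (rule cut_rel_linear)

sublocale R: hahn_product C "\<lambda>_. real_ogroup"
  by (rule C.real_hahn_product)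

lemma V_outside: "f \<in> V \<Longrightarrow> i \<notin> Field r \<Longrightarrow> f (Old i) = 0"
  using V_carrier[of f] by (simp add: R.carrier_hahn)

lemma V_differ_Field: "f \<in> V \<Longrightarrow> g \<in> V \<Longrightarrow> f (Old i) \<noteq> g (Old i) \<Longrightarrow> i \<in> Field r"
  using V_outside[of f i] V_outside[of g i] by fastforce

lemma V_Cut_eq: "f \<in> V \<Longrightarrow> g \<in> V \<Longrightarrow> f (Cut S) = g (Cut S)"
  using V_Cut[of f S] V_Cut[of g S] by simp

lemma lex_less_V_iff:
  assumes "f \<in> V" "g \<in> V"
  shows "lex_less C f g \<longleftrightarrow> (\<exists>i. f (Old i) < g (Old i) \<and> (\<forall>j. (j, i) \<in> r \<and> j \<noteq> i \<longrightarrow> f (Old j) = g (Old j)))"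
proof
  assume "lex_less C f g"
  then obtain k where k: "f k < g k" "\<And>l. (l, k) \<in> C \<Longrightarrow> l \<noteq> k \<Longrightarrow> f l = g l"
    by (auto simp: lex_less_def)
  then obtain i where "k = Old i" using V_Cut_eq[OF assms] by (cases k) auto
  then show "\<exists>i. f (Old i) < g (Old i) \<and> (\<forall>j. (j, i) \<in> r \<and> j \<noteq> i \<longrightarrow> f (Old j) = g (Old j))"
    using k by (intro exI[of _ i]) simp
next
  assume "\<exists>i. f (Old i) < g (Old i) \<and> (\<forall>j. (j, i) \<in> r \<and> j \<noteq> i \<longrightarrow> f (Old j) = g (Old j))"
  then obtain i where i: "f (Old i) < g (Old i)" "\<And>j. (j, i) \<in> r \<Longrightarrow> j \<noteq> i \<Longrightarrow> f (Old j) = g (Old j)"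
    by blast
  then have "i \<in> Field r" using V_differ_Field[OF assms, of i] by simp
  moreover have "f l = g l" if "(l, Old i) \<in> C" "l \<noteq> Old i" for l
    using that i V_Cut_eq[OF assms] by (cases l) auto
  ultimately show "lex_less C f g" unfolding lex_less_def using i by (intro bexI[of _ "Old i"]) auto
qed

lemma V_total: "f \<in> V \<Longrightarrow> g \<in> V \<Longrightarrow> f \<noteq> g \<Longrightarrow> lex_less C f g \<or> lex_less C g f"
  using C.lex_less_total V_carrier by blast

lemma not_D_up: "w \<in> V \<Longrightarrow> w \<notin> D \<Longrightarrow> u \<in> V \<Longrightarrow> lex_less C w u \<Longrightarrow> u \<notin> D"
  using D_down by blast

definition pos_lead :: "'i \<Rightarrow> ('i cut_idx \<Rightarrow> real) \<Rightarrow> bool" where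
  "pos_lead i h \<longleftrightarrow> h \<in> V \<and> h (Old i) > 0 \<and> (\<forall>j. (j, i) \<in> r \<and> j \<noteq> i \<longrightarrow> h (Old j) = 0)"

text \<open>
  Let \<open>\<gamma>\<close> be a virtual point in the cut. The condition says that the distance of \<open>g\<close> to \<open>\<gamma>\<close> is
  less than every positive element of leading index \<open>i\<close>. It is expressed by the positions of \<open>g - h\<close>
  and \<open>g + h\<close>, since \<open>\<gamma>\<close> need not be an element of any group.
\<close>

definition near :: "'i \<Rightarrow> ('i cut_idx \<Rightarrow> real) \<Rightarrow> bool" where
  "near i g \<longleftrightarrow> g \<in> V \<and> i \<in> Field r \<and>
     (\<forall>h. pos_lead i h \<longrightarrow> (\<lambda>k. g k - h k) \<in> D \<and> (\<lambda>k. g k + h k) \<notin> D)"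

lemma pos_lead_half: "pos_lead i h \<Longrightarrow> pos_lead i (\<lambda>k. h k / 2)"
  by (simp add: pos_lead_def V_half)

lemma pos_lead_Field: "pos_lead i h \<Longrightarrow> i \<in> Field r"
  unfolding pos_lead_def using V_outside[of h i] by force

lemma lex_less_pos_lead:
  assumes "pos_lead i h" and u: "u \<in> V" "lex_less C h u"
  obtains j where "(j, i) \<in> r" "u (Old j) > 0" "\<And>l. (l, j) \<in> r \<Longrightarrow> l \<noteq> j \<Longrightarrow> u (Old l) = 0"
proof -
  have h: "h \<in> V" "h (Old i) > 0" "\<And>j. (j, i) \<in> r \<Longrightarrow> j \<noteq> i \<Longrightarrow> h (Old j) = 0"
    using assms by (auto simp: pos_lead_def)
  obtain m where m: "h (Old m) < u (Old m)" "\<And>j. (j, m) \<in> r \<Longrightarrow> j \<noteq> m \<Longrightarrow> h (Old j) = u (Old j)"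
    using u h by (auto simp: lex_less_V_iff)
  have mF: "m \<in> Field r" using m(1) V_differ_Field[OF h(1) u(1), of m] by simp
  have iF: "i \<in> Field r" using pos_lead_Field assms by blast
  show ?thesis
  proof (cases "(m, i) \<in> r")
    case True
    have "u (Old m) > 0" using m(1) h(2) h(3)[OF True] by (cases "m = i") auto
    moreover have "u (Old l) = 0" if "(l, m) \<in> r" "l \<noteq> m" for l
    proof -
      have "(l, i) \<in> r" "l \<noteq> i" using that True rel_trans rel_antisym by blast+
      then show ?thesis using m(2)[OF that] h(3)[of l] by simp
    qed
    ultimately show ?thesis using that True by blast
  next
    case False
    then have im: "(i, m) \<in> r" "i \<noteq> m" using rel_total[OF mF iF] rel_refl[OF mF] by auto
    have eq: "h (Old l) = u (Old l)" if "(l, i) \<in> r" for l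
      using m(2)[of l] that im rel_trans rel_antisym by blast
    show ?thesis
    proof (rule that)
      show "(i, i) \<in> r" using iF by (rule rel_refl)
      show "u (Old i) > 0" using eq[OF rel_refl[OF iF]] h(2) by simp
      show "u (Old l) = 0" if "(l, i) \<in> r" "l \<noteq> i" for l
        using eq[OF that(1)] h(3)[OF that] by simp
    qed
  qed
qed

lemma near_le:
  assumes g: "near i g" and ji: "(j, i) \<in> r"
  shows "near j g"
proof (cases "i = j")
  case False
  have gV: "g \<in> V" and iF: "i \<in> Field r" using g by (auto simp: near_def)
  obtain h where h: "pos_lead i h" using V_lead[OF iF] by (auto simp: pos_lead_def)
  then have hV: "h \<in> V" by (simp add: pos_lead_def)
  have nh: "(\<lambda>k. g k - h k) \<in> D" "(\<lambda>k. g k + h k) \<notin> D" using g h by (auto simp: near_def)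
  show ?thesis
    unfolding near_def
  proof (intro conjI allI impI)
    fix h' assume h': "pos_lead j h'"
    then have h'V: "h' \<in> V" by (simp add: pos_lead_def)
    have jd: "(l, i) \<in> r \<and> l \<noteq> i" if "(l, j) \<in> r" for l
      using that ji False rel_trans rel_antisym by blast
    have z: "h (Old l) = 0" if "(l, j) \<in> r" for l
      using h jd[OF that] by (simp add: pos_lead_def)
    have z': "h' (Old l) = 0" if "(l, j) \<in> r" "l \<noteq> j" for l
      using h' that by (simp add: pos_lead_def)
    have jF: "j \<in> Field r" using h' by (rule pos_lead_Field)
    have p: "h' (Old j) > 0" "h (Old j) = 0" using h' z[OF rel_refl[OF jF]] by (simp_all add: pos_lead_def)
    have "lex_less C (\<lambda>k. g k - h' k) (\<lambda>k. g k - h k)"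
      using p z z' by (subst lex_less_V_iff) (auto simp: V_diff gV hV h'V intro!: exI[of _ j])
    then show "(\<lambda>k. g k - h' k) \<in> D" using D_down nh V_diff gV h'V by blast
    have "lex_less C (\<lambda>k. g k + h k) (\<lambda>k. g k + h' k)"
      using p z z' by (subst lex_less_V_iff) (auto simp: V_add gV hV h'V intro!: exI[of _ j])
    then show "(\<lambda>k. g k + h' k) \<notin> D" using not_D_up nh V_add gV hV h'V by blast
  qed (use gV ji rel_Field in auto)
qed (use g in simp)

text \<open>
  An element that is not near the cut at scale \<open>i\<close>, while \<open>g\<close> is, differs from \<open>g\<close> visibly, that is,
  by more than half of some element of leading index \<open>i\<close>. The sign of this difference then tells
  its side of the cut.
\<close>

lemma not_near_first_difference:
  assumes g: "near i g" and w: "w \<in> V" and nw: "\<not> near i w"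
  obtains j where "(j, i) \<in> r" "w (Old j) \<noteq> g (Old j)" "w (Old j) < g (Old j) \<longleftrightarrow> w \<in> D"
    "\<And>l. (l, j) \<in> r \<Longrightarrow> l \<noteq> j \<Longrightarrow> w (Old l) = g (Old l)"
proof -
  have gV: "g \<in> V" and iF: "i \<in> Field r" using g by (auto simp: near_def)
  obtain h where h: "pos_lead i h" and c: "(\<lambda>k. w k + h k) \<in> D \<or> (\<lambda>k. w k - h k) \<notin> D"
    using nw w iF by (auto simp: near_def)
  let ?k = "\<lambda>k. h k / 2"
  have k: "pos_lead i ?k" using h by (rule pos_lead_half)
  have V: "h \<in> V" "?k \<in> V" using h k by (auto simp: pos_lead_def)
  have gk: "(\<lambda>l. g l - ?k l) \<in> D" "(\<lambda>l. g l + ?k l) \<notin> D" using g k by (auto simp: near_def)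
  note inV = V_add[OF w V(1)] V_diff[OF w V(1)] V_add[OF gV V(2)] V_diff[OF gV V(2)]
    V_diff[OF gV w] V_diff[OF w gV]
  have hl: "h (Old i) > 0" "\<And>j. (j, i) \<in> r \<Longrightarrow> j \<noteq> i \<Longrightarrow> h (Old j) = 0"
    using h by (auto simp: pos_lead_def)
  from c show ?thesis
  proof
    assume wh: "(\<lambda>k. w k + h k) \<in> D"
    have "lex_less C w (\<lambda>k. w k + h k)"
      using hl by (subst lex_less_V_iff) (auto simp: w inV intro!: exI[of _ i])
    then have wD: "w \<in> D" using D_down wh w by blast
    have "(\<lambda>l. w l + h l) \<noteq> (\<lambda>l. g l + ?k l)" using wh gk by metis
    moreover have "\<not> lex_less C (\<lambda>l. g l + ?k l) (\<lambda>l. w l + h l)" using D_down wh gk inV by blast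
    ultimately have "lex_less C (\<lambda>l. w l + h l) (\<lambda>l. g l + ?k l)" using V_total inV by blast
    then have "lex_less C ?k (\<lambda>l. g l - w l)" unfolding lex_less_def by (simp add: field_simps)
    from lex_less_pos_lead[OF k inV(5) this] obtain j where
      "(j, i) \<in> r" "g (Old j) - w (Old j) > 0" "\<And>l. (l, j) \<in> r \<Longrightarrow> l \<noteq> j \<Longrightarrow> g (Old l) - w (Old l) = 0"
      by blast
    then show ?thesis using that[of j] wD by fastforce
  next
    assume wh: "(\<lambda>k. w k - h k) \<notin> D"
    have "lex_less C (\<lambda>k. w k - h k) w"
      using hl by (subst lex_less_V_iff) (auto simp: w inV intro!: exI[of _ i])
    then have wD: "w \<notin> D" using D_down wh inV by blast
    have "(\<lambda>l. w l - h l) \<noteq> (\<lambda>l. g l - ?k l)" using wh gk by metis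
    moreover have "\<not> lex_less C (\<lambda>l. w l - h l) (\<lambda>l. g l - ?k l)" using D_down wh gk inV by blast
    ultimately have "lex_less C (\<lambda>l. g l - ?k l) (\<lambda>l. w l - h l)" using V_total inV by blast
    then have "lex_less C ?k (\<lambda>l. w l - g l)" unfolding lex_less_def by (simp add: field_simps)
    from lex_less_pos_lead[OF k inV(6) this] obtain j where
      "(j, i) \<in> r" "w (Old j) - g (Old j) > 0" "\<And>l. (l, j) \<in> r \<Longrightarrow> l \<noteq> j \<Longrightarrow> w (Old l) - g (Old l) = 0"
      by blast
    then show ?thesis using that[of j] wD by fastforce
  qed
qed

text \<open>
  If \<open>g\<close> and \<open>g'\<close> first differed at \<open>m\<close>, then half of their difference would be a positive element of
  leading index \<open>m\<close>, and their midpoint would lie on both sides of the cut.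
\<close>

lemma near_agree:
  assumes g: "near i g" and g': "near i g'" and ji: "(j, i) \<in> r"
  shows "g (Old j) = g' (Old j)"
proof (rule ccontr)
  assume ne: "g (Old j) \<noteq> g' (Old j)"
  have no: False if gg: "near i g" "near i g'" and m: "(m, i) \<in> r" "g (Old m) > g' (Old m)"
    "\<And>l. (l, m) \<in> r \<Longrightarrow> l \<noteq> m \<Longrightarrow> g (Old l) = g' (Old l)" for g g' m
  proof -
    have V: "g \<in> V" "g' \<in> V" using gg by (auto simp: near_def)
    let ?d = "\<lambda>k. g k - g' k"
    have "pos_lead m ?d" using m V by (simp add: pos_lead_def V_diff)
    then have p: "pos_lead m (\<lambda>k. ?d k / 2)" by (rule pos_lead_half)
    have "near m g" "near m g'" using near_le gg m(1) by blast+
    then have "(\<lambda>k. g k - ?d k / 2) \<in> D" "(\<lambda>k. g' k + ?d k / 2) \<notin> D"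
      using p by (auto simp: near_def)
    moreover have "(\<lambda>k. g k - ?d k / 2) = (\<lambda>k. g' k + ?d k / 2)" by (auto simp: field_simps)
    ultimately show False by simp
  qed
  have V: "g \<in> V" "g' \<in> V" using g g' by (auto simp: near_def)
  have "g \<noteq> g'" using ne by auto
  then obtain m where m: "g (Old m) \<noteq> g' (Old m)" "\<And>l. (l, m) \<in> r \<Longrightarrow> l \<noteq> m \<Longrightarrow> g (Old l) = g' (Old l)"
    using V_total[OF V] V by (auto simp: lex_less_V_iff) (metis less_irrefl)+
  have "m \<in> Field r" "j \<in> Field r" using V_differ_Field[OF V] m(1) ne by blast+
  then have "(m, j) \<in> r" using rel_total[of m j] m(2)[of j] ne rel_refl[of m] by blast
  then have mi: "(m, i) \<in> r" using ji rel_trans by blast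
  show False
    using no[OF g g' mi] no[OF g' g mi] m by (metis linorder_neqE_linordered_idom)
qed

lemma agree_near:
  assumes g: "near i g" and w: "w \<in> V" and ag: "\<And>j. (j, i) \<in> r \<Longrightarrow> w (Old j) = g (Old j)"
  shows "near i w"
  using not_near_first_difference[OF g w] ag by metis

text \<open>
  A point \<open>x\<close> with the coordinates of an approximation up to scale \<open>i\<close> is on the right side
  of every element that is not near the cut at this scale, whatever its further coordinates are.
  This leaves the freedom to choose the latter.
\<close>

lemma separated_if_agree:
  assumes g: "near i g" and w: "w \<in> V" and nw: "\<not> near i w"
    and x: "\<And>k. (k, Old i) \<in> C \<Longrightarrow> x k = g k"
  shows "(w \<in> D \<longrightarrow> lex_less C w x) \<and> (w \<notin> D \<longrightarrow> lex_less C x w)"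
proof -
  have gV: "g \<in> V" using g by (simp add: near_def)
  obtain j where j: "(j, i) \<in> r" "w (Old j) \<noteq> g (Old j)" "w (Old j) < g (Old j) \<longleftrightarrow> w \<in> D"
    "\<And>l. (l, j) \<in> r \<Longrightarrow> l \<noteq> j \<Longrightarrow> w (Old l) = g (Old l)"
    using not_near_first_difference[OF g w nw] by blast
  have eq: "w k = x k" if "(k, Old j) \<in> C" "k \<noteq> Old j" for k
  proof -
    have "(k, Old i) \<in> C" using that(1) j(1) C.rel_trans[of k "Old j" "Old i"] by simp
    then have "x k = g k" by (rule x)
    moreover have "w k = g k" using that j(4) V_Cut_eq[OF w gV] by (cases k) auto
    ultimately show ?thesis by simp
  qed
  have xj: "x (Old j) = g (Old j)" using x j(1) by simp
  have jF: "Old j \<in> Field C" using j(1) rel_Field by simp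
  show ?thesis
  proof (cases "w \<in> D")
    case True
    then show ?thesis unfolding lex_less_def using jF xj j(3) eq by (auto intro!: bexI[of _ "Old j"])
  next
    case False
    then have "x (Old j) < w (Old j)" using xj j(2,3) by simp
    then show ?thesis unfolding lex_less_def using False jF eq by (auto intro!: bexI[of _ "Old j"])
  qed
qed

definition truncate :: "'i cut_idx \<Rightarrow> real \<Rightarrow> ('i cut_idx \<Rightarrow> real) \<Rightarrow> 'i cut_idx \<Rightarrow> real" where
  "truncate k0 c g k = (if k = k0 then c else if (k, k0) \<in> C then g k else 0)"

lemma truncate_carrier:
  assumes "g \<in> carrier (hahn_real C)" "k0 \<in> Field C"
  shows "truncate k0 c g \<in> carrier (hahn_real C)"
proof -
  have g: "wo_set C {k. g k \<noteq> 0}" "{k. g k \<noteq> 0} \<subseteq> Field C" using assms by (auto simp: R.carrier_hahn)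
  have k0: "wo_set C {k0}" "{k0} \<subseteq> Field C"
    using C.rel_refl[OF assms(2)] assms(2) by (simp_all add: wo_set_def subset_singleton_iff)
  have "wo_set C ({k. g k \<noteq> 0} \<union> {k0})" by (rule C.wo_set_Un[OF g(1) k0(1) g(2) k0(2)])
  then have "wo_set C {k. truncate k0 c g k \<noteq> 0}"
    by (rule wo_set_subset) (auto simp: truncate_def)
  moreover have "truncate k0 c g k = 0" if "k \<notin> Field C" for k
    using that assms C.rel_Field[of k k0] by (auto simp: truncate_def)
  ultimately show ?thesis by (simp add: R.carrier_hahn)
qed

lemma truncate_less:
  assumes "k0 \<in> Field C" and "\<And>k. (k, k0) \<in> C \<Longrightarrow> k \<noteq> k0 \<Longrightarrow> w k = g k"
  shows "w k0 < c \<Longrightarrow> lex_less C w (truncate k0 c g)" "c < w k0 \<Longrightarrow> lex_less C (truncate k0 c g) w"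
  unfolding lex_less_def using assms by (auto simp: truncate_def intro!: bexI[of _ k0])

definition reach :: "'i set" where "reach = {i. \<exists>g. near i g}"

lemma reach_ofilter: "ofilter r reach"
  unfolding ofilter_def
proof (intro conjI ballI subsetI)
  show "i \<in> Field r" if "i \<in> reach" for i using that by (auto simp: reach_def near_def)
  show "j \<in> reach" if "i \<in> reach" "j \<in> under r i" for i j
    using that near_le unfolding reach_def under_def by blast
qed

text \<open>
  The pseudo-limit of the approximations, extended by zero. By \<open>near_agree\<close>, the choice of the
  approximation does not matter.
\<close>

definition glued :: "'i cut_idx \<Rightarrow> real" where
  "glued k = (case k of Old i \<Rightarrow> if i \<in> reach then (SOME g. near i g) (Old i) else 0 | Cut T \<Rightarrow> 0)"

lemma glued_agree:
  assumes "near i g" "(k, Old i) \<in> C"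
  shows "glued k = g k"
proof (cases k)
  case (Old j)
  then have j: "near j g" using assms near_le by simp
  then have "near j (SOME g. near j g)" by (rule someI[of "near j"])
  moreover have "(j, j) \<in> r" using j by (auto simp: near_def intro: rel_refl)
  ultimately show ?thesis using near_agree[OF _ j] j Old by (auto simp: glued_def reach_def)
next
  case (Cut T)
  then show ?thesis using assms V_Cut by (auto simp: glued_def near_def)
qed

lemma glued_carrier: "glued \<in> carrier (hahn_real C)"
proof -
  have "reach \<subseteq> Field r" using reach_ofilter by (simp add: ofilter_def)
  then have "k \<in> Field C" if "glued k \<noteq> 0" for k
    using that by (cases k) (auto simp: glued_def split: if_splits)
  then have sub: "{k. glued k \<noteq> 0} \<subseteq> Field C" by blast
  have "wo_set C {k. glued k \<noteq> 0}"
  proof (rule C.wo_set_local)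
    fix b assume "b \<in> {k. glued k \<noteq> 0}"
    then obtain i g where b: "b = Old i" "near i g"
      by (auto simp: glued_def reach_def split: cut_idx.splits if_splits)
    then have "g \<in> carrier (hahn_real C)" using V_carrier by (auto simp: near_def)
    then have "wo_set C {k. g k \<noteq> 0}" by (simp add: R.carrier_hahn)
    then show "wo_set C {a \<in> {k. glued k \<noteq> 0}. (a, b) \<in> C}"
      by (rule wo_set_subset) (use b glued_agree in auto)
  qed (rule sub)
  then show ?thesis using sub by (auto simp: R.carrier_hahn)
qed

text \<open>
  The last alternative in the conclusion records that a new index is used only for a point that
  differs from an element of the space at this new index first.
\<close>

theorem cut_realized:
  obtains x where "x \<in> carrier (hahn_real C)"
    "\<And>w. w \<in> D \<Longrightarrow> lex_less C w x" "\<And>w. w \<in> V \<Longrightarrow> w \<notin> D \<Longrightarrow> lex_less C x w"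
    "(\<forall>S. x (Cut S) = 0) \<or>
     (\<exists>S. \<exists>g\<in>V. ofilter r S \<and> x (Cut S) \<noteq> 0 \<and> (\<forall>T. T \<noteq> S \<longrightarrow> x (Cut T) = 0) \<and>
        (\<forall>k. (k, Cut S) \<in> C \<and> k \<noteq> Cut S \<longrightarrow> x k = g k))"
proof (cases "\<exists>g0\<in>V. \<forall>i\<in>reach. near i g0")
  case False
  have sep: "(w \<in> D \<longrightarrow> lex_less C w glued) \<and> (w \<notin> D \<longrightarrow> lex_less C glued w)" if w: "w \<in> V" for w
  proof -
    obtain i where i: "i \<in> reach" "\<not> near i w" using False w by blast
    then obtain g where g: "near i g" by (auto simp: reach_def)
    show ?thesis using glued_agree[OF g] by (rule separated_if_agree[OF g w i(2)])
  qed
  show ?thesis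
    by (rule that[OF glued_carrier]) (use sep D_subset in \<open>auto simp: glued_def\<close>)
next
  case True
  then obtain g0 where g0: "g0 \<in> V" "\<And>i. i \<in> reach \<Longrightarrow> near i g0" by blast
  define B where "B = {w \<in> V. \<forall>i\<in>reach. near i w}"
  have B_agree: "w (Old i) = g0 (Old i)" if "w \<in> B" "i \<in> reach" for w i
    using that g0 near_agree[of i w g0 i] rel_refl[of i] by (auto simp: B_def near_def)
  have B_I: "w \<in> B" if "w \<in> V" "\<And>i. i \<in> reach \<Longrightarrow> w (Old i) = g0 (Old i)" for w
    unfolding B_def
  proof (intro CollectI conjI ballI)
    fix i assume i: "i \<in> reach"
    show "near i w"
    proof (rule agree_near[OF g0(2)[OF i] that(1)])
      fix j assume "(j, i) \<in> r"
      then have "j \<in> reach" using i reach_ofilter by (auto simp: ofilter_def under_def)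
      then show "w (Old j) = g0 (Old j)" by (rule that(2))
    qed
  qed fact
  have sep_outside: "(w \<in> D \<longrightarrow> lex_less C w (truncate k0 c g0)) \<and> (w \<notin> D \<longrightarrow> lex_less C (truncate k0 c g0) w)"
    if w: "w \<in> V" "w \<notin> B" and k0: "\<And>i. i \<in> reach \<Longrightarrow> (Old i, k0) \<in> C \<and> Old i \<noteq> k0" for w k0 c
  proof -
    obtain i where i: "i \<in> reach" "\<not> near i w" using w by (auto simp: B_def)
    have "truncate k0 c g0 k = g0 k" if "(k, Old i) \<in> C" for k
      using that k0[OF i(1)] C.rel_trans[of k "Old i" k0] C.rel_antisym[of k "Old i"]
      by (auto simp: truncate_def)
    then show ?thesis by (rule separated_if_agree[OF g0(2)[OF i(1)] w(1) i(2)])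
  qed
  show ?thesis
  proof (cases "\<exists>w\<in>B. \<exists>w'\<in>B. w \<in> D \<and> w' \<notin> D")
    case True
    then obtain w0 w1 where w0: "w0 \<in> B" "w0 \<in> D" and w1: "w1 \<in> B" "w1 \<notin> D" by blast
    have V01: "w0 \<in> V" "w1 \<in> V" using w0 w1 by (auto simp: B_def)
    have "lex_less C w0 w1" using V_total[OF V01] w0 w1 D_down[of w0 w1] V01 by auto
    then obtain i1 where i1: "w0 (Old i1) < w1 (Old i1)"
        "\<And>j. (j, i1) \<in> r \<Longrightarrow> j \<noteq> i1 \<Longrightarrow> w0 (Old j) = w1 (Old j)"
      using V01 by (auto simp: lex_less_V_iff)
    have i1r: "i1 \<notin> reach" using i1(1) B_agree[OF w0(1), of i1] B_agree[OF w1(1), of i1] by auto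
    have i1F: "i1 \<in> Field r" using i1(1) V_differ_Field[OF V01, of i1] by simp
    have min: "j \<in> reach" if "(j, i1) \<in> r" "j \<noteq> i1" for j
    proof -
      have jF: "j \<in> Field r" using that rel_Field by blast
      have "near j w0"
        unfolding near_def
      proof (intro conjI allI impI jF V01(1))
        fix h assume h: "pos_lead j h"
        then have hV: "h \<in> V" by (simp add: pos_lead_def)
        have hl: "h (Old j) > 0" "\<And>l. (l, j) \<in> r \<Longrightarrow> l \<noteq> j \<Longrightarrow> h (Old l) = 0"
          using h by (auto simp: pos_lead_def)
        have "lex_less C (\<lambda>k. w0 k - h k) w0"
          using hl by (subst lex_less_V_iff) (auto simp: V01 V_diff hV intro!: exI[of _ j])
        then show "(\<lambda>k. w0 k - h k) \<in> D" using D_down w0 V_diff V01 hV by blast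
        have eq: "w0 (Old l) = w1 (Old l)" if "(l, j) \<in> r" for l
          using i1(2)[of l] that \<open>(j, i1) \<in> r\<close> \<open>j \<noteq> i1\<close> rel_trans[of l j i1] rel_antisym[of l j] by blast
        have "lex_less C w1 (\<lambda>k. w0 k + h k)"
          using hl eq rel_refl[OF jF] by (subst lex_less_V_iff) (auto simp: V01 V_add hV intro!: exI[of _ j])
        then show "(\<lambda>k. w0 k + h k) \<notin> D" using not_D_up w1 V_add V01 hV by blast
      qed
      then show ?thesis by (auto simp: reach_def)
    qed
    have reach_below: "(i, i1) \<in> r \<and> i \<noteq> i1" if "i \<in> reach" for i
    proof -
      have "i \<in> Field r" using that by (auto simp: reach_def near_def)
      moreover have "(i1, i) \<notin> r" using that i1r reach_ofilter by (auto simp: ofilter_def under_def)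
      ultimately show ?thesis using rel_total[of i i1] i1F i1r that by blast
    qed
    have below: "w k = g0 k" if w: "w \<in> B" and k: "(k, Old i1) \<in> C" "k \<noteq> Old i1" for w k
    proof (cases k)
      case (Old j)
      then show ?thesis using k min B_agree[OF w] by simp
    next
      case (Cut T)
      have "w \<in> V" using w by (simp add: B_def)
      then show ?thesis using V_Cut_eq[OF _ g0(1)] Cut by simp
    qed
    have B_less: "lex_less C w w'" if "w \<in> B" "w' \<in> B" "w (Old i1) < w' (Old i1)" for w w'
      unfolding lex_less_def
    proof (intro bexI[of _ "Old i1"] conjI allI impI)
      fix k assume "(k, Old i1) \<in> C \<and> k \<noteq> Old i1"
      then show "w k = w' k" using below[OF that(1), of k] below[OF that(2), of k] by simp
    qed (use that i1F in auto)
    (* At the index i1 the cut induces a cut in the real line. Its supremum c is not attained from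
       either side, since an element with coordinate c at i1 would be near the cut at scale i1. *)
    let ?X = "{w (Old i1) | w. w \<in> B \<and> w \<in> D}"
    define c where "c = Sup ?X"
    have bound: "w (Old i1) \<le> w' (Old i1)" if "w \<in> B" "w \<in> D" "w' \<in> B" "w' \<notin> D" for w w'
    proof (rule ccontr)
      assume "\<not> ?thesis"
      then have "lex_less C w' w" using that by (intro B_less) auto
      then show False using D_down that by (auto simp: B_def)
    qed
    have bdd: "bdd_above ?X" using bound w1 by (auto intro!: bdd_aboveI)
    have le_c: "w (Old i1) \<le> c" if "w \<in> B" "w \<in> D" for w
      unfolding c_def using that bdd by (intro cSup_upper) auto
    have c_le: "c \<le> w' (Old i1)" if "w' \<in> B" "w' \<notin> D" for w'
      unfolding c_def by (rule cSup_least) (use w0 bound that in auto)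
    have shift: "(\<lambda>k. w k + h k) \<in> B" "(\<lambda>k. w k - h k) \<in> B" if "w \<in> B" "pos_lead i1 h" for w h
    proof -
      have V: "w \<in> V" "h \<in> V" using that by (auto simp: B_def pos_lead_def)
      have "h (Old i) = 0" if "i \<in> reach" for i
        using reach_below[OF that] \<open>pos_lead i1 h\<close> by (auto simp: pos_lead_def)
      then show "(\<lambda>k. w k + h k) \<in> B" "(\<lambda>k. w k - h k) \<in> B"
        using B_agree[OF that(1)] V by (auto intro!: B_I V_add V_diff)
    qed
    have hl: "h (Old i1) > 0" "h \<in> V" if "pos_lead i1 h" for h using that by (auto simp: pos_lead_def)
    have next_to: "\<exists>u\<in>B. (u \<in> D \<longleftrightarrow> w \<in> D) \<and> (if w \<in> D then w (Old i1) < u (Old i1) else u (Old i1) < w (Old i1))"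
      if w: "w \<in> B" for w
    proof -
      have wV: "w \<in> V" using w by (simp add: B_def)
      obtain h where h: "pos_lead i1 h" "(\<lambda>k. w k - h k) \<notin> D \<or> (\<lambda>k. w k + h k) \<in> D"
        using i1r wV i1F by (auto simp: reach_def near_def)
      note u = shift[OF w h(1)]
      have less: "lex_less C (\<lambda>k. w k - h k) w" "lex_less C w (\<lambda>k. w k + h k)"
        using u w hl[OF h(1)] by (auto intro!: B_less)
      show ?thesis
      proof (cases "w \<in> D")
        case True
        then have "(\<lambda>k. w k + h k) \<in> D" using D_down less(1) h(2) u(2) by (auto simp: B_def)
        then show ?thesis using True u(1) hl[OF h(1)] by (intro bexI[of _ "\<lambda>k. w k + h k"]) auto
      next
        case False
        then have "(\<lambda>k. w k - h k) \<notin> D" using D_down less(2) h(2) wV by blast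
        then show ?thesis using False u(2) hl[OF h(1)] by (intro bexI[of _ "\<lambda>k. w k - h k"]) auto
      qed
    qed
    have strict1: "w (Old i1) < c" if "w \<in> B" "w \<in> D" for w
      using next_to[OF that(1)] that le_c by fastforce
    have strict2: "c < w (Old i1)" if "w \<in> B" "w \<notin> D" for w
      using next_to[OF that(1)] that c_le by fastforce
    let ?x = "truncate (Old i1) c g0"
    have F: "Old i1 \<in> Field C" using i1F by simp
    have sep: "(w \<in> D \<longrightarrow> lex_less C w ?x) \<and> (w \<notin> D \<longrightarrow> lex_less C ?x w)" if w: "w \<in> V" for w
    proof (cases "w \<in> B")
      case True
      note less = truncate_less[OF F, of w g0 c, OF below[OF True]]
      show ?thesis using less strict1[OF True] strict2[OF True] by blast
    next
      case False
      then show ?thesis by (rule sep_outside[OF w]) (use reach_below in auto)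
    qed
    show ?thesis
    proof (rule that)
      show "?x \<in> carrier (hahn_real C)" using g0 F V_carrier by (intro truncate_carrier) auto
    qed (use sep D_subset g0 V_Cut in \<open>auto simp: truncate_def\<close>)
  next
    case False
    (* The elements of B are on one side of the cut. The sign at the new index puts the point on the
       other side of all of them; B has coordinate zero there. *)
    define c :: real where "c = (if g0 \<in> D then 1 else - 1)"
    have g0B: "g0 \<in> B" using g0 by (simp add: B_def)
    let ?x = "truncate (Cut reach) c g0"
    have F: "Cut reach \<in> Field C" using reach_ofilter by simp
    have sep: "(w \<in> D \<longrightarrow> lex_less C w ?x) \<and> (w \<notin> D \<longrightarrow> lex_less C ?x w)" if w: "w \<in> V" for w
    proof (cases "w \<in> B")
      case True
      have "w k = g0 k" if "(k, Cut reach) \<in> C" for k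
        using that B_agree[OF True] V_Cut_eq[OF w g0(1)] by (cases k) auto
      then have "w (Cut reach) < c \<Longrightarrow> lex_less C w ?x" "c < w (Cut reach) \<Longrightarrow> lex_less C ?x w"
        using truncate_less[OF F] by blast+
      moreover have "w \<in> D \<longleftrightarrow> g0 \<in> D" using False True g0B by blast
      ultimately show ?thesis using V_Cut[OF w, of reach] by (auto simp: c_def)
    next
      case False
      then show ?thesis by (rule sep_outside[OF w]) (use reach_ofilter in auto)
    qed
    show ?thesis
    proof (rule that)
      show "?x \<in> carrier (hahn_real C)" using g0 F V_carrier by (intro truncate_carrier) auto
      show "(\<forall>S. ?x (Cut S) = 0) \<or>
        (\<exists>S. \<exists>g\<in>V. ofilter r S \<and> ?x (Cut S) \<noteq> 0 \<and> (\<forall>T. T \<noteq> S \<longrightarrow> ?x (Cut T) = 0) \<and>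
        (\<forall>k. (k, Cut S) \<in> C \<and> k \<noteq> Cut S \<longrightarrow> ?x k = g k))"
        using reach_ofilter g0(1) V_Cut[OF g0(1)]
        by (intro disjI2 exI[of _ reach] bexI[of _ g0]) (auto simp: truncate_def c_def)
    qed (use sep D_subset in auto)
  qed
qed

end

section \<open>The rational rank of an extension to polynomials\<close>

context valuation
begin

lemma val_cases:
  obtains "\<mu> f = Infty" | a where "\<mu> f = Fin a" "a \<in> carrier G"
  using val_closed by (cases "\<mu> f") auto

lemma val_uminus: "\<mu> (- f) = \<mu> f"
proof -
  have "inf_add G (\<mu> (- 1)) (\<mu> (- 1)) = Fin \<one>\<^bsub>G\<^esub>"
    using val_mult[of "- 1" "- 1"] val_one by simp
  then obtain a where a: "\<mu> (- 1) = Fin a" "a \<otimes>\<^bsub>G\<^esub> a = \<one>\<^bsub>G\<^esub>" "a \<in> carrier G"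
    by (cases rule: val_cases[of "- 1"]) auto
  then have "a = \<one>\<^bsub>G\<^esub>" using pow_eq_one_imp_one[of a 2] by (simp add: numeral_2_eq_2)
  then have "\<mu> (- 1) = Fin \<one>\<^bsub>G\<^esub>" using a by simp
  moreover have "\<mu> (- f) = inf_add G (\<mu> (- 1)) (\<mu> f)" using val_mult[of "- 1" f] by simp
  ultimately show ?thesis by (cases rule: val_cases[of f]) auto
qed

lemma val_le_total: "inf_le G (\<mu> f) (\<mu> g) \<or> inf_le G (\<mu> g) (\<mu> f)"
  using gle_total by (cases rule: val_cases[of f]; cases rule: val_cases[of g]) auto

lemma val_le_antisym: "inf_le G (\<mu> f) (\<mu> g) \<Longrightarrow> inf_le G (\<mu> g) (\<mu> f) \<Longrightarrow> \<mu> f = \<mu> g"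
  using gle_antisym by (cases rule: val_cases[of f]; cases rule: val_cases[of g]) auto

text \<open>
  As usual, from \<open>f = (f + g) - g\<close>.
\<close>

lemma val_add_less:
  assumes "inf_le G (\<mu> f) (\<mu> g)" "\<mu> f \<noteq> \<mu> g"
  shows "\<mu> (f + g) = \<mu> f"
proof -
  have 1: "inf_le G (\<mu> f) (\<mu> (f + g))"
    using val_add[of f g] assms by (simp add: inf_min_def)
  have 2: "inf_le G (inf_min G (\<mu> (f + g)) (\<mu> g)) (\<mu> f)"
    using val_add[of "f + g" "- g"] by (simp add: val_uminus)
  have "\<not> inf_le G (\<mu> g) (\<mu> f)" using assms val_le_antisym by blast
  then have "inf_le G (\<mu> (f + g)) (\<mu> f)" using 2 by (auto simp: inf_min_def split: if_splits)
  then show ?thesis using 1 val_le_antisym by blast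
qed

lemma val_add_distinct:
  assumes "\<mu> f \<noteq> \<mu> g"
  shows "\<mu> (f + g) = \<mu> f \<or> \<mu> (f + g) = \<mu> g"
  using val_le_total[of f g] val_add_less[of f g] val_add_less[of g f] assms by (auto simp: add.commute)

lemma val_sum_distinct:
  assumes "finite S" "S \<noteq> {}" "inj_on (\<lambda>s. \<mu> (F s)) S"
  shows "\<exists>s\<in>S. \<mu> (sum F S) = \<mu> (F s)"
  using assms
proof (induction rule: finite_ne_induct)
  case (insert s S)
  then obtain t where t: "t \<in> S" "\<mu> (sum F S) = \<mu> (F t)" by auto
  then have "\<mu> (F s) \<noteq> \<mu> (sum F S)" using insert by (auto simp: inj_on_def)
  then show ?case using val_add_distinct[of "F s" "sum F S"] t insert by auto
qed auto

lemma val_power: "\<mu> f = Fin a \<Longrightarrow> a \<in> carrier G \<Longrightarrow> \<mu> (f ^ n) = Fin (a [^]\<^bsub>G\<^esub> n)"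
  by (induction n) (auto simp: val_one val_mult m_comm)

end

text \<open>
  The polynomials of degree at most \<open>d\<close> form a space of dimension \<open>d + 1\<close>. Dropping the zero
  coefficients from a dependence is convenient because the values of the remaining terms are finite.
\<close>

lemma poly_linear_dependence:
  fixes S :: "'k::field poly set"
  assumes "finite S" "\<And>p. p \<in> S \<Longrightarrow> degree p \<le> d" "card S > Suc d"
  obtains T u where "finite T" "T \<noteq> {}" "T \<subseteq> S" "\<And>p. p \<in> T \<Longrightarrow> u p \<noteq> 0" "(\<Sum>p\<in>T. smult (u p) p) = 0"
proof -
  interpret P: vector_space "smult :: 'k \<Rightarrow> 'k poly \<Rightarrow> 'k poly"
    by unfold_locales (simp_all add: smult_add_right smult_add_left)
  let ?M = "(\<lambda>i. monom (1::'k) i) ` {..d}"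
  have "p \<in> P.span ?M" if "p \<in> S" for p
  proof -
    have "p = (\<Sum>i\<le>d. smult (coeff p i) (monom 1 i))"
      using poly_as_sum_of_monoms'[OF assms(2)[OF that]] by (simp add: smult_monom)
    also have "\<dots> \<in> P.span ?M"
      by (intro P.span_sum P.span_scale P.span_base) auto
    finally show ?thesis .
  qed
  moreover have "card ?M \<le> Suc d" using card_image_le[of "{..d}" "\<lambda>i. monom (1::'k) i"] by simp
  ultimately have "P.dependent S"
    using P.independent_span_bound[of ?M S] assms(3) by (meson finite_atMost finite_imageI le_trans not_le subsetI)
  then obtain T u where T: "T \<subseteq> S" "finite T" "(\<Sum>p\<in>T. smult (u p) p) = 0" "\<exists>p\<in>T. u p \<noteq> 0"
    using P.independent_explicit_finite_subsets[of S] by blast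
  let ?T = "{p \<in> T. u p \<noteq> 0}"
  have "(\<Sum>p\<in>?T. smult (u p) p) = (\<Sum>p\<in>T. smult (u p) p)"
    using T(2) by (intro sum.mono_neutral_left) auto
  then have "(\<Sum>p\<in>?T. smult (u p) p) = 0" using T(3) by simp
  then show ?thesis by (rule that[of ?T u, rotated 4]) (use T in auto)
qed

text \<open>
  With \<open>d = deg f + deg g\<close>, the \<open>(d + 2)\<^sup>2\<close> products \<open>f\<^sup>i g\<^sup>j\<close> with \<open>i, j \<le> d + 1\<close> have degree at
  most \<open>d (d + 1)\<close>, so they are linearly dependent or not even distinct. In a vanishing linear
  combination two terms must have the same value: otherwise the value of the sum would be the
  least of the values of its terms, hence finite. The equality of these two values is a relation
  between \<open>a\<close> and \<open>b\<close> modulo values of constants.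
\<close>

theorem rational_rank_le_one:
  fixes W (structure) and \<mu> :: "'k::field poly \<Rightarrow> 'a with_inf"
  assumes "valuation W \<mu>" "\<mu> f = Fin a" "\<mu> g = Fin b"
  obtains i j i' j' :: nat and c c' x x' where
    "(i, j) \<noteq> (i', j')" "\<mu> [:c:] = Fin x" "\<mu> [:c':] = Fin x'"
    "x \<otimes> (a [^] i \<otimes> b [^] j) = x' \<otimes> (a [^] i' \<otimes> b [^] j')"
proof -
  interpret valuation W \<mu> by fact
  have car: "a \<in> carrier W" "b \<in> carrier W" using assms val_closed by auto
  have val_const: "\<exists>x. \<mu> [:c:] = Fin x" if "c \<noteq> 0" for c
  proof -
    have "inf_add W (\<mu> [:c:]) (\<mu> [:inverse c:]) = Fin \<one>"
      using that val_mult[of "[:c:]" "[:inverse c:]"] val_one by (simp add: one_pCons)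
    then show ?thesis by (cases "\<mu> [:c:]") auto
  qed
  define d where "d = degree f + degree g"
  let ?P = "{..Suc d} \<times> {..Suc d}"
  let ?F = "\<lambda>(i, j). f ^ i * g ^ j"
  have F: "\<mu> (?F p) = Fin (a [^] fst p \<otimes> b [^] snd p)" for p
    using val_power[OF assms(2) car(1)] val_power[OF assms(3) car(2)] by (auto simp: val_mult split: prod.split)
  have Fc: "\<mu> (smult c (?F p)) = inf_add W (\<mu> [:c:]) (\<mu> (?F p))" for c p
    using val_mult[of "[:c:]" "?F p"] by simp
  have "\<exists>p q c c'. p \<noteq> q \<and> c \<noteq> 0 \<and> c' \<noteq> 0 \<and> \<mu> (smult c (?F p)) = \<mu> (smult c' (?F q))"
  proof (cases "inj_on ?F ?P")
    case False
    then obtain p q where "p \<noteq> q" "?F p = ?F q" unfolding inj_on_def by blast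
    then show ?thesis by (intro exI[of _ p] exI[of _ q] exI[of _ 1]) simp
  next
    case True
    have "card (?F ` ?P) = Suc (Suc d) * Suc (Suc d)"
      using card_image[OF True] by simp
    then have "card (?F ` ?P) > Suc (d * Suc d)" by simp
    moreover have "degree p \<le> d * Suc d" if pF: "p \<in> ?F ` ?P" for p
    proof -
      obtain i j where p: "i \<le> Suc d" "j \<le> Suc d" "p = f ^ i * g ^ j" using pF by auto
      have "degree p \<le> degree (f ^ i) + degree (g ^ j)" unfolding p by (rule degree_mult_le)
      also have "\<dots> \<le> degree f * i + degree g * j" by (intro add_mono degree_power_le)
      also have "\<dots> \<le> degree f * Suc d + degree g * Suc d" using p by (intro add_mono mult_le_mono) auto
      finally show ?thesis by (simp add: d_def algebra_simps)
    qed
    moreover have "finite (?F ` ?P)" by simp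
    ultimately obtain T u where T: "finite T" "T \<noteq> {}" "T \<subseteq> ?F ` ?P" "\<And>p. p \<in> T \<Longrightarrow> u p \<noteq> 0"
      "(\<Sum>p\<in>T. smult (u p) p) = 0"
      using poly_linear_dependence[of "?F ` ?P" "d * Suc d"] by blast
    have "\<not> inj_on (\<lambda>p. \<mu> (smult (u p) p)) T"
    proof
      assume "inj_on (\<lambda>p. \<mu> (smult (u p) p)) T"
      from val_sum_distinct[OF T(1,2) this] obtain p where "p \<in> T" "\<mu> 0 = \<mu> (smult (u p) p)"
        using T(5) by auto
      moreover from this obtain q where "p = ?F q" using T(3) by auto
      ultimately show False using Fc[of "u p" q] F[of q] val_const[OF T(4)[of p]] val_zero by auto
    qed
    then obtain p q where pq: "p \<in> T" "q \<in> T" "p \<noteq> q" "\<mu> (smult (u p) p) = \<mu> (smult (u q) q)"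
      unfolding inj_on_def by blast
    then obtain p' q' where "p = ?F p'" "q = ?F q'" using T(3) by (meson imageE subsetD)
    then show ?thesis using pq T(4) by (intro exI[of _ p'] exI[of _ q'] exI[of _ "u p"] exI[of _ "u q"]) auto
  qed
  then obtain p q c c' where pq: "p \<noteq> q" "c \<noteq> 0" "c' \<noteq> 0" "\<mu> (smult c (?F p)) = \<mu> (smult c' (?F q))"
    by blast
  obtain x x' where x: "\<mu> [:c:] = Fin x" "\<mu> [:c':] = Fin x'" using val_const pq by blast
  have "x \<otimes> (a [^] fst p \<otimes> b [^] snd p) = x' \<otimes> (a [^] fst q \<otimes> b [^] snd q)"
    using pq(4) unfolding Fc F x by simp
  then show ?thesis using that[of "fst p" "snd p" "fst q" "snd q"] pq(1) x by (simp add: prod_eq_iff)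
qed

section \<open>Extending an embedding by one element\<close>

context ogroup_embedding
begin

text \<open>
  The element \<open>m x + g\<close> of the larger group.
\<close>

definition comb :: "'b \<Rightarrow> int \<Rightarrow> 'a \<Rightarrow> 'b" where
  "comb x m g = x [^] m \<otimes> f g"

lemma comb_closed: "x \<in> carrier L \<Longrightarrow> g \<in> carrier G \<Longrightarrow> comb x m g \<in> carrier L"
  by (simp add: comb_def)

lemma comb_mult:
  assumes "x \<in> carrier L" "g \<in> carrier G" "g' \<in> carrier G"
  shows "comb x m g \<otimes> comb x m' g' = comb x (m + m') (g \<otimes>\<^bsub>G\<^esub> g')"
  using assms by (simp add: comb_def L.int_pow_mult L.m_ac)

lemma comb_inv:
  assumes "x \<in> carrier L" "g \<in> carrier G"
  shows "inv (comb x m g) = comb x (- m) (inv\<^bsub>G\<^esub> g)"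
  using assms by (simp add: comb_def L.int_pow_neg L.inv_mult)

lemma comb_pow:
  assumes "x \<in> carrier L" "g \<in> carrier G"
  shows "comb x m g [^] (k::nat) = comb x (m * int k) (g [^]\<^bsub>G\<^esub> k)"
proof (induction k)
  case 0
  then show ?case by (simp add: comb_def)
next
  case (Suc k)
  then show ?case using assms comb_mult[of x "g [^]\<^bsub>G\<^esub> k" g "m * int k" m] by (simp add: algebra_simps)
qed

lemma comb_zero: "x \<in> carrier L \<Longrightarrow> g \<in> carrier G \<Longrightarrow> comb x 0 g = f g"
  by (simp add: comb_def)

lemma pow_mult_comb:
  assumes "x \<in> carrier L" "y \<in> carrier L" "z \<in> carrier L" "g \<in> carrier G" "g' \<in> carrier G"
    and y: "y [^] (n::nat) = comb x m g" and z: "z [^] (n'::nat) = comb x m' g'"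
  shows "(y \<otimes> z) [^] (n * n') = comb x (m * int n' + m' * int n) (g [^]\<^bsub>G\<^esub> n' \<otimes>\<^bsub>G\<^esub> g' [^]\<^bsub>G\<^esub> n)"
proof -
  have "(y \<otimes> z) [^] (n * n') = (y [^] n) [^] n' \<otimes> (z [^] n') [^] n"
    using assms(2,3) by (simp add: L.pow_mult_distrib L.m_comm L.nat_pow_pow mult.commute)
  then show ?thesis unfolding y z using assms(1,4,5) by (simp add: comb_pow comb_mult)
qed

text \<open>
  The elements that have a positive multiple among the combinations of \<open>x\<close> and the image of \<open>G\<close>,
  that is, the trace in \<open>L\<close> of the divisible hull of the group generated by these.
\<close>

definition isolated :: "'b \<Rightarrow> 'b set" where
  "isolated x = {y \<in> carrier L. \<exists>n>0. \<exists>m. \<exists>g\<in>carrier G. y [^] (n::nat) = comb x m g}"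

lemma isolated_subgroup:
  assumes x: "x \<in> carrier L"
  shows "subgroup (isolated x) L"
proof
  show "isolated x \<subseteq> carrier L" by (auto simp: isolated_def)
  show "\<one> \<in> isolated x"
    unfolding isolated_def using comb_zero[OF x G.one_closed]
    by (auto intro!: exI[of _ "1::nat"] exI[of _ "0::int"] bexI[of _ "\<one>\<^bsub>G\<^esub>"])
  fix y assume "y \<in> isolated x"
  then obtain n m g where y: "y \<in> carrier L" "n > 0" "g \<in> carrier G" "y [^] (n::nat) = comb x m g"
    by (auto simp: isolated_def)
  then have "(inv y) [^] n = comb x (- m) (inv\<^bsub>G\<^esub> g)"
    by (simp add: L.nat_pow_inv comb_inv x)
  then show "inv y \<in> isolated x"
    unfolding isolated_def using y by (auto intro!: exI[of _ n] exI[of _ "- m"] bexI[of _ "inv\<^bsub>G\<^esub> g"])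
  fix z assume "z \<in> isolated x"
  then obtain n' m' g' where z: "z \<in> carrier L" "n' > 0" "g' \<in> carrier G" "z [^] (n'::nat) = comb x m' g'"
    by (auto simp: isolated_def)
  have "(y \<otimes> z) [^] (n * n') = comb x (m * int n' + m' * int n) (g [^]\<^bsub>G\<^esub> n' \<otimes>\<^bsub>G\<^esub> g' [^]\<^bsub>G\<^esub> n)"
    by (rule pow_mult_comb[OF x y(1) z(1) y(3) z(3) y(4) z(4)])
  then show "y \<otimes> z \<in> isolated x"
    unfolding isolated_def using y(1-3) z(1-3)
    by (auto intro!: exI[of _ "n * n'"] exI[of _ "m * int n' + m' * int n"]
        bexI[of _ "g [^]\<^bsub>G\<^esub> n' \<otimes>\<^bsub>G\<^esub> g' [^]\<^bsub>G\<^esub> n"])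
qed

lemma combs_gle_iff:
  assumes x: "x \<in> carrier L" and y: "y \<in> carrier L" "g \<in> carrier G" "n > 0" "y [^] (n::nat) = comb x m g"
    and z: "z \<in> carrier L" "g' \<in> carrier G" "n' > 0" "z [^] (n'::nat) = comb x m' g'"
  shows "y \<preceq> z \<longleftrightarrow> \<one> \<preceq>
    comb x (m' * int n - m * int n') (inv\<^bsub>G\<^esub> (g [^]\<^bsub>G\<^esub> n') \<otimes>\<^bsub>G\<^esub> g' [^]\<^bsub>G\<^esub> n)"
proof -
  have 1: "y [^] (n * n') = comb x (m * int n') (g [^]\<^bsub>G\<^esub> n')"
    using y x comb_pow[of x g m n'] by (simp add: L.nat_pow_pow[symmetric])
  have "z [^] (n' * n) = comb x (m' * int n) (g' [^]\<^bsub>G\<^esub> n)"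
    using z x comb_pow[of x g' m' n] by (simp add: L.nat_pow_pow[symmetric])
  then have 2: "z [^] (n * n') = comb x (m' * int n) (g' [^]\<^bsub>G\<^esub> n)" by (simp add: mult.commute)
  have "y \<preceq> z \<longleftrightarrow> y [^] (n * n') \<preceq> z [^] (n * n')"
    using y z by (intro L.pow_gle_iff[symmetric]) auto
  also have "\<dots> \<longleftrightarrow> \<one> \<preceq> inv (comb x (m * int n') (g [^]\<^bsub>G\<^esub> n')) \<otimes> comb x (m' * int n) (g' [^]\<^bsub>G\<^esub> n)"
    unfolding 1 2 using x y z by (intro L.gle_iff_quotient comb_closed) auto
  finally show ?thesis using x y z by (simp add: comb_inv comb_mult)
qed

end

text \<open>
  All comparisons between elements of \<open>\<Lambda>\<close> reduce, after multiplication by positive integers, to the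
  signs of combinations \<open>m \<gamma> + g\<close>. Hence the relation \<open>n z = m x + g\<close>, where \<open>n y = m \<gamma> + g\<close>, preserves
  and reflects the order between the \<open>y\<close> and the \<open>z\<close>, and in particular is a function of \<open>y\<close>.
\<close>

theorem extend_embedding:
  fixes W (structure)
  assumes w: "ogroup_embedding G W i" and l: "ogroup_embedding G R l"
    and \<gamma>: "\<gamma> \<in> carrier W" and x: "x \<in> carrier R"
    and compat: "\<And>m g. g \<in> carrier G \<Longrightarrow>
      \<one> \<preceq> ogroup_embedding.comb W i \<gamma> m g \<longleftrightarrow> \<one>\<^bsub>R\<^esub> \<preceq>\<^bsub>R\<^esub> ogroup_embedding.comb R l x m g"
    and \<Lambda>: "subgroup \<Lambda> W" "\<Lambda> \<subseteq> ogroup_embedding.isolated G W i \<gamma>"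
    and divisible: "\<And>y n. y \<in> carrier R \<Longrightarrow> n > 0 \<Longrightarrow> \<exists>z\<in>carrier R. z [^]\<^bsub>R\<^esub> (n::nat) = y"
  obtains \<Phi> where "\<Phi> \<in> ogroup_emb (W\<lparr>carrier := \<Lambda>\<rparr>) R"
    "\<And>y n m g. y \<in> \<Lambda> \<Longrightarrow> n > 0 \<Longrightarrow> g \<in> carrier G \<Longrightarrow> y [^] (n::nat) = ogroup_embedding.comb W i \<gamma> m g \<Longrightarrow>
      \<Phi> y [^]\<^bsub>R\<^esub> n = ogroup_embedding.comb R l x m g"
proof -
  interpret w: ogroup_embedding G W i by fact
  interpret l: ogroup_embedding G R l by fact
  define rel where "rel = (\<lambda>n m g y z. y \<in> carrier W \<and> z \<in> carrier R \<and> n > 0 \<and> g \<in> carrier G \<and>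
    y [^] (n::nat) = w.comb \<gamma> m g \<and> z [^]\<^bsub>R\<^esub> n = l.comb x m g)"
  have rel_gle: "y \<preceq> y' \<longleftrightarrow> z \<preceq>\<^bsub>R\<^esub> z'" if "rel n m g y z" "rel n' m' g' y' z'" for n m g y z n' m' g' y' z'
    using that w.combs_gle_iff[OF \<gamma>, of y g n m y' g' n' m'] l.combs_gle_iff[OF x, of z g n m z' g' n' m']
      compat[of "inv\<^bsub>G\<^esub> (g [^]\<^bsub>G\<^esub> n') \<otimes>\<^bsub>G\<^esub> g' [^]\<^bsub>G\<^esub> n" "m' * int n - m * int n'"]
    by (simp add: rel_def)
  have rel_unique: "z = z'" if "rel n m g y z" "rel n' m' g' y z'" for n m g y z n' m' g' z'
  proof -
    have y: "y \<in> carrier W" "z \<in> carrier R" "z' \<in> carrier R" using that by (auto simp: rel_def)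
    then show ?thesis using rel_gle[OF that] rel_gle[OF that(2,1)] w.L.gle_refl l.L.gle_antisym by blast
  qed
  have rel_mult: "rel (n * n') (m * int n' + m' * int n) (g [^]\<^bsub>G\<^esub> n' \<otimes>\<^bsub>G\<^esub> g' [^]\<^bsub>G\<^esub> n) (y \<otimes> y') (z \<otimes>\<^bsub>R\<^esub> z')"
    if "rel n m g y z" "rel n' m' g' y' z'" for n m g y z n' m' g' y' z'
    using that w.pow_mult_comb[OF \<gamma>, of y y' g g' n m n' m'] l.pow_mult_comb[OF x, of z z' g g' n m n' m']
    by (simp add: rel_def)
  have rel_ex: "\<exists>z. rel n m g y z"
    if "y \<in> carrier W" "n > 0" "g \<in> carrier G" "y [^] n = w.comb \<gamma> m g" for y m g and n :: nat
    using divisible[OF l.comb_closed[OF x that(3), of m] that(2)] that by (auto simp: rel_def)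
  define \<Phi> where "\<Phi> = (\<lambda>y. SOME z. \<exists>n m g. rel n m g y z)"
  have \<Lambda>c: "y \<in> carrier W" if "y \<in> \<Lambda>" for y using that \<Lambda>(1) subgroup.subset by blast
  have \<Phi>: "\<exists>n m g. rel n m g y (\<Phi> y)" if "y \<in> \<Lambda>" for y
  proof -
    have "y \<in> w.isolated \<gamma>" using that \<Lambda>(2) by blast
    then have "\<exists>z n m g. rel n m g y z" unfolding w.isolated_def using rel_ex by blast
    then show ?thesis unfolding \<Phi>_def by (rule someI_ex)
  qed
  have "\<Phi> \<in> ogroup_emb (W\<lparr>carrier := \<Lambda>\<rparr>) R"
    unfolding ogroup_emb_def hom_def
  proof (intro CollectI conjI ballI Pi_I)
    fix y assume y: "y \<in> carrier (W\<lparr>carrier := \<Lambda>\<rparr>)"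
    then have "y \<in> \<Lambda>" by simp
    then obtain n m g where r: "rel n m g y (\<Phi> y)" using \<Phi> by blast
    then show "\<Phi> y \<in> carrier R" by (simp add: rel_def)
    fix y' assume y': "y' \<in> carrier (W\<lparr>carrier := \<Lambda>\<rparr>)"
    then have "y' \<in> \<Lambda>" by simp
    then obtain n' m' g' where r': "rel n' m' g' y' (\<Phi> y')" using \<Phi> by blast
    have "y \<otimes> y' \<in> \<Lambda>" using y y' \<Lambda>(1) by (simp add: subgroup.m_closed)
    then obtain n'' m'' g'' where "rel n'' m'' g'' (y \<otimes> y') (\<Phi> (y \<otimes> y'))" using \<Phi> by blast
    from rel_unique[OF this rel_mult[OF r r']]
    show "\<Phi> (y \<otimes>\<^bsub>W\<lparr>carrier := \<Lambda>\<rparr>\<^esub> y') = \<Phi> y \<otimes>\<^bsub>R\<^esub> \<Phi> y'" by simp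
    show "y \<preceq>\<^bsub>W\<lparr>carrier := \<Lambda>\<rparr>\<^esub> y' \<longleftrightarrow> \<Phi> y \<preceq>\<^bsub>R\<^esub> \<Phi> y'" using rel_gle[OF r r'] by simp
  qed
  moreover have "\<Phi> y [^]\<^bsub>R\<^esub> n = l.comb x m g"
    if y: "y \<in> \<Lambda>" "n > 0" "g \<in> carrier G" "y [^] n = w.comb \<gamma> m g" for y m g and n :: nat
  proof -
    obtain z where z: "rel n m g y z" using rel_ex[OF \<Lambda>c[OF y(1)] y(2-4)] by blast
    then have "z = \<Phi> y" using rel_unique \<Phi>[OF y(1)] by blast
    then show ?thesis using z by (simp add: rel_def)
  qed
  ultimately show ?thesis using that by blast
qed

section \<open>Value groups and embeddings\<close>

context ogroup_embedding
begin

lemma comb_nonneg_pos: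
  assumes "y \<in> carrier L" "g \<in> carrier G"
  shows "\<one> \<preceq> comb y (int n) g \<longleftrightarrow> f (inv\<^bsub>G\<^esub> g) \<preceq> y [^] n"
proof -
  have "f (inv\<^bsub>G\<^esub> g) \<preceq> y [^] n \<longleftrightarrow> \<one> \<preceq> f g \<otimes> y [^] n"
    using L.gle_iff_quotient[of "f (inv\<^bsub>G\<^esub> g)" "y [^] n"] assms by simp
  then show ?thesis using assms by (simp add: comb_def int_pow_int L.m_comm)
qed

lemma comb_nonneg_neg:
  assumes "y \<in> carrier L" "g \<in> carrier G"
  shows "\<one> \<preceq> comb y (- int n) g \<longleftrightarrow> y [^] n \<preceq> f g"
  using L.gle_iff_quotient[of "y [^] n" "f g"] assms
  by (simp add: comb_def L.int_pow_neg_int)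

end

context valuation
begin

lemma values_subgroup: "subgroup (generate G (carrier G \<inter> {x. \<exists>f. \<mu> f = Fin x})) G"
  by (rule generate_is_subgroup) auto

lemma value_group_eq: "value_group G \<mu> = G\<lparr>carrier := carrier (value_group G \<mu>)\<rparr>"
  by (simp add: value_group_def subgroup_generated_def)

lemma value_group_subgroup: "subgroup (carrier (value_group G \<mu>)) G"
  using values_subgroup by (simp add: value_group_def carrier_subgroup_generated)

lemma value_group_ordered: "ordered_comm_group (value_group G \<mu>)"
  by (subst value_group_eq) (rule subgroup_ordered_comm_group[OF value_group_subgroup])

lemma value_in_value_group: "\<mu> f = Fin a \<Longrightarrow> a \<in> carrier (value_group G \<mu>)"
  using val_closed by (auto simp: value_group_def carrier_subgroup_generated intro: generate.incl)

lemma value_group_simps [simp]: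
  "x \<otimes>\<^bsub>value_group G \<mu>\<^esub> y = x \<otimes>\<^bsub>G\<^esub> y" "\<one>\<^bsub>value_group G \<mu>\<^esub> = \<one>\<^bsub>G\<^esub>"
  "x \<preceq>\<^bsub>value_group G \<mu>\<^esub> y \<longleftrightarrow> x \<preceq>\<^bsub>G\<^esub> y"
  by (simp_all add: value_group_def subgroup_generated_def)

lemma map_valuation:
  assumes R: "ordered_comm_group R" and \<Phi>: "\<Phi> \<in> ogroup_emb (value_group G \<mu>) R"
  defines "\<nu> \<equiv> \<lambda>f. map_with_inf \<Phi> (\<mu> f)"
  shows "valuation R \<nu>"
    and "carrier (value_group R \<nu>) = \<Phi> ` carrier (value_group G \<mu>)"
    and "val_equiv G \<mu> R \<nu>"
proof -
  interpret R: ordered_comm_group R by fact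
  interpret P: ogroup_embedding "value_group G \<mu>" R \<Phi>
    by (intro ogroup_embedding.intro ogroup_embedding_axioms.intro value_group_ordered R \<Phi>)
  note inV = value_in_value_group
  have cases: thesis if "\<mu> f = Infty \<Longrightarrow> thesis" "\<And>a. \<mu> f = Fin a \<Longrightarrow> a \<in> carrier (value_group G \<mu>) \<Longrightarrow> thesis"
    for f thesis
    using that inV by (cases "\<mu> f") auto
  have le: "inf_le R (\<nu> f) (\<nu> g) \<longleftrightarrow> inf_le G (\<mu> f) (\<mu> g)" for f g
    by (rule cases[of f]; rule cases[of g]) (auto simp: \<nu>_def P.emb_gle)
  show val: "valuation R \<nu>"
  proof (intro valuation.intro valuation_axioms.intro R)
    show "x \<in> carrier R" if "\<nu> f = Fin x" for f x
      using that by (rule_tac cases[of f]) (auto simp: \<nu>_def)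
    show "\<nu> 0 = Infty" by (simp add: \<nu>_def val_zero)
    show "\<nu> 1 = Fin \<one>\<^bsub>R\<^esub>" using P.hom_one by (simp add: \<nu>_def val_one)
    show "\<nu> (f * g) = inf_add R (\<nu> f) (\<nu> g)" for f g
    proof (rule cases[of f]; rule cases[of g])
      fix a b assume "\<mu> f = Fin a" "a \<in> carrier (value_group G \<mu>)" "\<mu> g = Fin b" "b \<in> carrier (value_group G \<mu>)"
      then show ?thesis using P.hom_mult[of a b] by (simp add: \<nu>_def val_mult)
    qed (auto simp: \<nu>_def val_mult)
    show "inf_le R (inf_min R (\<nu> f) (\<nu> g)) (\<nu> (f + g))" for f g
      using val_add[of f g] by (simp add: inf_min_def le split: if_splits)
  qed
  have A: "{x. \<exists>f. \<mu> f = Fin x} \<subseteq> carrier (value_group G \<mu>)" using inV by blast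
  have "{x. \<exists>f. \<nu> f = Fin x} = \<Phi> ` {x. \<exists>f. \<mu> f = Fin x}"
  proof
    show "{x. \<exists>f. \<nu> f = Fin x} \<subseteq> \<Phi> ` {x. \<exists>f. \<mu> f = Fin x}"
    proof
      fix z assume "z \<in> {x. \<exists>f. \<nu> f = Fin x}"
      then obtain f where "\<nu> f = Fin z" by blast
      then show "z \<in> \<Phi> ` {x. \<exists>f. \<mu> f = Fin x}" by (cases "\<mu> f") (auto simp: \<nu>_def)
    qed
    show "\<Phi> ` {x. \<exists>f. \<mu> f = Fin x} \<subseteq> {x. \<exists>f. \<nu> f = Fin x}"
    proof clarify
      fix x f assume "\<mu> f = Fin x"
      then have "\<nu> f = Fin (\<Phi> x)" by (simp add: \<nu>_def)
      then show "\<exists>f. \<nu> f = Fin (\<Phi> x)" ..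
    qed
  qed
  moreover have "\<Phi> ` {x. \<exists>f. \<mu> f = Fin x} \<subseteq> carrier R" using A P.hom_closed by blast
  ultimately have "carrier (value_group R \<nu>) = generate R (\<Phi> ` {x. \<exists>f. \<mu> f = Fin x})"
    by (simp add: value_group_def carrier_subgroup_generated Int_absorb1)
  also have "\<dots> = \<Phi> ` generate (value_group G \<mu>) {x. \<exists>f. \<mu> f = Fin x}"
    using P.generate_img[OF A] .
  also have "generate (value_group G \<mu>) {x. \<exists>f. \<mu> f = Fin x} = generate G {x. \<exists>f. \<mu> f = Fin x}"
    by (subst value_group_eq) (rule generate_consistent[OF A value_group_subgroup])
  also have "\<dots> = carrier (value_group G \<mu>)"
  proof -
    have "carrier G \<inter> {x. \<exists>f. \<mu> f = Fin x} = {x. \<exists>f. \<mu> f = Fin x}" using val_closed by auto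
    then show ?thesis by (simp add: value_group_def carrier_subgroup_generated)
  qed
  finally show car: "carrier (value_group R \<nu>) = \<Phi> ` carrier (value_group G \<mu>)" .
  have "\<Phi> \<in> ogroup_iso (value_group G \<mu>) (value_group R \<nu>)"
    using ogroup_embD[OF \<Phi>] car P.emb_inj
    by (auto simp: ogroup_iso_def ogroup_emb_def iso_def hom_def bij_betw_def value_group_def subgroup_generated_def)
  then show "val_equiv G \<mu> R \<nu>" unfolding val_equiv_def \<nu>_def by blast
qed

end

lemma value_group_field_cases:
  fixes v :: "'k::field \<Rightarrow> 'g with_inf"
  assumes "valuation G v" "g \<in> carrier (value_group G v)"
  obtains c where "v c = Fin g"
  using carrier_value_group_field[OF assms(1)] assms(2) by (metis image_eqI imageE)

lemma restriction_embedding: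
  fixes W (structure) and \<mu> :: "'k::field poly \<Rightarrow> 'w with_inf"
  assumes v: "valuation G v" and \<mu>: "valuation W \<mu>" and eq: "val_equiv W (restrict_val \<mu>) G v"
  obtains \<iota> where "ogroup_embedding (value_group G v) W \<iota>" "\<And>c. \<mu> [:c:] = map_with_inf \<iota> (v c)"
proof -
  interpret W: valuation W \<mu> by fact
  interpret v: valuation G v by fact
  let ?A = "{x. \<exists>c. restrict_val \<mu> c = Fin x}"
  define \<Lambda> where "\<Lambda> = carrier (value_group W (restrict_val \<mu>))"
  have A: "?A \<subseteq> carrier W" using W.val_closed by (auto simp: restrict_val_def)
  then have \<Lambda>: "\<Lambda> = generate W ?A"
    by (simp add: \<Lambda>_def value_group_def carrier_subgroup_generated Int_absorb1)
  have sub: "subgroup \<Lambda> W" unfolding \<Lambda> using A by (rule W.generate_is_subgroup)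
  obtain \<phi> where \<phi>: "\<phi> \<in> ogroup_iso (value_group W (restrict_val \<mu>)) (value_group G v)"
    and v\<phi>: "\<And>c. v c = map_with_inf \<phi> (restrict_val \<mu> c)"
    using eq by (auto simp: val_equiv_def)
  have bij: "bij_betw \<phi> \<Lambda> (carrier (value_group G v))"
    using \<phi> by (auto simp: ogroup_iso_def iso_def \<Lambda>_def)
  have hom: "\<phi> (x \<otimes> y) = \<phi> x \<otimes>\<^bsub>value_group G v\<^esub> \<phi> y" "x \<preceq> y \<longleftrightarrow> \<phi> x \<preceq>\<^bsub>value_group G v\<^esub> \<phi> y"
    if "x \<in> \<Lambda>" "y \<in> \<Lambda>" for x y
    using ogroup_embD(2,3)[of \<phi> "value_group W (restrict_val \<mu>)" "value_group G v" x y] \<phi> that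
    by (auto simp: ogroup_iso_def \<Lambda>_def value_group_def subgroup_generated_def)
  define \<iota> where "\<iota> = inv_into \<Lambda> \<phi>"
  have \<iota>: "\<iota> g \<in> \<Lambda>" "\<phi> (\<iota> g) = g" if "g \<in> carrier (value_group G v)" for g
    using that bij unfolding \<iota>_def by (auto simp: bij_betw_def inv_into_into f_inv_into_f)
  have \<iota>\<phi>: "\<iota> (\<phi> x) = x" if "x \<in> \<Lambda>" for x
    using that bij unfolding \<iota>_def by (auto simp: bij_betw_def)
  have "\<iota> \<in> ogroup_emb (value_group G v) W"
    unfolding ogroup_emb_def hom_def
  proof (intro CollectI conjI ballI Pi_I)
    fix g g' assume g: "g \<in> carrier (value_group G v)" "g' \<in> carrier (value_group G v)"
    show "\<iota> g \<in> carrier W" using \<iota>[OF g(1)] sub subgroup.subset by blast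
    have "\<iota> (g \<otimes>\<^bsub>value_group G v\<^esub> g') = \<iota> (\<phi> (\<iota> g \<otimes> \<iota> g'))"
      using hom(1) \<iota> g by simp
    also have "\<dots> = \<iota> g \<otimes> \<iota> g'" using \<iota> g sub by (intro \<iota>\<phi>) (simp add: subgroup.m_closed)
    finally show "\<iota> (g \<otimes>\<^bsub>value_group G v\<^esub> g') = \<iota> g \<otimes> \<iota> g'" .
    show "g \<preceq>\<^bsub>value_group G v\<^esub> g' \<longleftrightarrow> \<iota> g \<preceq> \<iota> g'" using hom(2) \<iota> g by simp
  qed
  moreover have "\<mu> [:c:] = map_with_inf \<iota> (v c)" for c
  proof (cases "\<mu> [:c:]")
    case (Fin a)
    then have "a \<in> \<Lambda>" unfolding \<Lambda> by (auto simp: restrict_val_def intro!: generate.incl)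
    then show ?thesis using v\<phi>[of c] Fin \<iota>\<phi> by (simp add: restrict_val_def)
  qed (use v\<phi>[of c] in \<open>simp add: restrict_val_def\<close>)
  ultimately show ?thesis
    using that W.ordered_comm_group_axioms v.value_group_ordered
    by (meson ogroup_embedding.intro ogroup_embedding_axioms.intro)
qed

text \<open>
  If the value \<open>\<gamma>\<close> is not torsion modulo the values of constants, then in the relation between \<open>\<gamma>\<close>
  and any other value the latter must occur with different exponents on the two sides.
\<close>

lemma values_isolated:
  fixes W (structure) and \<mu> :: "'k::field poly \<Rightarrow> 'w with_inf"
  assumes v: "valuation G v" and \<mu>: "valuation W \<mu>"
    and emb: "ogroup_embedding (value_group G v) W \<iota>" and \<iota>: "\<And>c. \<mu> [:c:] = map_with_inf \<iota> (v c)"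
  obtains "carrier (value_group W \<mu>) \<subseteq> ogroup_embedding.isolated (value_group G v) W \<iota> \<one>"
  | \<gamma> where "\<gamma> \<in> carrier (value_group W \<mu>)"
      "\<And>n g. n > 0 \<Longrightarrow> g \<in> carrier (value_group G v) \<Longrightarrow> \<gamma> [^] (n::nat) \<noteq> \<iota> g"
      "carrier (value_group W \<mu>) \<subseteq> ogroup_embedding.isolated (value_group G v) W \<iota> \<gamma>"
proof -
  interpret W: valuation W \<mu> by fact
  interpret v: valuation G v by fact
  interpret E: ogroup_embedding "value_group G v" W \<iota> by fact
  let ?A = "{x. \<exists>f. \<mu> f = Fin x}"
  let ?\<Gamma> = "value_group G v"
  have A: "?A \<subseteq> carrier W" using W.val_closed by auto
  have gen: "carrier (value_group W \<mu>) \<subseteq> E.isolated x" if "x \<in> carrier W" "?A \<subseteq> E.isolated x" for x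
    using that A W.generate_subgroup_incl[OF that(2) E.isolated_subgroup[OF that(1)]]
    by (simp add: value_group_def carrier_subgroup_generated Int_absorb1)
  show ?thesis
  proof (cases "\<forall>a\<in>?A. \<exists>n>0. \<exists>g\<in>carrier ?\<Gamma>. a [^] (n::nat) = \<iota> g")
    case True
    have "?A \<subseteq> E.isolated \<one>"
    proof
      fix a assume a: "a \<in> ?A"
      then obtain n g where "n > 0" "g \<in> carrier ?\<Gamma>" "a [^] (n::nat) = \<iota> g" using True by blast
      then show "a \<in> E.isolated \<one>"
        unfolding E.isolated_def using A a E.comb_zero[OF W.one_closed, of g]
        by (auto intro!: exI[of _ n] exI[of _ "0::int"] bexI[of _ g])
    qed
    then show ?thesis using that(1) gen by blast
  next
    case False
    then obtain a f where a: "\<mu> f = Fin a"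
      and nt: "\<And>n g. n > 0 \<Longrightarrow> g \<in> carrier ?\<Gamma> \<Longrightarrow> a [^] (n::nat) \<noteq> \<iota> g" by blast
    have aW: "a \<in> carrier W" using a W.val_closed by blast
    have "?A \<subseteq> E.isolated a"
    proof
      fix b assume "b \<in> ?A"
      then obtain g where b: "\<mu> g = Fin b" by blast
      have bW: "b \<in> carrier W" using b W.val_closed by blast
      have const: "\<exists>g\<in>carrier ?\<Gamma>. x = \<iota> g" if "\<mu> [:c:] = Fin x" for c x
        using that \<iota>[of c] v.value_in_value_group[of c] by (cases "v c") auto
      have main: "b \<in> E.isolated a"
        if ne: "(i, j) \<noteq> (i', j')" and le: "j' \<le> j" and k: "k \<in> carrier ?\<Gamma>" "k' \<in> carrier ?\<Gamma>"
          and e: "\<iota> k \<otimes> (a [^] i \<otimes> b [^] j) = \<iota> k' \<otimes> (a [^] i' \<otimes> b [^] j')"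
        for i j i' j' :: nat and k k'
      proof -
        let ?c = "E.comb a (int i) k" and ?c' = "E.comb a (int i') k'"
        let ?m = "int i' - int i" and ?g = "k' \<otimes>\<^bsub>?\<Gamma>\<^esub> inv\<^bsub>?\<Gamma>\<^esub> k"
        have c: "?c \<in> carrier W" "?c' \<in> carrier W" using aW k by (simp_all add: E.comb_closed)
        obtain n where n: "j = n + j'" using le by (metis le_add_diff_inverse2)
        have "b [^] j = b [^] n \<otimes> b [^] j'" using bW n by (simp add: W.nat_pow_mult)
        then have "(b [^] n \<otimes> ?c) \<otimes> b [^] j' = ?c' \<otimes> b [^] j'"
          using e aW bW k by (simp add: E.comb_def int_pow_int W.m_ac)
        then have "b [^] n \<otimes> ?c = ?c'" using bW c by simp
        then have "b [^] n = ?c' \<otimes> inv ?c" using bW c W.inv_solve_right by simp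
        also have "\<dots> = E.comb a ?m ?g"
          using aW k E.comb_mult[of a k' "inv\<^bsub>?\<Gamma>\<^esub> k" "int i'" "- int i"] by (simp add: E.comb_inv)
        finally have bc: "b [^] n = E.comb a ?m ?g" .
        have g: "?g \<in> carrier ?\<Gamma>" using k E.G.m_closed E.G.inv_closed by blast
        show ?thesis
        proof (cases "n = 0")
          case False
          then show ?thesis unfolding E.isolated_def using bc g bW by blast
        next
          case True
          have tors: False if "g \<in> carrier ?\<Gamma>" "p > 0" "\<one> = E.comb a (int p) g" for g p
          proof -
            have "a [^] p = inv (\<iota> g)"
              using that aW W.inv_equality[of "a [^] p" "\<iota> g"] by (simp add: E.comb_def int_pow_int)
            then show False using nt[OF that(2), of "inv\<^bsub>?\<Gamma>\<^esub> g"] that(1) E.hom_inv[of g] by simp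
          qed
          have o: "\<one> = E.comb a ?m ?g" using bc True by simp
          have "\<one> = E.comb a (- ?m) (inv\<^bsub>?\<Gamma>\<^esub> ?g)"
            using E.comb_inv[OF aW g, of ?m] unfolding o[symmetric] by simp
          note o this
          moreover have "i \<noteq> i'" using ne n True by simp
          ultimately show ?thesis
            using tors[of ?g "i' - i"] tors[of "inv\<^bsub>?\<Gamma>\<^esub> ?g" "i - i'"] g E.G.inv_closed[OF g]
            by (cases "i < i'") (auto simp: of_nat_diff)
        qed
      qed
      obtain i j i' j' :: nat and c c' x x' where r: "(i, j) \<noteq> (i', j')" "\<mu> [:c:] = Fin x" "\<mu> [:c':] = Fin x'"
        "x \<otimes> (a [^] i \<otimes> b [^] j) = x' \<otimes> (a [^] i' \<otimes> b [^] j')"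
        by (rule rational_rank_le_one[OF \<mu> a b])
      obtain k k' where k: "k \<in> carrier ?\<Gamma>" "x = \<iota> k" "k' \<in> carrier ?\<Gamma>" "x' = \<iota> k'"
        using const[OF r(2)] const[OF r(3)] by blast
      show "b \<in> E.isolated a"
      proof (cases "j' \<le> j")
        case True
        then show ?thesis using main[OF r(1) True k(1,3)] r(4) k by blast
      next
        case False
        then show ?thesis using main[of i' j' i j k' k] r(1,4) k by auto
      qed
    qed
    then show ?thesis using that(2)[of a] gen[OF aW] nt W.value_in_value_group[OF a] by blast
  qed
qed

section \<open>The cut of a value over the divisible hull\<close>

context hahn_embedded
begin

abbreviation "R \<equiv> R_cut \<Gamma>"

lemma R_carrier: "carrier R = carrier (hahn_real C)"
  by (simp add: R_cut_def)

lemma R_mult: "f \<in> carrier R \<Longrightarrow> g \<in> carrier R \<Longrightarrow> (f \<otimes>\<^bsub>R\<^esub> g) k = f k + g k"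
  by (simp add: R_cut_def R.carrier_hahn)

lemma R_one: "\<one>\<^bsub>R\<^esub> k = 0"
  by (simp add: R_cut_def)

lemma R_inv:
  assumes "f \<in> carrier R"
  shows "(inv\<^bsub>R\<^esub> f) k = - f k"
proof -
  have "(inv\<^bsub>R\<^esub> f \<otimes>\<^bsub>R\<^esub> f) k = 0" using assms by (simp add: R_one)
  then show ?thesis using R_mult[of "inv\<^bsub>R\<^esub> f" f k] assms by simp
qed

lemma R_pow: "f \<in> carrier R \<Longrightarrow> (f [^]\<^bsub>R\<^esub> (n::nat)) k = real n * f k"
  by (induction n) (simp_all add: R_one R_mult algebra_simps)

lemma R_int_pow:
  assumes "f \<in> carrier R"
  shows "(f [^]\<^bsub>R\<^esub> (m::int)) k = real_of_int m * f k"
proof (cases m)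
  case (nonneg n)
  then show ?thesis using R_pow[OF assms, of n k] by (simp add: int_pow_int)
next
  case (neg n)
  have "(f [^]\<^bsub>R\<^esub> m) k = - (f [^]\<^bsub>R\<^esub> Suc n) k"
    unfolding neg R.int_pow_neg_int[OF assms] by (rule R_inv) (rule R.nat_pow_closed[OF assms])
  also have "\<dots> = real_of_int m * f k"
    unfolding R_pow[OF assms] neg by (simp add: algebra_simps)
  finally show ?thesis .
qed

lemma R_divisible:
  assumes "f \<in> carrier R" "n > 0"
  shows "\<exists>g\<in>carrier R. g [^]\<^bsub>R\<^esub> (n::nat) = f"
proof
  let ?g = "\<lambda>k. f k / real n"
  show g: "?g \<in> carrier R"
    using assms by (simp add: R_carrier R.carrier_hahn)
  show "?g [^]\<^bsub>R\<^esub> n = f"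
    using R_pow[OF g] assms by (auto simp: fun_eq_iff)
qed

lemma R_gle: "f \<preceq>\<^bsub>R\<^esub> g \<longleftrightarrow> f = g \<or> lex_less C f g"
  unfolding R_cut_def using linear_rel.hahn_real_gle[OF R.linear_rel_axioms] .

sublocale el: ogroup_embedding D R \<l>
  by unfold_locales (rule l_emb)

sublocale th: ogroup_embedding \<Gamma> D "to_hull \<Gamma>"
  by unfold_locales (rule to_hull_emb)

definition to_R :: "'g \<Rightarrow> 'g set cut_idx \<Rightarrow> real" where
  "to_R g = \<l> (to_hull \<Gamma> g)"

sublocale L: ogroup_embedding \<Gamma> R to_R
proof unfold_locales
  show "to_R \<in> ogroup_emb \<Gamma> R"
    unfolding ogroup_emb_def hom_def to_R_def
  proof (intro CollectI conjI ballI Pi_I)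
    fix x y assume "x \<in> carrier \<Gamma>" "y \<in> carrier \<Gamma>"
    then show "x \<preceq> y \<longleftrightarrow> \<l> (to_hull \<Gamma> x) \<preceq>\<^bsub>R\<^esub> \<l> (to_hull \<Gamma> y)"
      using el.emb_gle[of "to_hull \<Gamma> x" "to_hull \<Gamma> y"] th.emb_gle[of x y] by simp
  qed simp_all
qed

lemma to_R_Cut: "to_R g (Cut S) = 0"
  by (simp add: to_R_def)

lemma l_frac_pow:
  assumes "g \<in> carrier \<Gamma>" "n > 0"
  shows "\<l> (frac g n) [^]\<^bsub>R\<^esub> n = to_R g"
  using assms el.emb_pow[of "frac g n" n] by (simp add: frac_closed frac_pow_denominator to_R_def)

text \<open>
  Multiplication by \<open>n\<close> is injective on the Hahn product, so a quotient by \<open>n\<close> is determined there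
  by its multiple.
\<close>

lemma hull_image_iff: "f \<in> hull_image \<Gamma> e h \<longleftrightarrow> f \<in> carrier R \<and> (\<exists>n>0. \<exists>g\<in>carrier \<Gamma>. f [^]\<^bsub>R\<^esub> (n::nat) = to_R g)"
proof
  assume "f \<in> hull_image \<Gamma> e h"
  then obtain X where X: "X \<in> carrier D" "f = \<l> X" by (auto simp: hull_image_def)
  then obtain g n where "g \<in> carrier \<Gamma>" "n > 0" "X = frac g n" by (auto simp: carrier_div_hull)
  then show "f \<in> carrier R \<and> (\<exists>n>0. \<exists>g\<in>carrier \<Gamma>. f [^]\<^bsub>R\<^esub> (n::nat) = to_R g)"
    using X l_closed l_frac_pow by blast
next
  assume "f \<in> carrier R \<and> (\<exists>n>0. \<exists>g\<in>carrier \<Gamma>. f [^]\<^bsub>R\<^esub> (n::nat) = to_R g)"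
  then obtain n g where f: "f \<in> carrier R" "n > 0" "g \<in> carrier \<Gamma>" "f [^]\<^bsub>R\<^esub> (n::nat) = to_R g" by blast
  then have "f = \<l> (frac g n)"
    using l_frac_pow[of g n] R.pow_eq_iff[of f "\<l> (frac g n)" n] l_closed frac_closed by simp
  then show "f \<in> hull_image \<Gamma> e h" using f frac_closed by (auto simp: hull_image_def)
qed

text \<open>
  The lower half of the cut that \<open>\<gamma>\<close> makes in the divisible hull, transported to the Hahn
  product: the quotients \<open>g / n\<close> with \<open>g\<close> at most \<open>n \<gamma>\<close>.
\<close>

definition lower_cut :: "'w ogroup \<Rightarrow> ('g \<Rightarrow> 'w) \<Rightarrow> 'w \<Rightarrow> ('g set cut_idx \<Rightarrow> real) set" where
  "lower_cut W \<iota> \<gamma> = {\<l> (frac g n) | g n. g \<in> carrier \<Gamma> \<and> n > 0 \<and> \<iota> g \<preceq>\<^bsub>W\<^esub> \<gamma> [^]\<^bsub>W\<^esub> (n::nat)}"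

definition no_new_index :: "('g set cut_idx \<Rightarrow> real) \<Rightarrow> bool" where
  "no_new_index x \<longleftrightarrow> (\<forall>S. x (Cut S) = 0)"

text \<open>
  The point \<open>x\<close> differs from the element \<open>g / n\<close> of the divisible hull at the new index \<open>Cut S\<close> first.
\<close>

definition one_new_index :: "('g set cut_idx \<Rightarrow> real) \<Rightarrow> bool" where
  "one_new_index x \<longleftrightarrow>
     (\<exists>S. \<exists>n>0. \<exists>g\<in>carrier \<Gamma>. ofilter I S \<and> x (Cut S) \<noteq> 0 \<and> (\<forall>T. T \<noteq> S \<longrightarrow> x (Cut T) = 0) \<and>
        (\<forall>k. (k, Cut S) \<in> C \<and> k \<noteq> Cut S \<longrightarrow> real n * x k = to_R g k))"

context
  fixes W :: "'w ogroup" and \<iota> \<gamma>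
  assumes W: "ogroup_embedding \<Gamma> W \<iota>" and \<gamma>: "\<gamma> \<in> carrier W"
begin

interpretation W: ogroup_embedding \<Gamma> W \<iota> by (rule W)

lemma cross_gle:
  assumes "g \<in> carrier \<Gamma>" "n > 0" "g' \<in> carrier \<Gamma>" "n' > 0"
    and le: "g' [^]\<^bsub>\<Gamma>\<^esub> n \<preceq>\<^bsub>\<Gamma>\<^esub> g [^]\<^bsub>\<Gamma>\<^esub> n'" and g: "\<iota> g \<preceq>\<^bsub>W\<^esub> \<gamma> [^]\<^bsub>W\<^esub> (n::nat)"
  shows "\<iota> g' \<preceq>\<^bsub>W\<^esub> \<gamma> [^]\<^bsub>W\<^esub> (n'::nat)"
proof -
  have 1: "\<iota> g' [^]\<^bsub>W\<^esub> n \<preceq>\<^bsub>W\<^esub> \<iota> g [^]\<^bsub>W\<^esub> n'"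
    using assms W.emb_gle[of "g' [^]\<^bsub>\<Gamma>\<^esub> n" "g [^]\<^bsub>\<Gamma>\<^esub> n'"] by (simp add: W.emb_pow)
  have 2: "\<iota> g [^]\<^bsub>W\<^esub> n' \<preceq>\<^bsub>W\<^esub> (\<gamma> [^]\<^bsub>W\<^esub> n) [^]\<^bsub>W\<^esub> n'"
    using assms \<gamma> by (intro W.L.pow_mono) auto
  have "\<iota> g' [^]\<^bsub>W\<^esub> n \<preceq>\<^bsub>W\<^esub> (\<gamma> [^]\<^bsub>W\<^esub> n) [^]\<^bsub>W\<^esub> n'"
    by (rule W.L.gle_trans[OF _ _ _ 1 2]) (use assms \<gamma> in auto)
  also have "(\<gamma> [^]\<^bsub>W\<^esub> n) [^]\<^bsub>W\<^esub> n' = (\<gamma> [^]\<^bsub>W\<^esub> n') [^]\<^bsub>W\<^esub> n"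
    using \<gamma> by (simp add: W.L.nat_pow_pow mult.commute)
  finally show ?thesis using assms \<gamma> W.L.pow_gle_iff[of "\<iota> g'" "\<gamma> [^]\<^bsub>W\<^esub> n'" n] by simp
qed

lemma lower_cut_down:
  assumes "g \<in> carrier \<Gamma>" "n > 0" "w \<in> lower_cut W \<iota> \<gamma>" "\<l> (frac g n) \<preceq>\<^bsub>R\<^esub> w"
  shows "\<iota> g \<preceq>\<^bsub>W\<^esub> \<gamma> [^]\<^bsub>W\<^esub> n"
proof -
  obtain g' n' where g': "w = \<l> (frac g' n')" "g' \<in> carrier \<Gamma>" "n' > 0" "\<iota> g' \<preceq>\<^bsub>W\<^esub> \<gamma> [^]\<^bsub>W\<^esub> (n'::nat)"
    using assms(3) by (auto simp: lower_cut_def)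
  have "frac g n \<preceq>\<^bsub>D\<^esub> frac g' n'"
    using assms g' el.emb_gle frac_closed by simp
  then have "g [^]\<^bsub>\<Gamma>\<^esub> n' \<preceq>\<^bsub>\<Gamma>\<^esub> g' [^]\<^bsub>\<Gamma>\<^esub> n" using assms g' by (simp add: div_hull_gle)
  then show ?thesis using cross_gle[OF g'(2,3) assms(1,2)] g'(4) by simp
qed

lemma lower_cut_iff:
  assumes "g \<in> carrier \<Gamma>" "n > 0"
  shows "\<l> (frac g n) \<in> lower_cut W \<iota> \<gamma> \<longleftrightarrow> \<iota> g \<preceq>\<^bsub>W\<^esub> \<gamma> [^]\<^bsub>W\<^esub> n"
proof
  assume "\<l> (frac g n) \<in> lower_cut W \<iota> \<gamma>"
  then show "\<iota> g \<preceq>\<^bsub>W\<^esub> \<gamma> [^]\<^bsub>W\<^esub> n"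
    by (rule lower_cut_down[OF assms]) (use R.gle_refl l_closed frac_closed assms in blast)
qed (use assms in \<open>auto simp: lower_cut_def\<close>)

lemma hull_image_cut_space: "cut_space I (hull_image \<Gamma> e h) (lower_cut W \<iota> \<gamma>)"
proof (intro cut_space.intro cut_space_axioms.intro I.linear_rel_axioms)
  let ?V = "hull_image \<Gamma> e h"
  have V: "f \<in> ?V \<longleftrightarrow> (\<exists>X\<in>carrier D. f = \<l> X)" for f by (auto simp: hull_image_def)
  show "f \<in> carrier (hahn_real C)" if "f \<in> ?V" for f using that l_closed by (auto simp: V R_carrier)
  show "f (Cut S) = 0" if "f \<in> ?V" for f S using that by (auto simp: V)
  show add: "(\<lambda>k. f k + g k) \<in> ?V" if "f \<in> ?V" "g \<in> ?V" for f g
  proof -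
    obtain X Y where X: "X \<in> carrier D" "f = \<l> X" and Y: "Y \<in> carrier D" "g = \<l> Y" using \<open>f \<in> ?V\<close> \<open>g \<in> ?V\<close> V by blast
    then have "(\<lambda>k. f k + g k) = \<l> (X \<otimes>\<^bsub>D\<^esub> Y)"
      by (simp add: fun_eq_iff R_mult l_closed)
    then show ?thesis using X Y V by blast
  qed
  have neg: "(\<lambda>k. - f k) \<in> ?V" if "f \<in> ?V" for f
  proof -
    obtain X where X: "X \<in> carrier D" "f = \<l> X" using \<open>f \<in> ?V\<close> V by blast
    then have "(\<lambda>k. - f k) = \<l> (inv\<^bsub>D\<^esub> X)" by (simp add: R_inv[OF l_closed[OF X(1)], symmetric])
    then show ?thesis using X V by blast
  qed
  show "(\<lambda>k. f k - g k) \<in> ?V" if "f \<in> ?V" "g \<in> ?V" for f g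
    using add[OF that(1) neg[OF that(2)]] by simp
  show "(\<lambda>k. f k / 2) \<in> ?V" if "f \<in> ?V" for f
  proof -
    obtain n g where f: "f \<in> carrier R" "n > 0" "g \<in> carrier \<Gamma>" "f [^]\<^bsub>R\<^esub> (n::nat) = to_R g"
      using \<open>f \<in> ?V\<close> unfolding hull_image_iff by blast
    have f2: "(\<lambda>k. f k / 2) \<in> carrier R" using f(1) by (simp add: R_carrier R.carrier_hahn)
    have "(\<lambda>k. f k / 2) [^]\<^bsub>R\<^esub> (2 * n) = f [^]\<^bsub>R\<^esub> n"
      by (rule ext) (simp add: R_pow f2 f(1))
    then show ?thesis unfolding hull_image_iff using f f2 by (intro conjI exI[of _ "2 * n"] bexI[of _ g]) auto
  qed
  show "\<exists>f\<in>?V. 0 < f (Old i) \<and> (\<forall>j. (j, i) \<in> I \<and> j \<noteq> i \<longrightarrow> f (Old j) = 0)" if "i \<in> Field I" for i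
  proof -
    have iP: "i \<in> Prin \<Gamma>" using that by (simp add: Field_Prin_rel)
    obtain y where y: "y \<in> carrier D" "h y i \<noteq> \<one>\<^bsub>hull_component \<Gamma> i\<^esub>"
      "\<And>j. (j, i) \<in> I \<Longrightarrow> j \<noteq> i \<Longrightarrow> h y j = \<one>\<^bsub>hull_component \<Gamma> j\<^esub>"
      by (rule leading_index[OF iP], rule that)
    have ne: "\<l> y (Old i) \<noteq> 0" using y(1,2) iP l_eq_0_iff by blast
    have z: "\<l> y (Old j) = 0" if "(j, i) \<in> I" "j \<noteq> i" for j
      using y(3)[OF that] l_eq_0_iff[OF y(1)] that by (auto simp: Prin_rel_def)
    have yV: "\<l> y \<in> ?V" using y V by blast
    show ?thesis
    proof (cases "\<l> y (Old i) > 0")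
      case True
      then show ?thesis using z yV by blast
    next
      case False
      then show ?thesis using z ne neg[OF yV] by (intro bexI[of _ "\<lambda>k. - \<l> y k"]) auto
    qed
  qed
  show sub: "lower_cut W \<iota> \<gamma> \<subseteq> ?V" using frac_closed by (auto simp: lower_cut_def hull_image_def)
  show "u \<in> lower_cut W \<iota> \<gamma>" if w: "w \<in> lower_cut W \<iota> \<gamma>" and u: "u \<in> ?V" and uw: "lex_less C u w" for w u
  proof -
    obtain X where X: "X \<in> carrier D" "u = \<l> X" using u unfolding V by blast
    then obtain g n where g: "g \<in> carrier \<Gamma>" "n > 0" "u = \<l> (frac g n)" by (auto simp: carrier_div_hull)
    have "u \<preceq>\<^bsub>R\<^esub> w" using uw by (simp add: R_gle)
    then have "\<iota> g \<preceq>\<^bsub>W\<^esub> \<gamma> [^]\<^bsub>W\<^esub> n" using lower_cut_down[OF g(1,2) w] g(3) by simp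
    then show ?thesis using lower_cut_iff[OF g(1,2)] g(3) by simp
  qed
qed

text \<open>
  If no positive multiple of \<open>\<gamma>\<close> lies in the image of \<open>\<Gamma>\<close>, then the sign of \<open>m \<gamma> + g\<close> only depends
  on the position of the quotient of \<open>- g\<close> by \<open>m\<close> in the cut, so a point in the cut has the signs that
  are required for extending the embedding.
\<close>

lemma realize:
  assumes nt: "\<And>n g. n > 0 \<Longrightarrow> g \<in> carrier \<Gamma> \<Longrightarrow> \<gamma> [^]\<^bsub>W\<^esub> (n::nat) \<noteq> \<iota> g"
  obtains x where "x \<in> carrier R"
    "\<And>m g. g \<in> carrier \<Gamma> \<Longrightarrow> \<one>\<^bsub>W\<^esub> \<preceq>\<^bsub>W\<^esub> W.comb \<gamma> m g \<longleftrightarrow> \<one>\<^bsub>R\<^esub> \<preceq>\<^bsub>R\<^esub> L.comb x m g"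
    "no_new_index x \<or> one_new_index x"
proof -
  interpret cs: cut_space I "hull_image \<Gamma> e h" "lower_cut W \<iota> \<gamma>" by (rule hull_image_cut_space)
  obtain x where x': "x \<in> carrier (hahn_real C)"
    and below: "\<And>w. w \<in> lower_cut W \<iota> \<gamma> \<Longrightarrow> lex_less C w x"
    and above: "\<And>w. w \<in> hull_image \<Gamma> e h \<Longrightarrow> w \<notin> lower_cut W \<iota> \<gamma> \<Longrightarrow> lex_less C x w"
    and cut: "(\<forall>S. x (Cut S) = 0) \<or>
     (\<exists>S. \<exists>g\<in>hull_image \<Gamma> e h. ofilter I S \<and> x (Cut S) \<noteq> 0 \<and> (\<forall>T. T \<noteq> S \<longrightarrow> x (Cut T) = 0) \<and>
        (\<forall>k. (k, Cut S) \<in> C \<and> k \<noteq> Cut S \<longrightarrow> x k = g k))"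
    by (rule cs.cut_realized, rule that)
  have x: "x \<in> carrier R" using x' by (simp add: R_carrier)
  have hasym: "\<not> lex_less C b a" if "lex_less C a b" "a \<in> carrier R" "b \<in> carrier R" for a b
    using linear_rel.lex_less_asym[OF R.linear_rel_axioms] that by (simp add: R_carrier)
  have sign: "(to_R g \<preceq>\<^bsub>R\<^esub> x [^]\<^bsub>R\<^esub> n \<longleftrightarrow> \<iota> g \<preceq>\<^bsub>W\<^esub> \<gamma> [^]\<^bsub>W\<^esub> n) \<and> to_R g \<noteq> x [^]\<^bsub>R\<^esub> n"
    if g: "g \<in> carrier \<Gamma>" and n: "n > 0" for g and n :: nat
  proof -
    let ?w = "\<l> (frac g n)"
    have w: "?w \<in> carrier R" "?w \<in> hull_image \<Gamma> e h" using g n l_closed frac_closed by (auto simp: hull_image_def)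
    have ne: "?w \<noteq> x"
      using below[of ?w] above[OF w(2)] linear_rel.lex_less_irrefl[OF R.linear_rel_axioms] by metis
    have "to_R g \<preceq>\<^bsub>R\<^esub> x [^]\<^bsub>R\<^esub> n \<longleftrightarrow> ?w \<preceq>\<^bsub>R\<^esub> x"
      using R.pow_gle_iff[OF w(1) x n] l_frac_pow[OF g n] by simp
    also have "\<dots> \<longleftrightarrow> ?w \<in> lower_cut W \<iota> \<gamma>"
      using below[of ?w] above[OF w(2)] hasym[of x ?w] w(1) x ne by (auto simp: R_gle)
    also have "\<dots> \<longleftrightarrow> \<iota> g \<preceq>\<^bsub>W\<^esub> \<gamma> [^]\<^bsub>W\<^esub> n" by (rule lower_cut_iff[OF g n])
    finally show ?thesis
      using R.pow_eq_iff[OF w(1) x n] l_frac_pow[OF g n] ne by simp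
  qed
  have compat: "\<one>\<^bsub>W\<^esub> \<preceq>\<^bsub>W\<^esub> W.comb \<gamma> m g \<longleftrightarrow> \<one>\<^bsub>R\<^esub> \<preceq>\<^bsub>R\<^esub> L.comb x m g" if g: "g \<in> carrier \<Gamma>" for m g
  proof -
    have ig: "inv\<^bsub>\<Gamma>\<^esub> g \<in> carrier \<Gamma>" using g by simp
    show ?thesis
    proof (cases m)
      case (nonneg n)
      show ?thesis
      proof (cases "n = 0")
        case True
        then show ?thesis
          using nonneg g W.emb_gle[of \<one> g] L.emb_gle[of \<one> g] \<gamma> x by (simp add: W.comb_zero L.comb_zero)
      next
        case False
        then show ?thesis
          using nonneg W.comb_nonneg_pos[OF \<gamma> g] L.comb_nonneg_pos[OF x g] sign[OF ig] by simp
      qed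
    next
      case (neg k)
      have "\<gamma> [^]\<^bsub>W\<^esub> Suc k \<preceq>\<^bsub>W\<^esub> \<iota> g \<longleftrightarrow> \<not> \<iota> g \<preceq>\<^bsub>W\<^esub> \<gamma> [^]\<^bsub>W\<^esub> Suc k"
        using W.L.gle_total[of "\<gamma> [^]\<^bsub>W\<^esub> Suc k" "\<iota> g"] W.L.gle_antisym[of "\<gamma> [^]\<^bsub>W\<^esub> Suc k" "\<iota> g"]
          nt[OF zero_less_Suc[of k] g] W.hom_closed[OF g] W.L.nat_pow_closed[OF \<gamma>, of "Suc k"] by blast
      moreover have "x [^]\<^bsub>R\<^esub> Suc k \<preceq>\<^bsub>R\<^esub> to_R g \<longleftrightarrow> \<not> to_R g \<preceq>\<^bsub>R\<^esub> x [^]\<^bsub>R\<^esub> Suc k"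
        using R.gle_total[of "x [^]\<^bsub>R\<^esub> Suc k" "to_R g"] R.gle_antisym[of "x [^]\<^bsub>R\<^esub> Suc k" "to_R g"]
          sign[OF g zero_less_Suc[of k]] L.hom_closed[OF g] R.nat_pow_closed[OF x, of "Suc k"] by metis
      ultimately show ?thesis
        unfolding neg W.comb_nonneg_neg[OF \<gamma> g] L.comb_nonneg_neg[OF x g] using sign[OF g zero_less_Suc[of k]] by blast
    qed
  qed
  have "no_new_index x \<or> one_new_index x"
    using cut
  proof (elim disjE exE bexE)
    fix S f assume f: "f \<in> hull_image \<Gamma> e h" and S: "ofilter I S \<and> x (Cut S) \<noteq> 0 \<and> (\<forall>T. T \<noteq> S \<longrightarrow> x (Cut T) = 0) \<and>
        (\<forall>k. (k, Cut S) \<in> C \<and> k \<noteq> Cut S \<longrightarrow> x k = f k)"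
    obtain n g where "f \<in> carrier R" "n > 0" "g \<in> carrier \<Gamma>" "f [^]\<^bsub>R\<^esub> (n::nat) = to_R g"
      using f unfolding hull_image_iff by blast
    then have "n > 0" "g \<in> carrier \<Gamma>" "\<And>k. real n * f k = to_R g k" using R_pow by metis+
    then show ?thesis
      using S unfolding one_new_index_def by (intro disjI2 exI[of _ S] exI[of _ n] conjI bexI[of _ g]) auto
  qed (simp add: no_new_index_def)
  with x compat show ?thesis by (rule that)
qed

end

lemma carrier_hahn_Restr:
  assumes "z \<in> carrier R" "J \<subseteq> Field C" "\<And>k. k \<notin> J \<Longrightarrow> z k = 0"
  shows "z \<in> carrier (hahn_real (Restr C J))"
proof -
  have F: "Field (Restr C J) = J" using assms(2) R.rel_refl by (force simp: Field_def)
  have "{k. z k \<noteq> 0} \<subseteq> J" using assms(3) by blast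
  then have "Restr (Restr C J) {k. z k \<noteq> 0} = Restr C {k. z k \<noteq> 0}" by blast
  then show ?thesis using assms(1,3) by (simp add: R_carrier hahn_def F Let_def)
qed

lemma R_outside:
  assumes "z \<in> carrier R" "k \<notin> Old ` Prin \<Gamma>" "\<And>S. k = Cut S \<Longrightarrow> z k = 0"
  shows "z k = 0"
proof (cases k)
  case (Old i)
  then have "k \<notin> Field C" using assms(2) by (auto simp: Field_Prin_rel)
  then show ?thesis using assms(1) by (simp add: R_carrier R.carrier_hahn)
qed (use assms(3) in simp)

lemma R_oldI:
  assumes "z \<in> carrier R" "\<And>S. z (Cut S) = 0"
  shows "z \<in> R_old \<Gamma>"
  unfolding R_old_def
  by (rule carrier_hahn_Restr[OF assms(1)])
    (use R_outside[OF assms(1)] assms(2) in \<open>auto simp: Field_Prin_rel\<close>)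

lemma R_smeI:
  assumes "z \<in> carrier R" "ofilter I S" "\<And>T. T \<noteq> S \<Longrightarrow> z (Cut T) = 0"
  shows "z \<in> R_sme \<Gamma>"
  unfolding R_sme_def
proof (intro UN_I[of S] carrier_hahn_Restr[OF assms(1)])
  show "Old ` Prin \<Gamma> \<union> {Cut S} \<subseteq> Field C" using assms(2) by (auto simp: Field_Prin_rel)
  show "z k = 0" if "k \<notin> Old ` Prin \<Gamma> \<union> {Cut S}" for k
  proof (rule R_outside[OF assms(1)])
    show "z k = 0" if "k = Cut T" for T using \<open>k \<notin> _\<close> that assms(3)[of T] by auto
  qed (use that in blast)
qed (use assms(2) in simp)

text \<open>
  The element \<open>z\<close> has leading index \<open>Cut S\<close>. Elements of \<open>\<Gamma>\<close> vanish at this index, so those in the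
  convex subgroup generated by \<open>z\<close> belong to the smaller convex subgroup \<open>C'\<close> of all elements that
  vanish at \<open>Cut S\<close> and below. Hence no set of elements of \<open>\<Gamma>\<close> generates the former.
\<close>

lemma not_rank_preserving:
  assumes N: "subgroup N R" and f: "f \<in> ogroup_emb \<Gamma> (R\<lparr>carrier := N\<rparr>)"
    and fL: "\<And>g. g \<in> carrier \<Gamma> \<Longrightarrow> f g = to_R g" and S: "ofilter I S"
    and z: "z \<in> N" "z (Cut S) \<noteq> 0" "\<And>k. (k, Cut S) \<in> C \<Longrightarrow> k \<noteq> Cut S \<Longrightarrow> z k = 0"
  shows "\<not> rank_preserving \<Gamma> (R\<lparr>carrier := N\<rparr>) f"
proof
  let ?L = "R\<lparr>carrier := N\<rparr>"
  assume rank: "rank_preserving \<Gamma> ?L f"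
  interpret L': ordered_comm_group ?L using N by (rule R.subgroup_ordered_comm_group)
  have NR: "N \<subseteq> carrier R" using N by (rule subgroup.subset)
  have conv: "convex_subgroup {w \<in> N. \<forall>j\<in>J. w j = 0} ?L"
    if J: "\<And>i j. i \<in> J \<Longrightarrow> (j, i) \<in> C \<Longrightarrow> j \<in> J" for J
  proof -
    have c: "convex_subgroup {w \<in> carrier R. \<forall>j\<in>J. w j = 0} R"
      using R.vanishing_convex[of J, OF J] by (simp add: R_cut_def)
    have eq: "{w \<in> N. \<forall>j\<in>J. w j = 0} = {w \<in> carrier R. \<forall>j\<in>J. w j = 0} \<inter> N" using NR by blast
    have "subgroup ({w \<in> carrier R. \<forall>j\<in>J. w j = 0} \<inter> N) R"
      using c N by (intro R.subgroups_Inter_pair) (simp_all add: convex_subgroup_def)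
    then have "subgroup {w \<in> N. \<forall>j\<in>J. w j = 0} ?L"
      unfolding eq by (intro R.subgroup_incl) (use N in auto)
    moreover have "y \<in> {w \<in> N. \<forall>j\<in>J. w j = 0}"
      if "x \<in> {w \<in> N. \<forall>j\<in>J. w j = 0}" "y \<in> N" "\<one>\<^bsub>R\<^esub> \<preceq>\<^bsub>R\<^esub> y" "y \<preceq>\<^bsub>R\<^esub> x" for x y
      using c that NR unfolding convex_subgroup_def eq by blast
    ultimately show ?thesis unfolding convex_subgroup_def by simp
  qed
  let ?C = "{w \<in> N. \<forall>j\<in>{j. (j, Cut S) \<in> C \<and> j \<noteq> Cut S}. w j = 0}"
  let ?C' = "{w \<in> N. \<forall>j\<in>{j. (j, Cut S) \<in> C}. w j = 0}"
  have C: "convex_subgroup ?C ?L" by (rule conv) (use R.rel_trans R.rel_antisym in blast)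
  have C': "convex_subgroup ?C' ?L" by (rule conv) (use R.rel_trans in blast)
  have "z \<noteq> \<one>\<^bsub>?L\<^esub>" using z(2) R_one by auto
  then have "convex_hull_group ?L {z} \<in> Prin ?L"
    unfolding Prin_def using z(1) by (intro CollectI exI[of _ z]) simp
  then have "convex_hull_group ?L {z} \<in> (\<lambda>H. convex_hull_group ?L (f ` H)) ` Prin \<Gamma>"
    using rank by (simp add: rank_preserving_def)
  then obtain H where H: "H \<in> Prin \<Gamma>" "convex_hull_group ?L {z} = convex_hull_group ?L (f ` H)"
    by (rule imageE)
  have H\<Gamma>: "H \<subseteq> carrier \<Gamma>"
    using Prin_convex[OF H(1)] subgroup.subset[of H \<Gamma>] by (simp add: convex_subgroup_def)
  have "z \<in> ?C" using z by blast
  then have "f ` H \<subseteq> ?C"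
    using L'.convex_hull_min[OF C, of "{z}"] L'.convex_hull_superset[of "f ` H"] H(2) by blast
  moreover have "f g (Cut S) = 0" if "g \<in> H" for g using that H\<Gamma> fL to_R_Cut by auto
  ultimately have "f ` H \<subseteq> ?C'" by blast
  then have "convex_hull_group ?L (f ` H) \<subseteq> ?C'" by (rule L'.convex_hull_min[OF C'])
  then have "z \<in> ?C'" using H(2) L'.convex_hull_superset[of "{z}"] by blast
  then show False using z(2) S by auto
qed

text \<open>
  Some positive multiple of each element of \<open>N\<close> lies in the image of \<open>\<Gamma>\<close>, and the quotient is unique
  in the Hahn product and belongs to the image of the divisible hull.
\<close>

lemma torsion_in_hull_image:
  assumes N: "subgroup N R" and f: "f \<in> ogroup_emb \<Gamma> (R\<lparr>carrier := N\<rparr>)"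
    and fL: "\<And>g. g \<in> carrier \<Gamma> \<Longrightarrow> f g = to_R g"
    and com: "commensurable_ext \<Gamma> (R\<lparr>carrier := N\<rparr>) f"
  shows "N \<subseteq> hull_image \<Gamma> e h"
proof
  fix z assume z: "z \<in> N"
  let ?L = "R\<lparr>carrier := N\<rparr>"
  interpret L': ordered_comm_group ?L using N by (rule R.subgroup_ordered_comm_group)
  interpret f: ogroup_embedding \<Gamma> ?L f
    by (intro ogroup_embedding.intro ogroup_embedding_axioms.intro ordered_comm_group_axioms
        L'.ordered_comm_group_axioms f)
  let ?F = "f ` carrier \<Gamma>"
  have F: "subgroup ?F ?L" by (rule f.img_is_subgroup)
  interpret F: normal ?F ?L using F by (rule L'.subgroup_imp_normal)
  have zL: "z \<in> carrier ?L" using z by simp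
  have "?F #>\<^bsub>?L\<^esub> z \<in> carrier (?L Mod ?F)" using zL by (auto simp: FactGroup_def RCOSETS_def)
  then obtain n where n: "n > 0" "(?F #>\<^bsub>?L\<^esub> z) [^]\<^bsub>?L Mod ?F\<^esub> (n::nat) = \<one>\<^bsub>?L Mod ?F\<^esub>"
    using com unfolding commensurable_ext_def Let_def by blast
  then have "?F #>\<^bsub>?L\<^esub> (z [^]\<^bsub>?L\<^esub> n) = ?F" using F.FactGroup_pow[OF zL] by (simp add: FactGroup_def)
  then have "z [^]\<^bsub>?L\<^esub> n \<in> ?F" using L'.coset_join1[OF _ _ F] zL L'.nat_pow_closed subgroup.subset[OF F] by blast
  then obtain g where g: "g \<in> carrier \<Gamma>" "z [^]\<^bsub>R\<^esub> n = to_R g"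
    using fL R.nat_pow_consistent[of z n N] by auto
  have "z \<in> carrier R" using z N subgroup.subset by blast
  then show "z \<in> hull_image \<Gamma> e h" unfolding hull_image_iff using n(1) g by blast
qed

end

section \<open>Extensions of a valuation to polynomials\<close>

context hahn_embedded
begin

definition one_new_leading_index :: "('g set cut_idx \<Rightarrow> real) set \<Rightarrow> bool" where
  "one_new_leading_index N \<longleftrightarrow>
     (\<exists>S. ofilter I S \<and> (\<forall>z\<in>N. \<forall>T. T \<noteq> S \<longrightarrow> z (Cut T) = 0) \<and>
        (\<exists>z\<in>N. z (Cut S) \<noteq> 0 \<and> (\<forall>k. (k, Cut S) \<in> C \<and> k \<noteq> Cut S \<longrightarrow> z k = 0)))"

text \<open>
  In the torsion case any embedding is determined by that of \<open>\<Gamma>\<close>, and \<open>\<gamma> = 0\<close> and \<open>x = 0\<close> serve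
  as the additional pair. Otherwise \<open>x\<close> is a point in the cut of a value \<open>\<gamma>\<close>. At a new index all
  coordinates of the image are rational multiples of that of \<open>x\<close>, so at most one new index occurs;
  if it does, \<open>n x - g\<close> has it as leading index for some \<open>n\<close> and \<open>g\<close>, and this is the image of
  \<open>n \<gamma> - g\<close>.
\<close>

lemma embed_value_group:
  fixes v :: "'k::field \<Rightarrow> 'g with_inf" and \<mu> :: "'k poly \<Rightarrow> 'w with_inf"
  assumes v: "valuation G v" and \<Gamma>: "\<Gamma> = value_group G v" and \<mu>: "valuation W \<mu>"
    and emb: "ogroup_embedding \<Gamma> W \<iota>" and \<iota>: "\<And>c. \<mu> [:c:] = map_with_inf \<iota> (v c)"
  obtains \<Phi> where "\<Phi> \<in> ogroup_emb (value_group W \<mu>) R"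
    "\<And>g. g \<in> carrier \<Gamma> \<Longrightarrow> \<Phi> (\<iota> g) = to_R g"
    "(\<forall>z \<in> \<Phi> ` carrier (value_group W \<mu>). no_new_index z) \<or> one_new_leading_index (\<Phi> ` carrier (value_group W \<mu>))"
proof -
  interpret W: valuation W \<mu> by fact
  interpret E: ogroup_embedding \<Gamma> W \<iota> by fact
  let ?\<Lambda> = "carrier (value_group W \<mu>)"
  have \<Lambda>: "subgroup ?\<Lambda> W" by (rule W.value_group_subgroup)
  have \<iota>\<Lambda>: "\<iota> g \<in> ?\<Lambda>" if g: "g \<in> carrier \<Gamma>" for g
  proof -
    obtain c where "v c = Fin g" using value_group_field_cases[OF v] g \<Gamma> by metis
    then show ?thesis using \<iota>[of c] W.value_in_value_group by simp
  qed
  have combR: "L.comb x m g k = real_of_int m * x k + to_R g k" if "x \<in> carrier R" "g \<in> carrier \<Gamma>" for x m g k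
    using that by (simp add: L.comb_def R_mult R_int_pow)
  have "\<exists>\<gamma> x. \<gamma> \<in> carrier W \<and> x \<in> carrier R \<and> ?\<Lambda> \<subseteq> E.isolated \<gamma> \<and>
    (\<forall>m. \<forall>g\<in>carrier \<Gamma>. \<one>\<^bsub>W\<^esub> \<preceq>\<^bsub>W\<^esub> E.comb \<gamma> m g \<longleftrightarrow> \<one>\<^bsub>R\<^esub> \<preceq>\<^bsub>R\<^esub> L.comb x m g) \<and>
    (no_new_index x \<or> \<gamma> \<in> ?\<Lambda> \<and> one_new_index x)"
  proof (rule values_isolated[OF v \<mu> emb[unfolded \<Gamma>] \<iota>], unfold \<Gamma>[symmetric])
    assume iso: "?\<Lambda> \<subseteq> E.isolated \<one>\<^bsub>W\<^esub>"
    have "\<one>\<^bsub>W\<^esub> \<preceq>\<^bsub>W\<^esub> E.comb \<one>\<^bsub>W\<^esub> m g \<longleftrightarrow> \<one>\<^bsub>R\<^esub> \<preceq>\<^bsub>R\<^esub> L.comb \<one>\<^bsub>R\<^esub> m g" if "g \<in> carrier \<Gamma>" for m g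
      using that E.emb_gle[of \<one> g] L.emb_gle[of \<one> g] by (simp add: E.comb_def L.comb_def)
    then show ?thesis
      using iso R_one unfolding no_new_index_def by (intro exI[of _ "\<one>\<^bsub>W\<^esub>"] exI[of _ "\<one>\<^bsub>R\<^esub>"]) simp
  next
    fix \<gamma> assume \<gamma>: "\<gamma> \<in> ?\<Lambda>" and iso: "?\<Lambda> \<subseteq> E.isolated \<gamma>"
      and nt: "\<And>n g. n > 0 \<Longrightarrow> g \<in> carrier \<Gamma> \<Longrightarrow> \<gamma> [^]\<^bsub>W\<^esub> (n::nat) \<noteq> \<iota> g"
    have \<gamma>W: "\<gamma> \<in> carrier W" using \<gamma> \<Lambda> subgroup.subset by blast
    show ?thesis
    proof (rule realize[OF emb \<gamma>W nt])
      fix x assume "x \<in> carrier R"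
        "\<And>m g. g \<in> carrier \<Gamma> \<Longrightarrow> \<one>\<^bsub>W\<^esub> \<preceq>\<^bsub>W\<^esub> E.comb \<gamma> m g \<longleftrightarrow> \<one>\<^bsub>R\<^esub> \<preceq>\<^bsub>R\<^esub> L.comb x m g"
        "no_new_index x \<or> one_new_index x"
      then show ?thesis using \<gamma> \<gamma>W iso by (intro exI[of _ \<gamma>] exI[of _ x]) blast
    qed
  qed
  then obtain \<gamma> x where \<gamma>: "\<gamma> \<in> carrier W" and x: "x \<in> carrier R" and iso: "?\<Lambda> \<subseteq> E.isolated \<gamma>"
    and compat: "\<And>m g. g \<in> carrier \<Gamma> \<Longrightarrow> \<one>\<^bsub>W\<^esub> \<preceq>\<^bsub>W\<^esub> E.comb \<gamma> m g \<longleftrightarrow> \<one>\<^bsub>R\<^esub> \<preceq>\<^bsub>R\<^esub> L.comb x m g"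
    and cut: "no_new_index x \<or> \<gamma> \<in> ?\<Lambda> \<and> one_new_index x"
    by metis
  obtain \<Phi> where \<Phi>: "\<Phi> \<in> ogroup_emb (W\<lparr>carrier := ?\<Lambda>\<rparr>) R"
    and val: "\<And>y n m g. y \<in> ?\<Lambda> \<Longrightarrow> n > 0 \<Longrightarrow> g \<in> carrier \<Gamma> \<Longrightarrow> y [^]\<^bsub>W\<^esub> (n::nat) = E.comb \<gamma> m g \<Longrightarrow>
      \<Phi> y [^]\<^bsub>R\<^esub> n = L.comb x m g"
    by (rule extend_embedding[OF emb L.ogroup_embedding_axioms \<gamma> x compat \<Lambda> iso R_divisible]) blast+
  have \<Phi>R: "\<Phi> y \<in> carrier R" if "y \<in> ?\<Lambda>" for y using ogroup_embD(1)[OF \<Phi>] that by simp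
  have one: "\<Phi> y k = real_of_int m * x k + to_R g k" if "y \<in> ?\<Lambda>" "g \<in> carrier \<Gamma>" "y = E.comb \<gamma> m g" for y m g k
  proof -
    have "y [^]\<^bsub>W\<^esub> (1::nat) = E.comb \<gamma> m g" using that E.comb_closed[OF \<gamma> that(2)] by simp
    from val[OF that(1) _ that(2) this] show ?thesis using \<Phi>R[OF that(1)] combR[OF x that(2)] by simp
  qed
  have const: "\<Phi> (\<iota> g) = to_R g" if "g \<in> carrier \<Gamma>" for g
    using one[OF \<iota>\<Lambda>[OF that] that, of 0] E.comb_zero[OF \<gamma> that] by (simp add: fun_eq_iff)
  have Cut0: "z (Cut T) = 0" if "z \<in> \<Phi> ` ?\<Lambda>" and xT: "x (Cut T) = 0" for z T
  proof -
    obtain y where y: "y \<in> ?\<Lambda>" "z = \<Phi> y" using \<open>z \<in> \<Phi> ` ?\<Lambda>\<close> by blast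
    then obtain n m g where "n > 0" "g \<in> carrier \<Gamma>" "y [^]\<^bsub>W\<^esub> (n::nat) = E.comb \<gamma> m g"
      using iso unfolding E.isolated_def by blast
    then have "n > 0" "(z [^]\<^bsub>R\<^esub> n) (Cut T) = 0"
      using val[OF y(1)] combR[OF x] xT to_R_Cut y(2) by simp_all
    then show ?thesis using R_pow[OF \<Phi>R[OF y(1)]] y(2) by simp
  qed
  have "(\<forall>z \<in> \<Phi> ` ?\<Lambda>. no_new_index z) \<or> one_new_leading_index (\<Phi> ` ?\<Lambda>)"
    using cut[unfolded no_new_index_def one_new_index_def]
  proof (elim disjE exE bexE conjE)
    assume "\<forall>S. x (Cut S) = 0"
    then show ?thesis using Cut0 unfolding no_new_index_def by blast
  next
    fix S n g assume S: "ofilter I S" "x (Cut S) \<noteq> 0" "\<forall>T. T \<noteq> S \<longrightarrow> x (Cut T) = 0"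
      and \<gamma>\<Lambda>: "\<gamma> \<in> ?\<Lambda>" and n: "n > 0" and g: "g \<in> carrier \<Gamma>"
      and lead: "\<forall>k. (k, Cut S) \<in> C \<and> k \<noteq> Cut S \<longrightarrow> real n * x k = to_R g k"
    have ig: "inv g \<in> carrier \<Gamma>" using g by simp
    let ?y = "E.comb \<gamma> (int n) (inv g)"
    have "\<gamma> [^]\<^bsub>W\<^esub> n \<in> ?\<Lambda>" by (induction n) (use \<gamma>\<Lambda> \<Lambda> in \<open>simp_all add: subgroup.m_closed subgroup.one_closed\<close>)
    then have y: "?y \<in> ?\<Lambda>"
      using \<iota>\<Lambda>[OF ig] \<Lambda> by (simp add: E.comb_def int_pow_int subgroup.m_closed)
    have \<Phi>y: "\<Phi> ?y k = real n * x k - to_R g k" for k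
    proof -
      have "to_R (inv g) k = - to_R g k" using L.hom_inv[OF g] R_inv[OF L.hom_closed[OF g]] by simp
      then show ?thesis using one[OF y ig refl] by simp
    qed
    have "\<Phi> ?y (Cut S) \<noteq> 0" unfolding \<Phi>y using S(2) n to_R_Cut by simp
    moreover have "\<forall>k. (k, Cut S) \<in> C \<and> k \<noteq> Cut S \<longrightarrow> \<Phi> ?y k = 0" unfolding \<Phi>y using lead by simp
    ultimately show ?thesis using S y Cut0 unfolding one_new_leading_index_def by blast
  qed
  moreover have "\<Phi> \<in> ogroup_emb (value_group W \<mu>) R" using \<Phi> W.value_group_eq by simp
  ultimately show ?thesis using const by (intro that)
qed

end

theorem proposition5p1:
  fixes G :: "'g ogroup" and v :: "'k::field \<Rightarrow> 'g with_inf"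
    and e :: "'g set \<Rightarrow> ('g \<times> nat) set set \<Rightarrow> real"
    and h :: "('g \<times> nat) set \<Rightarrow> 'g set \<Rightarrow> ('g \<times> nat) set set"
    and W :: "'w ogroup" and \<mu> :: "'k poly \<Rightarrow> 'w with_inf"
  assumes "valuation G v"
    and "hahn_embedding (value_group G v) e h"
    and "valuation W \<mu>"
    and "val_equiv W (restrict_val \<mu>) G v"
  shows "let \<Gamma> = value_group G v in
    \<exists>\<nu> :: 'k poly \<Rightarrow> ('g set cut_idx \<Rightarrow> real) with_inf.
      valuation (R_cut \<Gamma>) \<nu> \<and>
      val_equiv W \<mu> (R_cut \<Gamma>) \<nu> \<and>
      carrier (value_group (R_cut \<Gamma>) \<nu>) \<subseteq> R_sme \<Gamma> \<and>
      (val_commensurable G v (R_cut \<Gamma>) \<nu> \<longrightarrow>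
         carrier (value_group (R_cut \<Gamma>) \<nu>) \<subseteq> hull_image \<Gamma> e h) \<and>
      (val_rank_preserving G v (R_cut \<Gamma>) \<nu> \<longrightarrow>
         carrier (value_group (R_cut \<Gamma>) \<nu>) \<subseteq> R_old \<Gamma>)"
proof -
  define \<Gamma> where "\<Gamma> = value_group G v"
  interpret v: valuation G v by fact
  interpret W: valuation W \<mu> by fact
  interpret hahn_embedded \<Gamma> e h
    using v.value_group_ordered assms(2) unfolding \<Gamma>_def
    by (intro hahn_embedded.intro hahn_embedded_axioms.intro)
  obtain \<iota> where emb: "ogroup_embedding \<Gamma> W \<iota>" and \<iota>: "\<And>c. \<mu> [:c:] = map_with_inf \<iota> (v c)"
    unfolding \<Gamma>_def by (rule restriction_embedding[OF assms(1,3,4)]) blast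
  let ?\<Lambda> = "carrier (value_group W \<mu>)"
  obtain \<Phi> where \<Phi>: "\<Phi> \<in> ogroup_emb (value_group W \<mu>) (R_cut \<Gamma>)"
    and const: "\<And>g. g \<in> carrier \<Gamma> \<Longrightarrow> \<Phi> (\<iota> g) = to_R g"
    and cut: "(\<forall>z \<in> \<Phi> ` ?\<Lambda>. no_new_index z) \<or> one_new_leading_index (\<Phi> ` ?\<Lambda>)"
    by (rule embed_value_group[OF assms(1) \<Gamma>_def assms(3) emb \<iota>], rule that)
  define \<nu> where "\<nu> = (\<lambda>f. map_with_inf \<Phi> (\<mu> f))"
  let ?N = "carrier (value_group (R_cut \<Gamma>) \<nu>)"
  have val: "valuation (R_cut \<Gamma>) \<nu>" and N: "?N = \<Phi> ` ?\<Lambda>" and equiv: "val_equiv W \<mu> (R_cut \<Gamma>) \<nu>"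
    unfolding \<nu>_def by (rule W.map_valuation[OF R.ordered_comm_group_axioms \<Phi>])+
  interpret \<nu>: valuation "R_cut \<Gamma>" \<nu> by fact
  have NR: "subgroup ?N (R_cut \<Gamma>)" by (rule \<nu>.value_group_subgroup)
  have inR: "z \<in> carrier (R_cut \<Gamma>)" if "z \<in> ?N" for z using that NR subgroup.subset by blast
  note eq = \<nu>.value_group_eq
  have ind: "f g = to_R g" if f: "f \<in> induced_emb G v (R_cut \<Gamma>) \<nu>" and g: "g \<in> carrier \<Gamma>" for f g
  proof -
    obtain c where c: "v c = Fin g" using value_group_field_cases[OF assms(1)] g \<Gamma>_def by metis
    have "\<nu> [:c:] = map_with_inf f (v c)" using f by (simp add: induced_emb_def restrict_val_def)
    then show ?thesis using c \<iota>[of c] const[OF g] by (simp add: \<nu>_def)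
  qed
  have sme: "?N \<subseteq> R_sme \<Gamma>"
    using cut unfolding N[symmetric] no_new_index_def one_new_leading_index_def
  proof (elim disjE exE conjE)
    assume "\<forall>z\<in>?N. \<forall>S. z (Cut S) = 0"
    moreover have "ofilter (Prin_rel \<Gamma>) {}" by (simp add: ofilter_def)
    ultimately show ?thesis using R_smeI inR by blast
  next
    fix S assume S: "ofilter (Prin_rel \<Gamma>) S" "\<forall>z\<in>?N. \<forall>T. T \<noteq> S \<longrightarrow> z (Cut T) = 0"
    show ?thesis
    proof
      fix z assume z: "z \<in> ?N"
      show "z \<in> R_sme \<Gamma>" using S(2) z by (intro R_smeI[OF inR[OF z] S(1)]) blast
    qed
  qed
  have com: "?N \<subseteq> hull_image \<Gamma> e h" if "val_commensurable G v (R_cut \<Gamma>) \<nu>"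
  proof -
    obtain f where f: "f \<in> induced_emb G v (R_cut \<Gamma>) \<nu>"
      "commensurable_ext \<Gamma> (value_group (R_cut \<Gamma>) \<nu>) f"
      using \<open>val_commensurable G v (R_cut \<Gamma>) \<nu>\<close> by (auto simp: val_commensurable_def \<Gamma>_def)
    then have "f \<in> ogroup_emb \<Gamma> (value_group (R_cut \<Gamma>) \<nu>)" by (simp add: induced_emb_def \<Gamma>_def)
    then show ?thesis using torsion_in_hull_image[OF NR _ ind[OF f(1)]] f(2) eq by simp
  qed
  have rank: "?N \<subseteq> R_old \<Gamma>" if "val_rank_preserving G v (R_cut \<Gamma>) \<nu>"
    using cut unfolding N[symmetric] no_new_index_def one_new_leading_index_def
  proof (elim disjE exE conjE bexE)
    assume "\<forall>z\<in>?N. \<forall>S. z (Cut S) = 0"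
    then show ?thesis using R_oldI inR by blast
  next
    fix S z assume S: "ofilter (Prin_rel \<Gamma>) S" and z: "z \<in> ?N" "z (Cut S) \<noteq> 0"
      "\<forall>k. (k, Cut S) \<in> cut_rel (Prin_rel \<Gamma>) \<and> k \<noteq> Cut S \<longrightarrow> z k = 0"
    obtain f where f: "f \<in> induced_emb G v (R_cut \<Gamma>) \<nu>"
      "rank_preserving \<Gamma> (value_group (R_cut \<Gamma>) \<nu>) f"
      using \<open>val_rank_preserving G v (R_cut \<Gamma>) \<nu>\<close> by (auto simp: val_rank_preserving_def \<Gamma>_def)
    then have "f \<in> ogroup_emb \<Gamma> (value_group (R_cut \<Gamma>) \<nu>)" by (simp add: induced_emb_def \<Gamma>_def)
    then have False using not_rank_preserving[OF NR _ ind[OF f(1)] S z(1,2)] z(3) f(2) eq by simp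
    then show ?thesis ..
  qed
  show ?thesis
    unfolding Let_def \<Gamma>_def[symmetric] using val equiv sme com rank by blast
qed

end
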